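(* Let $\mathcal{G}$ be a compact simple Lie algebra of rank $l$ and let $\Omega^{(2m-1)}$ be a primitive $(2m-1)$-cocycle on $\mathcal{G}$ (there are $l$ of these, $m=m_1,\dots,m_l$). Then the tensor(s) $t^{(m)}$ given by $$t^{i_1\dots i_m}=[\Omega^{(2m-1)}]^{j_1\dots j_{2m-2}i_m}\,C^{i_1}_{j_1j_2}\cdots C^{i_{m-1}}_{j_{2m-3}j_{2m-2}}$$ are $G$-invariant, (completely) symmetric and primitive. Moreover, for $m>2$ they are traceless: $t_\sigma{}^{\sigma i_3\dots i_m}=0$.
   Context: $\mathcal{G}$ is a compact simple real Lie algebra of rank $l$ with basis $\{X_i\}_{i=1}^r$, $[X_i,X_j]=C_{ij}^kX_k$; repeated indices are summed. The basis is chosen so that the Killing form is a negative multiple of $\delta_{ij}$, so indices are raised and lowered with $\delta_{ij}$ and $C_{ijk}$ is totally antisymmetric. $G$ is the compact group associated with $\mathcal{G}$. A tensor $h_{i_1\dots i_m}$ is $G$-invariant if $\sum_{s=1}^m C^\rho_{\nu i_s} h_{i_1\dots i_{s-1}\rho i_{s+1}\dots i_m}=0$ for all $\nu,i_1,\dots,i_m$. A symmetric invariant tensor of order $m$ is called primitive if it is not a linear combination of symmetrised products of symmetric invariant tensors of lower order (it may contain such non-primitive terms as summands). The algebra of symmetric invariant tensors (invariant polynomials on $\mathcal{G}$) is freely generated by $l$ primitive ones, of orders $m_1,\dots,m_l$. The generalized $\epsilon$ symbol is $\epsilon_{\alpha_1\dots\alpha_n}^{\beta_1\dots\beta_n}=\sum_{\sigma\in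 S_n}\mathrm{sgn}(\sigma)\,\delta_{\alpha_1}^{\beta_{\sigma(1)}}\cdots\delta_{\alpha_n}^{\beta_{\sigma(n)}}$. A primitive $(2m-1)$-cocycle is the skewsymmetric tensor constructed from a (real) primitive symmetric invariant tensor $h$ of order $m$ by $$\Omega^{(2m-1)}_{i_1\dots i_{2m-2}\sigma}=\frac{1}{(2m-1)!}\,\epsilon^{j_1\dots j_{2m-2}\rho}_{i_1\dots i_{2m-2}\sigma}\,C_{j_1j_2}^{l_1}\cdots C_{j_{2m-3}j_{2m-2}}^{l_{m-1}}\,h_{l_1\dots l_{m-1}\rho}.$$ It is a known fact that such $\Omega^{(2m-1)}$ is a nonzero, nontrivial Lie algebra cocycle, and it is an invariant tensor. *)

theory Defs
  imports "HOL-Analysis.Analysis"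
begin

text \<open>The Lie algebra is a whole type \<open>'g\<close> with a bracket \<open>br\<close>.\<close>

definition lie_bracket :: "('g::real_vector \<Rightarrow> 'g \<Rightarrow> 'g) \<Rightarrow> bool" where
  "lie_bracket br \<longleftrightarrow> bilinear br \<and> (\<forall>x. br x x = 0) \<and>
     (\<forall>x y z. br x (br y z) + br y (br z x) + br z (br x y) = 0)"

definition lie_ideal :: "('g::real_vector \<Rightarrow> 'g \<Rightarrow> 'g) \<Rightarrow> 'g set \<Rightarrow> bool" where
  "lie_ideal br I \<longleftrightarrow> subspace I \<and> (\<forall>x. \<forall>y\<in>I. br x y \<in> I)"

definition simple_lie_algebra :: "('g::real_vector \<Rightarrow> 'g \<Rightarrow> 'g) \<Rightarrow> bool" where
  "simple_lie_algebra br \<longleftrightarrow> lie_bracket br \<and> (\<exists>x y. br x y \<noteq> 0) \<and>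
     (\<forall>I. lie_ideal br I \<longrightarrow> I = {0} \<or> I = UNIV)"

definition basis_family :: "('i::finite \<Rightarrow> 'g::real_vector) \<Rightarrow> bool" where
  "basis_family X \<longleftrightarrow> inj X \<and> independent (range X) \<and> span (range X) = UNIV"

definition basis_coord :: "('i::finite \<Rightarrow> 'g::real_vector) \<Rightarrow> 'g \<Rightarrow> 'i \<Rightarrow> real" where
  "basis_coord X v k = representation (range X) v (X k)"

text \<open>\<open>structure_const br X i j k\<close> is $C_{ij}^k$, with $[X_i,X_j]=C_{ij}^k X_k$.\<close>

definition structure_const ::
  "('g::real_vector \<Rightarrow> 'g \<Rightarrow> 'g) \<Rightarrow> ('i::finite \<Rightarrow> 'g) \<Rightarrow> 'i \<Rightarrow> 'i \<Rightarrow> 'i \<Rightarrow> real" where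
  "structure_const br X i j k = basis_coord X (br (X i) (X j)) k"

text \<open>The trace of $\mathrm{ad}_x \circ \mathrm{ad}_y$, computed in the basis \<open>X\<close>; its value does
  not depend on the choice of basis.\<close>

definition killing_form ::
  "('g::real_vector \<Rightarrow> 'g \<Rightarrow> 'g) \<Rightarrow> ('i::finite \<Rightarrow> 'g) \<Rightarrow> 'g \<Rightarrow> 'g \<Rightarrow> real" where
  "killing_form br X x y = (\<Sum>k\<in>UNIV. basis_coord X (br x (br y (X k))) k)"

text \<open>A simple real Lie algebra is compact iff its Killing form is negative definite.\<close>

definition compact_simple_lie_algebra ::
  "('g::real_vector \<Rightarrow> 'g \<Rightarrow> 'g) \<Rightarrow> ('i::finite \<Rightarrow> 'g) \<Rightarrow> bool" where
  "compact_simple_lie_algebra br X \<longleftrightarrow> simple_lie_algebra br \<and> basis_family X \<and>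
     (\<forall>x. x \<noteq> 0 \<longrightarrow> killing_form br X x x < 0)"

definition killing_normalized ::
  "('g::real_vector \<Rightarrow> 'g \<Rightarrow> 'g) \<Rightarrow> ('i::finite \<Rightarrow> 'g) \<Rightarrow> bool" where
  "killing_normalized br X \<longleftrightarrow>
     (\<exists>c>0. \<forall>i j. killing_form br X (X i) (X j) = - c * (if i = j then 1 else 0))"

text \<open>A tensor of order \<open>m\<close> is a function on index lists of which only the values on lists of
  length \<open>m\<close> matter. Since the Killing form is proportional to $\delta_{ij}$, indices are raised
  and lowered with $\delta_{ij}$, so that upper and lower positions are not distinguished.\<close>

type_synonym 'i tensor = "'i list \<Rightarrow> real"

definition invariant_tensor ::
  "('i::finite \<Rightarrow> 'i \<Rightarrow> 'i \<Rightarrow> real) \<Rightarrow> nat \<Rightarrow> 'i tensor \<Rightarrow> bool" where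
  "invariant_tensor C m h \<longleftrightarrow> (\<forall>\<nu> is. length is = m \<longrightarrow>
     (\<Sum>s<m. \<Sum>\<rho>\<in>UNIV. C \<nu> (is ! s) \<rho> * h (is[s := \<rho>])) = 0)"

definition symmetric_tensor :: "nat \<Rightarrow> 'i tensor \<Rightarrow> bool" where
  "symmetric_tensor m h \<longleftrightarrow>
     (\<forall>is \<pi>. length is = m \<longrightarrow> \<pi> permutes {..<m} \<longrightarrow> h (permute_list \<pi> is) = h is)"

definition symmetrize :: "'i tensor \<Rightarrow> 'i tensor" where
  "symmetrize f is =
     (\<Sum>\<pi> | \<pi> permutes {..<length is}. f (permute_list \<pi> is)) / fact (length is)"

text \<open>Tensor product of a list of tensors, each paired with its order.\<close>

fun tensor_prod :: "(nat \<times> 'i tensor) list \<Rightarrow> 'i tensor" where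
  "tensor_prod [] is = 1"
| "tensor_prod ((k, f) # fs) is = f (take k is) * tensor_prod fs (drop k is)"

definition lower_order_factors ::
  "('i::finite \<Rightarrow> 'i \<Rightarrow> 'i \<Rightarrow> real) \<Rightarrow> nat \<Rightarrow> (nat \<times> 'i tensor) list \<Rightarrow> bool" where
  "lower_order_factors C m fs \<longleftrightarrow> sum_list (map fst fs) = m \<and>
     (\<forall>(k, f) \<in> set fs. k < m \<and> symmetric_tensor k f \<and> invariant_tensor C k f)"

definition decomposable_tensor ::
  "('i::finite \<Rightarrow> 'i \<Rightarrow> 'i \<Rightarrow> real) \<Rightarrow> nat \<Rightarrow> 'i tensor \<Rightarrow> bool" where
  "decomposable_tensor C m h \<longleftrightarrow> (\<exists>(N::nat) (c::nat \<Rightarrow> real) F.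
     (\<forall>a<N. lower_order_factors C m (F a)) \<and>
     (\<forall>is. length is = m \<longrightarrow> h is = (\<Sum>a<N. c a * symmetrize (tensor_prod (F a)) is)))"

definition primitive_tensor ::
  "('i::finite \<Rightarrow> 'i \<Rightarrow> 'i \<Rightarrow> real) \<Rightarrow> nat \<Rightarrow> 'i tensor \<Rightarrow> bool" where
  "primitive_tensor C m h \<longleftrightarrow> symmetric_tensor m h \<and> invariant_tensor C m h \<and>
     \<not> decomposable_tensor C m h"

text \<open>$\epsilon_{\alpha_1\dots\alpha_n}^{\beta_1\dots\beta_n}$ for lists \<open>\<alpha>\<close>, \<open>\<beta>\<close> of equal length.\<close>

definition gen_eps :: "'i list \<Rightarrow> 'i list \<Rightarrow> real" where
  "gen_eps \<alpha> \<beta> = (\<Sum>\<sigma> | \<sigma> permutes {..<length \<alpha>}.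
     of_int (sign \<sigma>) * (\<Prod>s<length \<alpha>. if \<alpha> ! s = \<beta> ! \<sigma> s then 1 else 0))"

text \<open>$C_{j_1j_2}^{l_1}\cdots C_{j_{2n-1}j_{2n}}^{l_n}$; list positions start at 0.\<close>

definition C_chain ::
  "('i \<Rightarrow> 'i \<Rightarrow> 'i \<Rightarrow> real) \<Rightarrow> nat \<Rightarrow> 'i list \<Rightarrow> 'i list \<Rightarrow> real" where
  "C_chain C n js ls = (\<Prod>a<n. C (js ! (2 * a)) (js ! (2 * a + 1)) (ls ! a))"

definition cocycle_of ::
  "('i::finite \<Rightarrow> 'i \<Rightarrow> 'i \<Rightarrow> real) \<Rightarrow> nat \<Rightarrow> 'i tensor \<Rightarrow> 'i tensor" where
  "cocycle_of C m h is = 1 / fact (2 * m - 1) *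
     (\<Sum>js | length js = 2 * m - 2. \<Sum>\<rho>\<in>UNIV. \<Sum>ls | length ls = m - 1.
        gen_eps is (js @ [\<rho>]) * C_chain C (m - 1) js ls * h (ls @ [\<rho>]))"

text \<open>\<open>\<Omega>\<close> is a primitive $(2m-1)$-cocycle. No bound on \<open>m\<close> is needed: no tensor of order 0 is
  primitive, as the empty product spans the scalars.\<close>

definition primitive_cocycle ::
  "('i::finite \<Rightarrow> 'i \<Rightarrow> 'i \<Rightarrow> real) \<Rightarrow> nat \<Rightarrow> 'i tensor \<Rightarrow> bool" where
  "primitive_cocycle C m \<Omega> \<longleftrightarrow> (\<exists>h. primitive_tensor C m h \<and>
     (\<forall>is. length is = 2 * m - 1 \<longrightarrow> \<Omega> is = cocycle_of C m h is))"

definition t_tensor ::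
  "('i::finite \<Rightarrow> 'i \<Rightarrow> 'i \<Rightarrow> real) \<Rightarrow> nat \<Rightarrow> 'i tensor \<Rightarrow> 'i tensor" where
  "t_tensor C m \<Omega> is =
     (\<Sum>js | length js = 2 * m - 2. \<Omega> (js @ [is ! (m - 1)]) * C_chain C (m - 1) js is)"

definition traceless_tensor :: "nat \<Rightarrow> 'i::finite tensor \<Rightarrow> bool" where
  "traceless_tensor m t \<longleftrightarrow> (\<forall>is. length is = m - 2 \<longrightarrow> (\<Sum>\<sigma>\<in>UNIV. t (\<sigma> # \<sigma> # is)) = 0)"

end

theory Submission imports Defs begin

text \<open>Contracting $t$ with an invariant tensor $p$ of order $0 < k < m$ evaluates $p$ on $k$ copies of
  the curvature two-form $F^l = C_{ab}^l\theta^a\theta^b$, which vanishes by invariance and the Jacobi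
  identity. Hence $t$ is orthogonal to all decomposable tensors, and for $p = \delta$ it is traceless.
  Symmetry and invariance of $t$ come from the invariance of $\Omega$. If $t$ were decomposable it would
  be orthogonal to itself, so $t = 0$; contracting with the tensor $h$ that defines $\Omega$ gives
  $\langle t, h\rangle = \langle\Omega, \Omega\rangle$ and so $\Omega = 0$.

  It remains to see that $\Omega \neq 0$. The component $h'$ of $h$ orthogonal to the decomposables
  is nonzero, and it is annihilated by every invariant differential operator of order $0 < k < m$. Start with
  $v_0 = h'$ and apply alternately the Koszul operator $\epsilon = \theta^i\partial_{u^i}$ and the inverse of
  the Lie algebra boundary $\partial$ on the invariants in (skew) $\otimes$ (symmetric), that is
  $\partial v_{n+1} = \epsilon v_n$. The equation is solvable because the Casimir operator of the skew
  factor is a homotopy of $\partial$ to zero and is injective on the subspace annihilated by the same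
  differential operators. The pairing of $\Omega$ with the final skew tensor is a positive multiple of
  $\langle h, h'\rangle \neq 0$.\<close>

section \<open>Sums over index lists\<close>

text \<open>Not being decomposable is a negative statement with which one cannot compute. Being
  annihilated by all lower invariants is an equation, and it survives every step of the zigzag: each
  operator either acts on the skew slots only or takes over one symmetric slot, while contractions
  act on the remaining symmetric slots. This is why h is paired with its component h' rather than
  with itself. The zigzag is transgression in the Weil algebra, transposed: the operators act on
  test tensors, and h enters only as a functional evaluated on them. The Koszul operator at stage n
  multiplies the pairing by (m+n)/(m-n). Here m-n counts the symmetric slots left, and m+n = (m-n) +
  2n, where 2n comes from carrying a covector past n curvature contractions. The product over n < m
  is the binomial coefficient of 2m-1 over m, the positive multiple of the overview. The boundary
  has to be inverted only in symmetric degrees strictly between 0 and m, exactly those in which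
  annihilation by lower invariants can be applied to the element itself.\<close>

lemma finite_len [simp]: "finite {xs::'i::finite list. length xs = n}"
  using finite_lists_length_eq[of "UNIV::'i set" n] by simp

lemma sum_len_0 [simp]: "(\<Sum>xs | length xs = 0. f xs) = f []"
  by simp

lemma sum_len_add:
  "(\<Sum>xs::'i::finite list | length xs = p + q. f xs) =
    (\<Sum>xs | length xs = p. \<Sum>ys | length ys = q. (f (xs @ ys) :: real))"
proof -
  have "(\<Sum>xs::'i list | length xs = p + q. f xs)
      = (\<Sum>z \<in> {xs. length xs = p} \<times> {ys. length ys = q}. f (fst z @ snd z))"
    by (rule sum.reindex_bij_witness[where j = "\<lambda>xs. (take p xs, drop p xs)"
          and i = "\<lambda>z. fst z @ snd z"]) auto
  then show ?thesis by (simp add: sum.cartesian_product case_prod_unfold)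
qed

lemma sum_len_1: "(\<Sum>xs::'i::finite list | length xs = Suc 0. f xs) = (\<Sum>k\<in>UNIV. (f [k] :: real))"
  by (rule sum.reindex_bij_witness[where j = hd and i = "\<lambda>k. [k]"]) (auto simp: length_Suc_conv)

lemma sum_len_Suc:
  "(\<Sum>xs::'i::finite list | length xs = Suc n. f xs) =
    (\<Sum>k\<in>UNIV. \<Sum>xs | length xs = n. (f (k # xs) :: real))"
  using sum_len_add[of f "Suc 0" n] by (simp add: sum_len_1)

lemma sum_len_snoc:
  "(\<Sum>xs::'i::finite list | length xs = Suc n. f xs) =
    (\<Sum>xs | length xs = n. \<Sum>k\<in>UNIV. (f (xs @ [k]) :: real))"
  using sum_len_add[of f n "Suc 0"] by (simp add: sum_len_1)

lemma sum4_move: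
  "(\<Sum>a\<in>A. \<Sum>b\<in>B. \<Sum>c\<in>G. \<Sum>d\<in>H. f a b c d) = (\<Sum>b\<in>B. \<Sum>c\<in>G. \<Sum>d\<in>H. \<Sum>a\<in>A. f a b c d)"
proof -
  have "(\<Sum>a\<in>A. \<Sum>b\<in>B. \<Sum>c\<in>G. \<Sum>d\<in>H. f a b c d) = (\<Sum>b\<in>B. \<Sum>a\<in>A. \<Sum>c\<in>G. \<Sum>d\<in>H. f a b c d)"
    by (rule sum.swap)
  also have "\<dots> = (\<Sum>b\<in>B. \<Sum>c\<in>G. \<Sum>a\<in>A. \<Sum>d\<in>H. f a b c d)"
    by (rule sum.cong, rule refl, rule sum.swap)
  also have "\<dots> = (\<Sum>b\<in>B. \<Sum>c\<in>G. \<Sum>d\<in>H. \<Sum>a\<in>A. f a b c d)"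
    by (rule sum.cong, rule refl, rule sum.cong, rule refl, rule sum.swap)
  finally show ?thesis .
qed

lemma sum3_move:
  "(\<Sum>a\<in>A. \<Sum>b\<in>B. \<Sum>c\<in>G. f a b c) = (\<Sum>b\<in>B. \<Sum>c\<in>G. \<Sum>a\<in>A. f a b c)"
proof -
  have "(\<Sum>a\<in>A. \<Sum>b\<in>B. \<Sum>c\<in>G. f a b c) = (\<Sum>b\<in>B. \<Sum>a\<in>A. \<Sum>c\<in>G. f a b c)"
    by (rule sum.swap)
  also have "\<dots> = (\<Sum>b\<in>B. \<Sum>c\<in>G. \<Sum>a\<in>A. f a b c)"
    by (rule sum.cong, rule refl, rule sum.swap)
  finally show ?thesis .
qed

lemma sum3_rot:
  fixes f :: "'i::finite \<Rightarrow> 'i \<Rightarrow> 'i \<Rightarrow> real"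
  shows "(\<Sum>a\<in>UNIV. \<Sum>b\<in>UNIV. \<Sum>c\<in>UNIV. f b c a) = (\<Sum>a\<in>UNIV. \<Sum>b\<in>UNIV. \<Sum>c\<in>UNIV. f a b c)"
proof -
  have "(\<Sum>a\<in>UNIV. \<Sum>b\<in>UNIV. \<Sum>c\<in>UNIV. f b c a) = (\<Sum>b\<in>UNIV. \<Sum>a\<in>UNIV. \<Sum>c\<in>UNIV. f b c a)"
    by (rule sum.swap)
  also have "\<dots> = (\<Sum>b\<in>UNIV. \<Sum>c\<in>UNIV. \<Sum>a\<in>UNIV. f b c a)"
    by (rule sum.cong, rule refl, rule sum.swap)
  finally show ?thesis .
qed

lemma sum3_rev:
  fixes f :: "'i::finite \<Rightarrow> 'i \<Rightarrow> 'i \<Rightarrow> real"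
  shows "(\<Sum>l\<in>UNIV. \<Sum>a\<in>UNIV. \<Sum>b\<in>UNIV. f l a b) = (\<Sum>b\<in>UNIV. \<Sum>a\<in>UNIV. \<Sum>l\<in>UNIV. f l a b)"
proof -
  have "(\<Sum>l\<in>UNIV. \<Sum>a\<in>UNIV. \<Sum>b\<in>UNIV. f l a b) = (\<Sum>l\<in>UNIV. \<Sum>b\<in>UNIV. \<Sum>a\<in>UNIV. f l a b)"
    by (rule sum.cong, rule refl, rule sum.swap)
  also have "\<dots> = (\<Sum>b\<in>UNIV. \<Sum>l\<in>UNIV. \<Sum>a\<in>UNIV. f l a b)" by (rule sum.swap)
  also have "\<dots> = (\<Sum>b\<in>UNIV. \<Sum>a\<in>UNIV. \<Sum>l\<in>UNIV. f l a b)"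
    by (rule sum.cong, rule refl, rule sum.swap)
  finally show ?thesis .
qed

lemma sum2_antisym:
  fixes f :: "'i::finite \<Rightarrow> 'i \<Rightarrow> real"
  assumes "\<And>i k. f i k = - f k i"
  shows "(\<Sum>i\<in>UNIV. \<Sum>k\<in>UNIV. f i k) = 0"
proof -
  have "(\<Sum>i\<in>UNIV. \<Sum>k\<in>UNIV. f i k) = (\<Sum>i\<in>UNIV. \<Sum>k\<in>UNIV. - f k i)" by (simp add: assms[symmetric])
  also have "\<dots> = - (\<Sum>k\<in>UNIV. \<Sum>i\<in>UNIV. f k i)" by (subst sum.swap) (simp add: sum_negf)
  finally show ?thesis by simp
qed

lemma sum_lessThan_add:
  "(\<Sum>a<N1 + N2. g a) = (\<Sum>a<N1. g a) + (\<Sum>a<N2. g (N1 + a))" for g :: "nat \<Rightarrow> real"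
  by (induction N2) (simp_all add: algebra_simps)

section \<open>Operators on tensors\<close>

text \<open>Exterior multiplication by the \<open>i\<close>-th covector. With \<open>g (k # ks)\<close> read as contraction by
  the \<open>k\<close>-th vector, the recursion is the canonical anticommutation relation.\<close>

fun wedge :: "'i \<Rightarrow> 'i tensor \<Rightarrow> 'i tensor" where
  "wedge i g [] = 0"
| "wedge i g (k # ks) = (if k = i then g ks else 0) - wedge i (\<lambda>xs. g (k # xs)) ks"

text \<open>The sum in \<open>invariant_tensor\<close> as a recursion that splits off the first
  slot, so that Leibniz arguments become list inductions.\<close>

fun lie_der :: "('i::finite \<Rightarrow> 'i \<Rightarrow> 'i \<Rightarrow> real) \<Rightarrow> 'i \<Rightarrow> 'i tensor \<Rightarrow> 'i tensor" where
  "lie_der C \<nu> g [] = 0"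
| "lie_der C \<nu> g (k # ks) = (\<Sum>\<rho>\<in>UNIV. C \<nu> k \<rho> * g (\<rho> # ks)) + lie_der C \<nu> (\<lambda>xs. g (k # xs)) ks"

lemma lie_der_nth: "lie_der C \<nu> g is = (\<Sum>s<length is. \<Sum>\<rho>\<in>UNIV. C \<nu> (is ! s) \<rho> * g (is[s := \<rho>]))"
  by (induction "is" arbitrary: g) (simp_all add: sum.lessThan_Suc_shift del: sum.lessThan_Suc)

lemma invariant_tensor_lie_der:
  "invariant_tensor C m h \<longleftrightarrow> (\<forall>\<nu> is. length is = m \<longrightarrow> lie_der C \<nu> h is = 0)"
  by (auto simp: invariant_tensor_def lie_der_nth)

lemma lie_der_cong: "(\<And>xs. length xs = length js \<Longrightarrow> g xs = g' xs) \<Longrightarrow> lie_der C \<nu> g js = lie_der C \<nu> g' js"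
  by (simp add: lie_der_nth)

lemma wedge_cong: "(\<And>xs. Suc (length xs) = length js \<Longrightarrow> g xs = g' xs) \<Longrightarrow> wedge i g js = wedge i g' js"
proof (induction js arbitrary: g g')
  case (Cons k ks)
  have "wedge i (\<lambda>xs. g (k # xs)) ks = wedge i (\<lambda>xs. g' (k # xs)) ks"
    by (rule Cons.IH) (simp add: Cons.prems)
  moreover have "g ks = g' ks" by (rule Cons.prems) simp
  ultimately show ?case by simp
qed simp

lemma lie_der_append:
  "lie_der C \<nu> g (xs @ ys) = lie_der C \<nu> (\<lambda>xs. g (xs @ ys)) xs + lie_der C \<nu> (\<lambda>ys. g (xs @ ys)) ys"
  by (induction xs arbitrary: g) simp_all

lemma wedge_sum: "wedge i (\<lambda>js. \<Sum>x\<in>A. g x js) js = (\<Sum>x\<in>A. wedge i (g x) js)"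
proof (induction js arbitrary: g)
  case (Cons k ks)
  then show ?case by (simp add: sum_subtractf)
qed simp

lemma wedge_scale: "wedge i (\<lambda>js. c * g js) js = c * wedge i g js"
  by (induction js arbitrary: g) (simp_all add: algebra_simps)

lemma wedge_add: "wedge i (\<lambda>js. g js + g' js) js = wedge i g js + wedge i g' js"
  by (induction js arbitrary: g g') (simp_all add: algebra_simps)

lemma wedge_minus: "wedge i (\<lambda>js. - g js) js = - wedge i g js"
  by (induction js arbitrary: g) (simp_all add: algebra_simps)

lemma wedge_diff: "wedge i (\<lambda>js. g js - g' js) js = wedge i g js - wedge i g' js"
  by (induction js arbitrary: g g') (simp_all add: algebra_simps)

lemma wedge_zero: "wedge i (\<lambda>js. 0) js = 0"
  by (induction js) simp_all

lemma lie_der_sum: "lie_der C \<nu> (\<lambda>js. \<Sum>x\<in>A. g x js) js = (\<Sum>x\<in>A. lie_der C \<nu> (g x) js)"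
proof (induction js arbitrary: g)
  case (Cons k ks)
  have "(\<Sum>\<rho>\<in>UNIV. C \<nu> k \<rho> * (\<Sum>x\<in>A. g x (\<rho> # ks)))
      = (\<Sum>x\<in>A. \<Sum>\<rho>\<in>UNIV. C \<nu> k \<rho> * g x (\<rho> # ks))"
    by (simp add: sum_distrib_left) (rule sum.swap)
  with Cons show ?case by (simp add: sum.distrib)
qed simp

lemma lie_der_scale: "lie_der C \<nu> (\<lambda>js. c * g js) js = c * lie_der C \<nu> g js"
  by (induction js arbitrary: g) (simp_all add: algebra_simps sum_distrib_left)

lemma lie_der_add: "lie_der C \<nu> (\<lambda>js. g js + g' js) js = lie_der C \<nu> g js + lie_der C \<nu> g' js"
  by (induction js arbitrary: g g') (simp_all add: algebra_simps sum.distrib)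

lemma lie_der_minus: "lie_der C \<nu> (\<lambda>js. - g js) js = - lie_der C \<nu> g js"
  using lie_der_scale[of C \<nu> "-1" g js] by simp

lemma lie_der_diff: "lie_der C \<nu> (\<lambda>js. g js - g' js) js = lie_der C \<nu> g js - lie_der C \<nu> g' js"
  using lie_der_add[of C \<nu> g "\<lambda>js. - g' js"] by (simp add: lie_der_minus)

lemma lie_der_zero: "lie_der C \<nu> (\<lambda>js. 0) js = 0"
  by (induction js) simp_all

lemma lie_der_wedge_commute:
  "lie_der C \<nu> (\<lambda>us. wedge i (f us) js) us = wedge i (\<lambda>js. lie_der C \<nu> (\<lambda>us. f us js) us) js"
proof (induction js arbitrary: f)
  case (Cons k ks)
  have "lie_der C \<nu> (\<lambda>us. if k = i then f us ks else 0) us = (if k = i then lie_der C \<nu> (\<lambda>us. f us ks) us else 0)"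
    by (simp add: lie_der_zero)
  then show ?case by (simp add: lie_der_diff Cons)
qed (simp add: lie_der_zero)

lemma wedge_anticommute: "wedge i (wedge j g) ks = - wedge j (wedge i g) ks"
proof (induction ks arbitrary: g)
  case (Cons k ks)
  have *: "wedge a (\<lambda>xs. (if P then f xs else 0) - h xs) ks = (if P then wedge a f ks else 0) - wedge a h ks"
    for a P and f h :: "'a tensor"
    by (simp add: wedge_diff wedge_zero wedge_minus)
  show ?case by (simp add: * Cons)
qed simp

text \<open>Adjacent transpositions generate all permutations, and this form passes to tails of
  lists. The condition holds at every length, so a tensor given at one order is cut off by
  \<open>restrict_order\<close> before it can be called skew.\<close>

definition skew :: "'i tensor \<Rightarrow> bool" where
  "skew g \<longleftrightarrow> (\<forall>xs a b ys. g (xs @ a # b # ys) = - g (xs @ b # a # ys))"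

lemma skewD: "skew g \<Longrightarrow> g (a # b # ys) = - g (b # a # ys)"
  unfolding skew_def by (metis append_Nil)

lemma skewD2: "skew g \<Longrightarrow> g (xs @ a # b # ys) = - g (xs @ b # a # ys)"
  unfolding skew_def by metis

lemma skew_Cons: "skew g \<Longrightarrow> skew (\<lambda>xs. g (k # xs))"
  unfolding skew_def by (metis append_Cons)

lemma skew_sum:
  assumes "\<And>x. x \<in> A \<Longrightarrow> skew (g x)" shows "skew (\<lambda>js. \<Sum>x\<in>A. g x js)"
  unfolding skew_def
proof (intro allI)
  fix xs a b ys
  have "(\<Sum>x\<in>A. g x (xs @ a # b # ys)) = (\<Sum>x\<in>A. - g x (xs @ b # a # ys))"
    using assms by (intro sum.cong refl skewD2)
  then show "(\<Sum>x\<in>A. g x (xs @ a # b # ys)) = - (\<Sum>x\<in>A. g x (xs @ b # a # ys))"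
    by (simp add: sum_negf)
qed

lemma skew_scale:
  assumes "skew g" shows "skew (\<lambda>js. c * g js)"
  unfolding skew_def
proof (intro allI)
  fix xs a b ys
  show "c * g (xs @ a # b # ys) = - (c * g (xs @ b # a # ys))"
    using skewD2[OF assms, of xs a b ys] by simp
qed

lemma skew_wedge:
  assumes "skew g" shows "skew (wedge i g)"
  unfolding skew_def
proof (intro allI)
  fix xs a b ys
  show "wedge i g (xs @ a # b # ys) = - wedge i g (xs @ b # a # ys)"
    using assms
  proof (induction xs arbitrary: g)
    case Nil
    have "(\<lambda>xs. g (b # a # xs)) = (\<lambda>xs. - g (a # b # xs))"
      by (rule ext) (rule skewD[OF Nil])
    then have e: "wedge i (\<lambda>xs. g (b # a # xs)) ys = - wedge i (\<lambda>xs. g (a # b # xs)) ys"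
      by (simp add: wedge_minus)
    show ?case unfolding append_Nil wedge.simps e by simp
  next
    case (Cons k xs)
    then show ?case using Cons.IH[OF skew_Cons[OF Cons.prems], of k] skewD2[OF Cons.prems, of xs a b ys]
      by simp
  qed
qed

lemma skew_lie_der:
  assumes "skew g" shows "skew (lie_der C \<nu> g)"
  unfolding skew_def
proof (intro allI)
  fix xs a b ys
  show "lie_der C \<nu> g (xs @ a # b # ys) = - lie_der C \<nu> g (xs @ b # a # ys)"
    using assms
  proof (induction xs arbitrary: g)
    case Nil
    note * = skewD[OF Nil]
    have "(\<lambda>xs. g (b # a # xs)) = (\<lambda>xs. - g (a # b # xs))"
      by (rule ext) (rule *)
    then have "lie_der C \<nu> (\<lambda>xs. g (b # a # xs)) ys = - lie_der C \<nu> (\<lambda>xs. g (a # b # xs)) ys"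
      by (simp add: lie_der_minus)
    moreover have "(\<Sum>\<rho>\<in>UNIV. C \<nu> a \<rho> * g (b # \<rho> # ys)) = - (\<Sum>\<rho>\<in>UNIV. C \<nu> a \<rho> * g (\<rho> # b # ys))"
       "(\<Sum>\<rho>\<in>UNIV. C \<nu> b \<rho> * g (a # \<rho> # ys)) = - (\<Sum>\<rho>\<in>UNIV. C \<nu> b \<rho> * g (\<rho> # a # ys))"
      by (simp_all only: *[of b] *[of a] mult_minus_right sum_negf)
    ultimately show ?case by simp
  next
    case (Cons k xs)
    have "g (\<rho> # xs @ a # b # ys) = - g (\<rho> # xs @ b # a # ys)" for \<rho>
      using skewD2[OF Cons.prems, of "\<rho> # xs" a b ys] by simp
    then show ?case using Cons.IH[OF skew_Cons[OF Cons.prems], of k]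
      by (simp add: sum_negf )
  qed
qed

section \<open>Curvature contractions and the Lie algebra boundary\<close>

locale antisym_lie_constants =
  fixes C :: "'i::finite \<Rightarrow> 'i \<Rightarrow> 'i \<Rightarrow> real"
  assumes C_swap12: "C a b c = - C b a c"
    and C_swap23: "C a b c = - C a c b"
    and jacobi: "(\<Sum>s\<in>UNIV. C a b s * C s c d + C b c s * C s a d + C c a s * C s b d) = 0"
begin

lemma C_cycle: "C a b c = C b c a"
  by (metis C_swap12 C_swap23)

lemma C_diag [simp]: "C a a c = 0" "C a b b = 0"
  using C_swap12[of a a c] C_swap23[of a b b] by auto

lemma jacobi_lie_der: "(\<Sum>s\<in>UNIV. C \<nu> a s * C \<mu> s d) - (\<Sum>s\<in>UNIV. C \<mu> a s * C \<nu> s d)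
  = - (\<Sum>s\<in>UNIV. C \<nu> \<mu> s * C s a d)"
proof -
  have 1: "C \<mu> a s * C s \<nu> d = - (C \<mu> a s * C \<nu> s d)" "C a \<nu> s * C s \<mu> d = C \<nu> a s * C \<mu> s d" for s
    using C_swap12[of s \<nu> d] C_swap12[of a \<nu> s] C_swap12[of s \<mu> d] by auto
  show ?thesis using jacobi[of \<nu> \<mu> a d] by (simp add: sum.distrib sum_subtractf 1 sum_negf)
qed

text \<open>The Jacobi identity read as invariance of the tensor \<open>C\<close>: rotating its two
  lower indices amounts to rotating the upper one.\<close>

lemma jacobi_Q: "(\<Sum>s\<in>UNIV. C s b l * C \<nu> s a) + (\<Sum>s\<in>UNIV. C a s l * C \<nu> s b)
  = (\<Sum>s\<in>UNIV. C \<nu> l s * C a b s)"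
proof -
  have 1: "C a b s * C s \<nu> l = C \<nu> l s * C a b s"
    "C b \<nu> s * C s a l = - (C a s l * C \<nu> s b)" "C \<nu> a s * C s b l = - (C s b l * C \<nu> s a)" for s
    using C_cycle[of s \<nu> l] C_cycle[of b \<nu> s]  C_swap12[of s a l] C_swap23[of \<nu> s b] C_swap23[of \<nu> a s]
    by (auto simp: algebra_simps)
  show ?thesis using jacobi[of a b \<nu> l] by (simp add: sum.distrib sum_subtractf 1 sum_negf)
qed

abbreviation D where "D \<equiv> lie_der C"

text \<open>\<open>Q l\<close> is the adjoint of multiplication by the two-form $C_{ab}^l\theta^a\theta^b$, and
  \<open>bdry\<close> is, up to a factor, the adjoint of the Chevalley-Eilenberg differential.\<close>

definition Q :: "'i \<Rightarrow> 'i tensor \<Rightarrow> 'i tensor" where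
  "Q l g js = (\<Sum>a\<in>UNIV. \<Sum>b\<in>UNIV. C a b l * g (a # b # js))"

fun Qs :: "'i list \<Rightarrow> 'i tensor \<Rightarrow> 'i tensor" where
  "Qs [] g = g"
| "Qs (l # ls) g = Qs ls (Q l g)"

definition bdry :: "'i tensor \<Rightarrow> 'i tensor" where
  "bdry g js = (\<Sum>c\<in>UNIV. wedge c (Q c g) js)"

lemma Q_sum: "Q l (\<lambda>js. \<Sum>x\<in>A. g x js) = (\<lambda>js. \<Sum>x\<in>A. Q l (g x) js)"
proof
  fix js
  have "(\<Sum>a\<in>UNIV. \<Sum>b\<in>UNIV. \<Sum>x\<in>A. C a b l * g x (a # b # js)) =
     (\<Sum>a\<in>UNIV. \<Sum>x\<in>A. \<Sum>b\<in>UNIV. C a b l * g x (a # b # js))"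
    by (rule sum.cong, rule refl, rule sum.swap)
  also have "\<dots> = (\<Sum>x\<in>A. \<Sum>a\<in>UNIV. \<Sum>b\<in>UNIV. C a b l * g x (a # b # js))"
    by (rule sum.swap)
  finally show "Q l (\<lambda>js. \<Sum>x\<in>A. g x js) js = (\<Sum>x\<in>A. Q l (g x) js)"
    by (simp add: Q_def sum_distrib_left)
qed

lemma Q_scale: "Q l (\<lambda>js. c * g js) = (\<lambda>js. c * Q l g js)"
  by (rule ext) (simp add: Q_def sum_distrib_left algebra_simps)

lemma Q_add: "Q l (\<lambda>js. g js + g' js) = (\<lambda>js. Q l g js + Q l g' js)"
  by (rule ext) (simp add: Q_def sum.distrib algebra_simps)

lemma Qs_sum: "Qs ls (\<lambda>js. \<Sum>x\<in>A. g x js) = (\<lambda>js. \<Sum>x\<in>A. Qs ls (g x) js)"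
  by (induction ls arbitrary: g) (simp_all add: Q_sum)

lemma Qs_scale: "Qs ls (\<lambda>js. c * g js) = (\<lambda>js. c * Qs ls g js)"
  by (induction ls arbitrary: g) (simp_all add: Q_scale)

lemma Qs_add: "Qs ls (\<lambda>js. g js + g' js) = (\<lambda>js. Qs ls g js + Qs ls g' js)"
  by (induction ls arbitrary: g g') (simp_all add: Q_add)

lemma Qs_zero: "Qs ls (\<lambda>js. 0) = (\<lambda>js. 0)"
  using Qs_scale[of ls 0 "\<lambda>_. 0"] by simp

lemma Qs_append: "Qs (ls @ ls') g = Qs ls' (Qs ls g)"
  by (induction ls arbitrary: g) simp_all

lemma bdry_sum: "bdry (\<lambda>js. \<Sum>x\<in>A. g x js) = (\<lambda>js. \<Sum>x\<in>A. bdry (g x) js)"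
  by (rule ext, simp add: bdry_def Q_sum wedge_sum) (rule sum.swap)

lemma bdry_scale: "bdry (\<lambda>js. c * g js) = (\<lambda>js. c * bdry g js)"
  by (rule ext) (simp add: bdry_def Q_scale wedge_scale sum_distrib_left)

lemma Q_Cons:
  assumes "skew g" shows "Q l g (k # js) = Q l (\<lambda>xs. g (k # xs)) js"
proof -
  have "g (a # b # k # js) = g (k # a # b # js)" for a b
    using skewD2[OF assms, of "[a]" b k js] skewD2[OF assms, of "[]" a k "b # js"] by simp
  then show ?thesis by (simp add: Q_def)
qed

lemma skew_Q:
  assumes "skew g" shows "skew (Q l g)"
proof -
  have *: "g (c # d # xs @ a # b # ys) = - g (c # d # xs @ b # a # ys)" for a b c d xs ys
    using skewD2[OF assms, of "c # d # xs" a b ys] by simp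
  show ?thesis unfolding skew_def Q_def
  proof (intro allI)
    fix xs a b ys
    show "(\<Sum>c\<in>UNIV. \<Sum>d\<in>UNIV. C c d l * g (c # d # xs @ a # b # ys)) =
      - (\<Sum>c\<in>UNIV. \<Sum>d\<in>UNIV. C c d l * g (c # d # xs @ b # a # ys))"
      by (subst *) (simp add: sum_negf)
  qed
qed

lemma skew_Qs: "skew g \<Longrightarrow> skew (Qs ls g)"
  by (induction ls arbitrary: g) (simp_all add: skew_Q)

lemma Qs_Cons: "skew g \<Longrightarrow> Qs ls g (k # js) = Qs ls (\<lambda>xs. g (k # xs)) js"
proof (induction ls arbitrary: g)
  case (Cons l ls)
  have "(\<lambda>xs. Q l g (k # xs)) = Q l (\<lambda>xs. g (k # xs))"
    using Q_Cons[OF Cons.prems] by auto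
  then show ?case using Cons.IH[OF skew_Q[OF Cons.prems]] by simp
qed simp

text \<open>Two-forms are even: moving the pair a, b past the pair c, d takes four transpositions
  and costs no sign.\<close>

lemma Q_commute:
  assumes "skew g" shows "Q l (Q k g) = Q k (Q l g)"
proof
  fix js
  have *: "g (a # b # c # d # js) = g (c # d # a # b # js)" for a b c d
    using skewD2[OF assms, of "[a]" b c "d#js"] skewD2[OF assms, of "[a,c]" b d js]
      skewD2[OF assms, of "[]" a c "d#b#js"] skewD2[OF assms, of "[c]" a d "b#js"]
    unfolding append.simps by linarith
  have "Q l (Q k g) js = (\<Sum>c\<in>UNIV. \<Sum>d\<in>UNIV. \<Sum>a\<in>UNIV. \<Sum>b\<in>UNIV. C c d l * (C a b k * g (a # b # c # d # js)))"
    by (simp add: Q_def sum_distrib_left)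
  also have "\<dots> = (\<Sum>(c,d)\<in>UNIV. \<Sum>(a,b)\<in>UNIV. C c d l * (C a b k * g (a # b # c # d # js)))"
    by (simp add: UNIV_Times_UNIV[symmetric] sum.cartesian_product[symmetric] del: UNIV_Times_UNIV)
  also have "\<dots> = (\<Sum>(a,b)\<in>UNIV. \<Sum>(c,d)\<in>UNIV. C c d l * (C a b k * g (a # b # c # d # js)))"
    unfolding case_prod_unfold by (rule sum.swap)
  also have "\<dots> = (\<Sum>(a,b)\<in>UNIV. \<Sum>(c,d)\<in>UNIV. C a b k * (C c d l * g (c # d # a # b # js)))"
    by (subst *) (simp add: mult.left_commute)
  also have "\<dots> = (\<Sum>a\<in>UNIV. \<Sum>b\<in>UNIV. \<Sum>c\<in>UNIV. \<Sum>d\<in>UNIV. C a b k * (C c d l * g (c # d # a # b # js)))"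
    by (simp add: UNIV_Times_UNIV[symmetric] sum.cartesian_product[symmetric] del: UNIV_Times_UNIV)
  also have "\<dots> = Q k (Q l g) js"
    by (simp add: Q_def sum_distrib_left)
  finally show "Q l (Q k g) js = Q k (Q l g) js" .
qed

text \<open>The adjoint form of $d(C_{ab}^k\theta^a\theta^b) = 0$: the Jacobi identity gives each cyclic sum
  over the three contracted indices the value zero.\<close>

lemma sum_C_Q_Cons:
  assumes "skew g"
  shows "(\<Sum>a\<in>UNIV. \<Sum>l\<in>UNIV. C a l k * Q l g (a # js)) = 0"
proof -
  define G where "G a b c = (\<Sum>l\<in>UNIV. C a l k * C b c l) * g (b # c # a # js)" for a b c
  have rot: "g (b # c # a # js) = g (a # b # c # js)" for a b c
    using skewD2[OF assms, of "[b]" c a js] skewD2[OF assms, of "[]" b a "c # js"] by simp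
  have "(\<Sum>a\<in>UNIV. \<Sum>l\<in>UNIV. C a l k * Q l g (a # js))
    = (\<Sum>a\<in>UNIV. \<Sum>l\<in>UNIV. \<Sum>b\<in>UNIV. \<Sum>c\<in>UNIV. C a l k * C b c l * g (b # c # a # js))"
    by (simp add: Q_def sum_distrib_left algebra_simps)
  also have "\<dots> = (\<Sum>a\<in>UNIV. \<Sum>b\<in>UNIV. \<Sum>l\<in>UNIV. \<Sum>c\<in>UNIV. C a l k * C b c l * g (b # c # a # js))"
    by (rule sum.cong, rule refl, rule sum.swap)
  also have "\<dots> = (\<Sum>a\<in>UNIV. \<Sum>b\<in>UNIV. \<Sum>c\<in>UNIV. G a b c)"
    unfolding G_def sum_distrib_right by (rule sum.cong, rule refl, rule sum.cong, rule refl, rule sum.swap)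
  finally have eq: "(\<Sum>a\<in>UNIV. \<Sum>l\<in>UNIV. C a l k * Q l g (a # js)) = (\<Sum>a\<in>UNIV. \<Sum>b\<in>UNIV. \<Sum>c\<in>UNIV. G a b c)" .
  have cyc: "G a b c + G b c a + G c a b = 0" for a b c
  proof -
    have "(\<Sum>l\<in>UNIV. C a l k * C b c l) + (\<Sum>l\<in>UNIV. C b l k * C c a l) + (\<Sum>l\<in>UNIV. C c l k * C a b l)
       = - (\<Sum>s\<in>UNIV. C a b s * C s c k + C b c s * C s a k + C c a s * C s b k)"
      unfolding sum.distrib[symmetric] sum_negf[symmetric]
      by (intro sum.cong refl) (simp add: C_swap12[of _ a k] C_swap12[of _ b k] C_swap12[of _ c k] algebra_simps)
    then have *: "(\<Sum>l\<in>UNIV. C a l k * C b c l) + (\<Sum>l\<in>UNIV. C b l k * C c a l) + (\<Sum>l\<in>UNIV. C c l k * C a b l) = 0"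
      by (simp add: jacobi)
    have "G a b c + G b c a + G c a b = ((\<Sum>l\<in>UNIV. C a l k * C b c l) + (\<Sum>l\<in>UNIV. C b l k * C c a l) + (\<Sum>l\<in>UNIV. C c l k * C a b l)) * g (a # b # c # js)"
      using rot[of b c a] rot[of c a b] by (simp add: G_def algebra_simps)
    then show ?thesis by (simp add: *)
  qed
  have "0 = (\<Sum>a\<in>UNIV. \<Sum>b\<in>UNIV. \<Sum>c\<in>UNIV. G a b c + G b c a + G c a b)"
    by (simp add: cyc)
  also have "\<dots> = (\<Sum>a\<in>UNIV. \<Sum>b\<in>UNIV. \<Sum>c\<in>UNIV. G a b c) + (\<Sum>a\<in>UNIV. \<Sum>b\<in>UNIV. \<Sum>c\<in>UNIV. G b c a)
     + (\<Sum>a\<in>UNIV. \<Sum>b\<in>UNIV. \<Sum>c\<in>UNIV. G c a b)"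
    by (simp add: sum.distrib)
  also have "\<dots> = 3 * (\<Sum>a\<in>UNIV. \<Sum>b\<in>UNIV. \<Sum>c\<in>UNIV. G a b c)"
    using sum3_rot[of G] sum3_rot[of "\<lambda>a b c. G b c a"] by simp
  finally show ?thesis using eq by simp
qed

text \<open>The Lie derivative also acts on the two contracted slots; by \<open>jacobi_Q\<close>
  these terms rotate the label \<open>l\<close>, so that the curvature transforms as a
  vector.\<close>

lemma Q_lie_der: "Q l (D \<nu> g) js = D \<nu> (Q l g) js + (\<Sum>\<rho>\<in>UNIV. C \<nu> l \<rho> * Q \<rho> g js)"
proof -
  have A: "D \<nu> (Q l g) js = (\<Sum>a\<in>UNIV. \<Sum>b\<in>UNIV. C a b l * D \<nu> (\<lambda>xs. g (a # b # xs)) js)"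
    unfolding Q_def by (simp add: lie_der_sum lie_der_scale)
  have "(\<Sum>a\<in>UNIV. \<Sum>b\<in>UNIV. C a b l * (\<Sum>s\<in>UNIV. C \<nu> a s * g (s # b # js)))
     = (\<Sum>a\<in>UNIV. \<Sum>s\<in>UNIV. \<Sum>b\<in>UNIV. C a b l * C \<nu> a s * g (s # b # js))"
    by (simp add: sum_distrib_left algebra_simps, rule sum.cong, rule refl, rule sum.swap)
  also have "\<dots> = (\<Sum>s\<in>UNIV. \<Sum>a\<in>UNIV. \<Sum>b\<in>UNIV. C a b l * C \<nu> a s * g (s # b # js))"
    by (rule sum.swap)
  also have "\<dots> = (\<Sum>s\<in>UNIV. \<Sum>b\<in>UNIV. \<Sum>a\<in>UNIV. C a b l * C \<nu> a s * g (s # b # js))"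
    by (rule sum.cong, rule refl, rule sum.swap)
  finally have B: "(\<Sum>a\<in>UNIV. \<Sum>b\<in>UNIV. C a b l * (\<Sum>s\<in>UNIV. C \<nu> a s * g (s # b # js)))
     = (\<Sum>a\<in>UNIV. \<Sum>b\<in>UNIV. (\<Sum>s\<in>UNIV. C s b l * C \<nu> s a) * g (a # b # js))"
    by (simp add: sum_distrib_right)
  have "(\<Sum>a\<in>UNIV. \<Sum>b\<in>UNIV. C a b l * (\<Sum>s\<in>UNIV. C \<nu> b s * g (a # s # js)))
     = (\<Sum>a\<in>UNIV. \<Sum>s\<in>UNIV. \<Sum>b\<in>UNIV. C a b l * C \<nu> b s * g (a # s # js))"
    by (simp add: sum_distrib_left algebra_simps, rule sum.cong, rule refl, rule sum.swap)
  then have E: "(\<Sum>a\<in>UNIV. \<Sum>b\<in>UNIV. C a b l * (\<Sum>s\<in>UNIV. C \<nu> b s * g (a # s # js)))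
     = (\<Sum>a\<in>UNIV. \<Sum>b\<in>UNIV. (\<Sum>s\<in>UNIV. C a s l * C \<nu> s b) * g (a # b # js))"
    by (simp add: sum_distrib_right)
  have "(\<Sum>\<rho>\<in>UNIV. C \<nu> l \<rho> * Q \<rho> g js)
      = (\<Sum>a\<in>UNIV. \<Sum>\<rho>\<in>UNIV. \<Sum>b\<in>UNIV. C \<nu> l \<rho> * C a b \<rho> * g (a # b # js))"
    unfolding Q_def by (subst sum.swap) (simp add: sum_distrib_left algebra_simps)
  also have "\<dots> = (\<Sum>a\<in>UNIV. \<Sum>b\<in>UNIV. (\<Sum>\<rho>\<in>UNIV. C \<nu> l \<rho> * C a b \<rho>) * g (a # b # js))"
    unfolding sum_distrib_right by (rule sum.cong, rule refl, rule sum.swap)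
  finally have F: "(\<Sum>\<rho>\<in>UNIV. C \<nu> l \<rho> * Q \<rho> g js)
      = (\<Sum>a\<in>UNIV. \<Sum>b\<in>UNIV. ((\<Sum>s\<in>UNIV. C s b l * C \<nu> s a) + (\<Sum>s\<in>UNIV. C a s l * C \<nu> s b)) * g (a # b # js))"
    by (simp add: jacobi_Q)
  have "Q l (D \<nu> g) js = (\<Sum>a\<in>UNIV. \<Sum>b\<in>UNIV. C a b l * (\<Sum>s\<in>UNIV. C \<nu> a s * g (s # b # js)))
    + (\<Sum>a\<in>UNIV. \<Sum>b\<in>UNIV. C a b l * (\<Sum>s\<in>UNIV. C \<nu> b s * g (a # s # js))) + D \<nu> (Q l g) js"
    unfolding A by (simp add: Q_def distrib_left sum.distrib)
  then show ?thesis unfolding B E F by (simp add: sum.distrib algebra_simps)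
qed

text \<open>The labels are treated as tensor slots. If \<open>g\<close> is invariant the left side
  vanishes, and \<open>Qs ls g js\<close> is an invariant tensor in \<open>ls\<close> and
  \<open>js\<close> jointly.\<close>

lemma Qs_lie_der: "Qs ls (D \<nu> g) js = D \<nu> (Qs ls g) js + D \<nu> (\<lambda>ls. Qs ls g js) ls"
proof (induction ls arbitrary: g)
  case (Cons l ls)
  have "Q l (D \<nu> g) = (\<lambda>js. D \<nu> (Q l g) js + (\<Sum>\<rho>\<in>UNIV. C \<nu> l \<rho> * Q \<rho> g js))"
    by (rule ext) (rule Q_lie_der)
  then show ?case by (simp add: Qs_add Qs_sum Qs_scale Cons)
qed simp

text \<open>The reason why invariant polynomials evaluated on the curvature two-forms vanish, and
  why the cocycle contraction is symmetric in its last two indices.\<close>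

lemma sum_lie_der_Qs_Cons:
  assumes "skew g"
  shows "(\<Sum>a\<in>UNIV. D a (\<lambda>ls. Qs ls (\<lambda>xs. g (a # xs)) js) ls) = 0"
  using assms
proof (induction ls arbitrary: g)
  case (Cons l ls)
  have Qc: "Q \<rho> (\<lambda>xs. g (a # xs)) = (\<lambda>xs. Q \<rho> g (a # xs))" for a \<rho>
    using Q_Cons[OF Cons.prems] by auto
  have "(\<Sum>a\<in>UNIV. \<Sum>\<rho>\<in>UNIV. C a l \<rho> * Qs ls (Q \<rho> (\<lambda>xs. g (a # xs))) js)
     = Qs ls (\<lambda>js. \<Sum>a\<in>UNIV. \<Sum>\<rho>\<in>UNIV. C a l \<rho> * Q \<rho> g (a # js)) js"
    by (simp add: Qs_sum Qs_scale Qc)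
  also have "(\<lambda>js. \<Sum>a\<in>UNIV. \<Sum>\<rho>\<in>UNIV. C a l \<rho> * Q \<rho> g (a # js)) = (\<lambda>js. - (\<Sum>a\<in>UNIV. \<Sum>\<rho>\<in>UNIV. C a \<rho> l * Q \<rho> g (a # js)))"
    by (intro ext) (simp add: C_swap23[of _ l] sum_negf)
  also have "\<dots> = (\<lambda>js. 0)" using sum_C_Q_Cons[OF Cons.prems] by auto
  finally have "(\<Sum>a\<in>UNIV. \<Sum>\<rho>\<in>UNIV. C a l \<rho> * Qs ls (Q \<rho> (\<lambda>xs. g (a # xs))) js) = 0"
    by (simp add: Qs_zero)
  then show ?case using Cons.IH[OF skew_Q[OF Cons.prems, of l]] by (simp add: sum.distrib Qc)
qed simp

text \<open>The action substitutes into the arguments of \<open>g\<close>, which reverses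
  composition; hence the minus sign in front of the structure constants.\<close>

lemma lie_der_commutator:
  "D \<nu> (D \<mu> g) js = D \<mu> (D \<nu> g) js - (\<Sum>k\<in>UNIV. C \<nu> \<mu> k * D k g js)"
proof (induction js arbitrary: g)
  case (Cons k ks)
  have 1: "D \<nu> (\<lambda>xs. D \<mu> g (k # xs)) ks = (\<Sum>\<rho>\<in>UNIV. C \<mu> k \<rho> * D \<nu> (\<lambda>xs. g (\<rho> # xs)) ks) + D \<nu> (D \<mu> (\<lambda>xs. g (k # xs))) ks" for \<mu> \<nu>
    by (simp add: lie_der_add lie_der_sum lie_der_scale)
  have 2: "(\<Sum>\<rho>\<in>UNIV. C \<nu> k \<rho> * D \<mu> g (\<rho> # ks)) = (\<Sum>d\<in>UNIV. (\<Sum>s\<in>UNIV. C \<nu> k s * C \<mu> s d) * g (d # ks))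
      + (\<Sum>\<rho>\<in>UNIV. C \<nu> k \<rho> * D \<mu> (\<lambda>xs. g (\<rho> # xs)) ks)" for \<mu> \<nu>
  proof -
    have "(\<Sum>\<rho>\<in>UNIV. \<Sum>d\<in>UNIV. C \<nu> k \<rho> * (C \<mu> \<rho> d * g (d # ks))) = (\<Sum>d\<in>UNIV. (\<Sum>s\<in>UNIV. C \<nu> k s * C \<mu> s d) * g (d # ks))"
      by (subst sum.swap) (simp add: sum_distrib_left sum_distrib_right algebra_simps)
    then show ?thesis by (simp add: distrib_left sum.distrib sum_distrib_left)
  qed
  have 3: "(\<Sum>s\<in>UNIV. C \<nu> k s * C \<mu> s d) = (\<Sum>s\<in>UNIV. C \<mu> k s * C \<nu> s d) - (\<Sum>s\<in>UNIV. C \<nu> \<mu> s * C s k d)" for d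
    using jacobi_lie_der[of \<nu> k \<mu> d] by simp
  have 4: "(\<Sum>d\<in>UNIV. (\<Sum>s\<in>UNIV. C \<nu> \<mu> s * C s k d) * g (d # ks)) = (\<Sum>s\<in>UNIV. C \<nu> \<mu> s * (\<Sum>d\<in>UNIV. C s k d * g (d # ks)))"
    unfolding sum_distrib_right sum_distrib_left by (subst sum.swap) (simp add: algebra_simps)
  show ?case
    using 2[of \<nu> \<mu>] 2[of \<mu> \<nu>] 4 Cons[of "\<lambda>xs. g (k # xs)"]
    by (simp add: 1 3 left_diff_distrib sum_subtractf distrib_left sum.distrib del: lie_der.simps(2)) (simp add: distrib_left sum.distrib lie_der_add lie_der_sum lie_der_scale)
qed simp

section \<open>The Casimir operator and the commutation relations of the boundary\<close>

definition casimir :: "'i tensor \<Rightarrow> 'i tensor" where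
  "casimir g js = (\<Sum>i\<in>UNIV. D i (D i g) js)"

text \<open>Commuting through both factors leaves C_{\<nu>ik} (D_i D_k + D_k D_i), antisymmetric
  times symmetric in i and k.\<close>

lemma lie_der_casimir: "D \<nu> (casimir g) js = casimir (D \<nu> g) js"
proof -
  have 1: "D \<nu> (D i g) = (\<lambda>js. D i (D \<nu> g) js - (\<Sum>k\<in>UNIV. C \<nu> i k * D k g js))" for i
    by (rule ext) (rule lie_der_commutator)
  have "D \<nu> (D i (D i g)) js = D i (D i (D \<nu> g)) js - (\<Sum>k\<in>UNIV. C \<nu> i k * D i (D k g) js)
      - (\<Sum>k\<in>UNIV. C \<nu> i k * D k (D i g) js)" for i
    using lie_der_commutator[of \<nu> i "D i g" js] by (simp add: 1 lie_der_diff lie_der_sum lie_der_scale)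
  moreover have "(\<Sum>i\<in>UNIV. \<Sum>k\<in>UNIV. C \<nu> i k * D i (D k g) js + C \<nu> i k * D k (D i g) js) = 0"
  proof (rule sum2_antisym)
    fix i k
    show "C \<nu> i k * D i (D k g) js + C \<nu> i k * D k (D i g) js = - (C \<nu> k i * D k (D i g) js + C \<nu> k i * D i (D k g) js)"
      using C_swap23[of \<nu> i k] by simp
  qed
  ultimately show ?thesis unfolding casimir_def
    by (simp add: lie_der_sum sum_subtractf sum.distrib)
qed

lemma lie_der_wedge: "D \<nu> (wedge c g) js = wedge c (D \<nu> g) js + (\<Sum>\<rho>\<in>UNIV. C \<nu> \<rho> c * wedge \<rho> g js)"
proof (induction js arbitrary: g)
  case (Cons k ks)
  have 1: "(\<lambda>xs. wedge c g (k # xs)) = (\<lambda>xs. (if k = c then g xs else 0) - wedge c (\<lambda>xs. g (k # xs)) xs)"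
    by auto
  have 2: "D \<nu> (\<lambda>xs. if k = c then g xs else 0) ks = (if k = c then D \<nu> g ks else 0)"
    by (simp add: lie_der_zero)
  have 3: "(\<Sum>\<rho>\<in>UNIV. C \<nu> k \<rho> * wedge c g (\<rho> # ks)) = C \<nu> k c * g ks - (\<Sum>\<rho>\<in>UNIV. C \<nu> k \<rho> * wedge c (\<lambda>xs. g (\<rho> # xs)) ks)"
    by (simp add: right_diff_distrib sum_subtractf if_distrib[of "\<lambda>x. _ * x"] cong: if_cong)
  have 4: "(\<Sum>\<rho>\<in>UNIV. C \<nu> \<rho> c * wedge \<rho> g (k # ks)) = C \<nu> k c * g ks - (\<Sum>\<rho>\<in>UNIV. C \<nu> \<rho> c * wedge \<rho> (\<lambda>xs. g (k # xs)) ks)"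
    by (simp add: right_diff_distrib sum_subtractf if_distrib[of "\<lambda>x. _ * x"] cong: if_cong)
  have 5: "wedge c (D \<nu> g) (k # ks) = (if k = c then D \<nu> g ks else 0) - (\<Sum>\<rho>\<in>UNIV. C \<nu> k \<rho> * wedge c (\<lambda>xs. g (\<rho> # xs)) ks)
     - wedge c (D \<nu> (\<lambda>xs. g (k # xs))) ks"
    by (simp add: wedge_add wedge_sum wedge_scale)
  show ?case unfolding 4 5 unfolding lie_der.simps(2) 3 unfolding 1 lie_der_diff 2 Cons
    by simp
qed simp

lemma lie_der_bdry: "D \<nu> (bdry g) js = bdry (D \<nu> g) js"
proof -
  have 1: "D \<nu> (Q c g) = (\<lambda>js. Q c (D \<nu> g) js - (\<Sum>\<rho>\<in>UNIV. C \<nu> c \<rho> * Q \<rho> g js))" for c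
    by (rule ext) (simp add: Q_lie_der)
  have 2: "(\<Sum>c\<in>UNIV. \<Sum>\<rho>\<in>UNIV. C \<nu> \<rho> c * wedge \<rho> (Q c g) js) = (\<Sum>c\<in>UNIV. \<Sum>\<rho>\<in>UNIV. C \<nu> c \<rho> * wedge c (Q \<rho> g) js)"
    by (rule sum.swap)
  show ?thesis
    unfolding bdry_def
    by (simp add: lie_der_sum lie_der_wedge 1 wedge_diff wedge_sum wedge_scale sum.distrib sum_subtractf 2)
qed

text \<open>Passing the covector through the two contractions in \<open>Q l\<close> leaves one term
  for each, and antisymmetry of \<open>C\<close> makes the two equal. This 2 is the source of the
  factor m+n in \<open>Ssum_koszul\<close>.\<close>

lemma Q_wedge: "Q l (wedge i g) js = wedge i (Q l g) js + 2 * (\<Sum>b\<in>UNIV. C i b l * g (b # js))"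
proof -
  have A: "wedge i (Q l g) js = (\<Sum>a\<in>UNIV. \<Sum>b\<in>UNIV. C a b l * wedge i (\<lambda>xs. g (a # b # xs)) js)"
    unfolding Q_def by (simp add: wedge_sum wedge_scale)
  define x where "x a b = (if a = i then g (b # js) else 0)" for a b
  define y where "y a b = (if b = i then g (a # js) else 0)" for a b
  have x: "(\<Sum>a\<in>UNIV. \<Sum>b\<in>UNIV. C a b l * x a b) = (\<Sum>b\<in>UNIV. C i b l * g (b # js))"
    unfolding x_def by (subst sum.swap) (simp add: if_distrib[of "\<lambda>x. _ * x"] cong: if_cong)
  have y: "(\<Sum>a\<in>UNIV. \<Sum>b\<in>UNIV. C a b l * y a b) = - (\<Sum>b\<in>UNIV. C i b l * g (b # js))"
    unfolding y_def by (simp add: if_distrib[of "\<lambda>x. _ * x"] C_swap12[of _ i l] sum_negf cong: if_cong)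
  have e: "wedge i g (a # b # js) = x a b - y a b + wedge i (\<lambda>xs. g (a # b # xs)) js" for a b
    by (simp add: x_def y_def)
  show ?thesis unfolding A Q_def e using x y
    by (simp add: distrib_left right_diff_distrib sum.distrib sum_subtractf)
qed

text \<open>On skew tensors the Lie derivative is a sum of products of a wedge and a contraction.
  The sign comes from exchanging the last two indices of \<open>C\<close>.\<close>

lemma sum_C_wedge_eq_lie_der:
  assumes "skew g"
  shows "(\<Sum>b\<in>UNIV. \<Sum>c\<in>UNIV. C i b c * wedge c (\<lambda>xs. g (b # xs)) js) = - D i g js"
  using assms
proof (induction js arbitrary: g)
  case (Cons k ks)
  have sw: "(\<lambda>xs. g (b # k # xs)) = (\<lambda>xs. - g (k # b # xs))" for b
    by (rule ext) (rule skewD[OF Cons.prems])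
  have "(\<Sum>c\<in>UNIV. C i b c * wedge c (\<lambda>xs. g (b # xs)) (k # ks)) = C i b k * g (b # ks) + (\<Sum>c\<in>UNIV. C i b c * wedge c (\<lambda>xs. g (k # b # xs)) ks)" for b
    by (simp add: sw wedge_minus distrib_left sum.distrib if_distrib[of "\<lambda>x. _ * x"] cong: if_cong)
  then show ?case using Cons.IH[OF skew_Cons[OF Cons.prems], of k]
    by (simp add: sum.distrib sum_subtractf C_swap23[of i _ k] sum_negf)
qed simp

text \<open>Cartan's formula in transposed form, with wedge in place of contraction and the boundary
  in place of the differential. The coefficient combines the 2 of \<open>Q_wedge\<close> with the
  sign of \<open>sum_C_wedge_eq_lie_der\<close>; the wedge terms anticommute.\<close>

lemma bdry_wedge:
  assumes "skew g"
  shows "bdry (wedge i g) js = - wedge i (bdry g) js - 2 * D i g js"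
proof -
  have 1: "Q c (wedge i g) = (\<lambda>js. wedge i (Q c g) js + 2 * (\<Sum>b\<in>UNIV. C i b c * g (b # js)))" for c
    by (rule ext) (rule Q_wedge)
  have "bdry (wedge i g) js = (\<Sum>c\<in>UNIV. wedge c (wedge i (Q c g)) js) + 2 * (\<Sum>c\<in>UNIV. \<Sum>b\<in>UNIV. C i b c * wedge c (\<lambda>xs. g (b # xs)) js)"
    by (simp add: bdry_def 1 wedge_add wedge_scale wedge_sum sum.distrib sum_distrib_left)
  moreover have "(\<Sum>c\<in>UNIV. wedge c (wedge i (Q c g)) js) = - wedge i (bdry g) js"
    unfolding bdry_def by (simp add: wedge_sum wedge_anticommute[of _ i] sum_negf)
  ultimately show ?thesis using sum_C_wedge_eq_lie_der[OF assms, of i js] by (subst (asm) (2) sum.swap) simp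
qed

text \<open>Contraction anticommutes with \<open>wedge c\<close> up to a Kronecker delta, which
  selects \<open>Q k\<close>. Through this identity a boundary contributes one more curvature to a
  pairing.\<close>

lemma bdry_Cons:
  assumes "skew g"
  shows "bdry g (k # ks) = Q k g ks - bdry (\<lambda>xs. g (k # xs)) ks"
proof -
  have "(\<lambda>xs. Q c g (k # xs)) = Q c (\<lambda>xs. g (k # xs))" for c
    using Q_Cons[OF assms] by auto
  then show ?thesis by (simp add: bdry_def sum_subtractf)
qed

lemma bdry_Nil [simp]: "bdry g [] = 0" by (simp add: bdry_def)

text \<open>The transpose of the fact that multiplication by a closed two-form commutes with the
  differential. Of the terms created by contracting with a and b, two remain, and
  \<open>sum_C_Q_Cons\<close> kills each.\<close>

lemma Q_bdry:
  assumes "skew g" shows "Q l (bdry g) js = bdry (Q l g) js"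
proof -
  have 1: "bdry g (a # b # js) = Q a g (b # js) - Q b g (a # js) + bdry (\<lambda>xs. g (a # b # xs)) js" for a b
    using Q_Cons[OF assms, of b a js] by (simp add: bdry_Cons[OF assms] bdry_Cons[OF skew_Cons[OF assms]])
  have 2: "Q l g = (\<lambda>js. \<Sum>a\<in>UNIV. \<Sum>b\<in>UNIV. C a b l * g (a # b # js))"
    by (rule ext) (simp add: Q_def)
  have "bdry (Q l g) js = (\<Sum>a\<in>UNIV. \<Sum>b\<in>UNIV. C a b l * bdry (\<lambda>xs. g (a # b # xs)) js)"
    unfolding 2 by (simp add: bdry_sum bdry_scale)
  moreover have "(\<Sum>a\<in>UNIV. \<Sum>b\<in>UNIV. C a b l * Q b g (a # js)) = 0"
    using sum_C_Q_Cons[OF assms] by blast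
  moreover have "(\<Sum>a\<in>UNIV. \<Sum>b\<in>UNIV. C a b l * Q a g (b # js)) = 0"
  proof -
    have "(\<Sum>a\<in>UNIV. \<Sum>b\<in>UNIV. C a b l * Q a g (b # js)) = (\<Sum>b\<in>UNIV. \<Sum>a\<in>UNIV. C a b l * Q a g (b # js))"
      by (rule sum.swap)
    also have "\<dots> = (\<Sum>b\<in>UNIV. \<Sum>a\<in>UNIV. - (C b a l * Q a g (b # js)))"
      by (subst C_swap12) simp
    finally show ?thesis using sum_C_Q_Cons[OF assms, of l js] by (simp add: sum_negf)
  qed
  moreover have "Q l (bdry g) js = (\<Sum>a\<in>UNIV. \<Sum>b\<in>UNIV. C a b l * Q a g (b # js)) - (\<Sum>a\<in>UNIV. \<Sum>b\<in>UNIV. C a b l * Q b g (a # js))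
    + (\<Sum>a\<in>UNIV. \<Sum>b\<in>UNIV. C a b l * bdry (\<lambda>xs. g (a # b # xs)) js)"
    unfolding Q_def[of _ "bdry g"] 1 by (simp add: sum.distrib sum_subtractf algebra_simps)
  ultimately show ?thesis by simp
qed

lemma Qs_bdry: "skew g \<Longrightarrow> Qs ls (bdry g) = bdry (Qs ls g)"
proof (induction ls arbitrary: g)
  case (Cons l ls)
  have "Q l (bdry g) = bdry (Q l g)" using Q_bdry[OF Cons.prems] by auto
  then show ?case using Cons.IH[OF skew_Q[OF Cons.prems]] by simp
qed simp

lemma bdry_add: "bdry (\<lambda>js. g js + g' js) = (\<lambda>js. bdry g js + bdry g' js)"
  by (rule ext) (simp add: bdry_def Q_add wedge_add sum.distrib)

end

section \<open>Invariant symmetric tensors and the Koszul zigzag\<close>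

text \<open>Unlike \<open>symmetric_tensor\<close>, this ranges over all lengths and allows any type
  of values, so it applies directly to the symmetric slots of a function
  \<open>f us js\<close>.\<close>

definition perm_inv :: "('i list \<Rightarrow> 'b) \<Rightarrow> bool" where
  "perm_inv f \<longleftrightarrow> (\<forall>xs ys. mset xs = mset ys \<longrightarrow> f xs = f ys)"

lemma msymD: "perm_inv f \<Longrightarrow> mset xs = mset ys \<Longrightarrow> f xs = f ys"
  unfolding perm_inv_def by blast

lemma perm_inv_Cons: "perm_inv f \<Longrightarrow> perm_inv (\<lambda>xs. f (k # xs))"
  unfolding perm_inv_def by simp

text \<open>Gram-Schmidt one coordinate at a time: the members of \<open>V\<close> that vanish at
  the new point have codimension at most one. Closure under f + c g replaces the choice of a
  basis.\<close>

lemma projection_exists: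
  fixes x :: "'a \<Rightarrow> real"
  assumes "finite A" and "\<And>f a. f \<in> V \<Longrightarrow> a \<notin> A \<Longrightarrow> f a = 0" and "(\<lambda>_. 0) \<in> V"
    and "\<And>f g c. f \<in> V \<Longrightarrow> g \<in> V \<Longrightarrow> (\<lambda>a. f a + c * g a) \<in> V"
  shows "\<exists>d\<in>V. \<forall>e\<in>V. (\<Sum>a\<in>A. (x a - d a) * e a) = 0"
  using assms
proof (induction A arbitrary: V x rule: finite_induct)
  case empty
  then show ?case by auto
next
  case (insert b A)
  note lin = insert.prems(3)
  define V0 where "V0 = {f \<in> V. f b = 0}"
  have V0: "\<exists>d\<in>V0. \<forall>e\<in>V0. (\<Sum>a\<in>A. (x a - d a) * e a) = 0" for x
  proof (rule insert.IH)
    show "f a = 0" if "f \<in> V0" "a \<notin> A" for f a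
      using that insert.prems(1)[of f a] by (cases "a = b") (auto simp: V0_def)
    show "(\<lambda>_. 0) \<in> V0" using insert.prems(2) by (simp add: V0_def)
    show "(\<lambda>a. f a + c * g a) \<in> V0" if "f \<in> V0" "g \<in> V0" for f g c
      using that lin by (simp add: V0_def)
  qed
  have V0': "\<exists>d\<in>V0. \<forall>e\<in>V0. (\<Sum>a\<in>insert b A. (x a - d a) * e a) = 0" for x
  proof -
    have "(\<Sum>a\<in>insert b A. f a * e a) = (\<Sum>a\<in>A. f a * e a)" if "e \<in> V0" for f e :: "'a \<Rightarrow> real"
      using that insert.hyps by (simp add: V0_def)
    then show ?thesis using V0[of x] by metis
  qed
  show ?case
  proof (cases "V0 = V")
    case True
    then show ?thesis using V0'[of x] by simp
  next
    case False
    then obtain u where u: "u \<in> V" "u b \<noteq> 0" by (auto simp: V0_def)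
    obtain d where d: "d \<in> V0" "\<forall>e\<in>V0. (\<Sum>a\<in>insert b A. (u a - d a) * e a) = 0" using V0' by blast
    \<comment> \<open>The part of \<open>u\<close> orthogonal to \<open>V0\<close>. Since
      \<open>d\<close> vanishes at \<open>b\<close>, \<open>w b\<close> equals \<open>u b\<close>,
      which is nonzero, and every \<open>e\<close> in \<open>V\<close> is a member of
      \<open>V0\<close> plus (e b / w b) times \<open>w\<close>.\<close>
    define w where "w = (\<lambda>a. u a + (-1) * d a)"
    have w: "w \<in> V" "w b \<noteq> 0" "\<forall>e\<in>V0. (\<Sum>a\<in>insert b A. w a * e a) = 0"
      using u d lin[of u d "-1"] by (auto simp: w_def V0_def)
    obtain y where y: "y \<in> V0" "\<forall>e\<in>V0. (\<Sum>a\<in>insert b A. (x a - y a) * e a) = 0" using V0' by blast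
    define N where "N = (\<Sum>a\<in>insert b A. w a * w a)"
    have "N > 0"
    proof -
      have "0 < w b * w b" using w(2) not_real_square_gt_zero by blast
      moreover have "0 \<le> (\<Sum>a\<in>A. w a * w a)" by (intro sum_nonneg) simp
      ultimately show ?thesis using insert.hyps by (simp add: N_def)
    qed
    define c where "c = (\<Sum>a\<in>insert b A. (x a - y a) * w a) / N"
    have "(\<lambda>a. y a + c * w a) \<in> V" using y(1) w(1) lin by (simp add: V0_def)
    moreover have "(\<Sum>a\<in>insert b A. (x a - (y a + c * w a)) * e a) = 0" if "e \<in> V" for e
    proof -
      define t where "t = e b / w b"
      define e0 where "e0 = (\<lambda>a. e a + (- t) * w a)"
      have e0: "e0 \<in> V0" unfolding V0_def e0_def using lin[OF that w(1), of "-t"] w(2) by (simp add: t_def)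
      have e: "e a = e0 a + t * w a" for a by (simp add: e0_def)
      have p: "(x a - (y a + c * w a)) * e a = (x a - y a) * e0 a + (- c) * (w a * e0 a)
          + t * ((x a - y a) * w a) + (- t * c) * (w a * w a)" for a
        unfolding e by algebra
      have "(\<Sum>a\<in>insert b A. (x a - (y a + c * w a)) * e a) =
         (\<Sum>a\<in>insert b A. (x a - y a) * e0 a) + (- c) * (\<Sum>a\<in>insert b A. w a * e0 a)
         + t * (\<Sum>a\<in>insert b A. (x a - y a) * w a) + (- t * c) * N"
        unfolding N_def p by (simp only: sum.distrib sum_distrib_left)
      also have "\<dots> = 0" using e0 y(2) w(3) \<open>N > 0\<close> by (simp add: c_def)
      finally show ?thesis .
    qed
    ultimately show ?thesis by (intro bexI[where x = "\<lambda>a. y a + c * w a"] ballI)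
  qed
qed

section \<open>Vanishing of invariants on the curvature; pairings along the zigzag\<close>

context antisym_lie_constants
begin

text \<open>Integration by parts, slot by slot: \<open>C\<close> is antisymmetric in the two indices
  that the action exchanges.\<close>

lemma sum_lie_der_adjoint:
  "(\<Sum>is | length is = n. f is * D \<nu> g is) = - (\<Sum>is | length is = n. D \<nu> f is * g is)"
proof (induction n arbitrary: f g)
  case (Suc n)
  have "(\<Sum>k\<in>UNIV. \<Sum>ks | length ks = n. f (k # ks) * (\<Sum>\<rho>\<in>UNIV. C \<nu> k \<rho> * g (\<rho> # ks)))
     = (\<Sum>ks | length ks = n. \<Sum>k\<in>UNIV. \<Sum>\<rho>\<in>UNIV. C \<nu> k \<rho> * f (k # ks) * g (\<rho> # ks))"
    by (subst sum.swap) (simp add: sum_distrib_left algebra_simps)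
  also have "\<dots> = (\<Sum>ks | length ks = n. \<Sum>\<rho>\<in>UNIV. \<Sum>k\<in>UNIV. C \<nu> k \<rho> * f (k # ks) * g (\<rho> # ks))"
    by (rule sum.cong, rule refl, rule sum.swap)
  also have "\<dots> = (\<Sum>ks | length ks = n. \<Sum>\<rho>\<in>UNIV. \<Sum>k\<in>UNIV. - (C \<nu> \<rho> k * f (k # ks) * g (\<rho> # ks)))"
    by (subst C_swap23) simp
  also have "\<dots> = - (\<Sum>\<rho>\<in>UNIV. \<Sum>ks | length ks = n. (\<Sum>k\<in>UNIV. C \<nu> \<rho> k * f (k # ks)) * g (\<rho> # ks))"
    by (subst sum.swap) (simp add: sum_negf sum_distrib_right)
  finally show ?case
    by (simp add: sum_len_Suc distrib_left distrib_right sum.distrib sum_subtractf Suc sum_negf)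
qed simp

text \<open>Write the curvature with label l as C_{ab}^l and contract it with \<open>p\<close>:
  invariance turns the result into minus D_a on the other slots of \<open>p\<close>. Integration by
  parts moves D_a onto the labels of the other curvatures, where the sum over a vanishes by
  \<open>sum_lie_der_Qs_Cons\<close>.\<close>

lemma sum_invariant_Qs:
  assumes "invariant_tensor C k p" "k > 0" "skew g"
  shows "(\<Sum>ls | length ls = k. p ls * Qs ls g js) = 0"
proof -
  obtain n where k: "k = Suc n" using assms(2) by (cases k) auto
  have inv: "(\<Sum>l\<in>UNIV. C a b l * p (l # ls)) = - D a (\<lambda>ls. p (b # ls)) ls" if "length ls = n" for a b ls
    using assms(1) that k by (auto simp: invariant_tensor_lie_der dest!: spec[of _ a] spec[of _ "b # ls"])
  have sw: "(\<lambda>xs. g (a # b # xs)) = (\<lambda>xs. - g (b # a # xs))" for a b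
    by (rule ext) (rule skewD[OF assms(3)])
  have Qm: "Qs ls (\<lambda>xs. - f xs) js = - Qs ls f js" for ls f
    using Qs_scale[of ls "-1" f] by simp
  have Z: "(\<Sum>a\<in>UNIV. D a (\<lambda>ls. Qs ls (\<lambda>xs. g (a # b # xs)) js) ls) = 0" for b ls
    using sum_lie_der_Qs_Cons[OF skew_Cons[OF assms(3)], of b js ls]
    by (simp only: sw[of _ b] Qm lie_der_minus sum_negf neg_equal_0_iff_equal)
  have Ql: "Q l g = (\<lambda>js. \<Sum>a\<in>UNIV. \<Sum>b\<in>UNIV. C a b l * g (a # b # js))" for l
    by (rule ext) (simp add: Q_def)
  have "(\<Sum>ls | length ls = k. p ls * Qs ls g js)
     = (\<Sum>l\<in>UNIV. \<Sum>ls | length ls = n. \<Sum>a\<in>UNIV. \<Sum>b\<in>UNIV. C a b l * p (l # ls) * Qs ls (\<lambda>xs. g (a # b # xs)) js)"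
    unfolding k sum_len_Suc by (simp add: Ql Qs_sum Qs_scale sum_distrib_left algebra_simps)
  also have "\<dots> = (\<Sum>ls | length ls = n. \<Sum>l\<in>UNIV. \<Sum>a\<in>UNIV. \<Sum>b\<in>UNIV. C a b l * p (l # ls) * Qs ls (\<lambda>xs. g (a # b # xs)) js)"
    by (rule sum.swap)
  also have "\<dots> = (\<Sum>ls | length ls = n. \<Sum>b\<in>UNIV. \<Sum>a\<in>UNIV. \<Sum>l\<in>UNIV. C a b l * p (l # ls) * Qs ls (\<lambda>xs. g (a # b # xs)) js)"
    by (rule sum.cong, rule refl, rule sum3_rev)
  also have "\<dots> = (\<Sum>ls | length ls = n. \<Sum>b\<in>UNIV. \<Sum>a\<in>UNIV. - (D a (\<lambda>ls. p (b # ls)) ls * Qs ls (\<lambda>xs. g (a # b # xs)) js))"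
    by (intro sum.cong refl) (simp add: sum_distrib_right[symmetric] inv)
  also have "\<dots> = (\<Sum>b\<in>UNIV. \<Sum>ls | length ls = n. \<Sum>a\<in>UNIV. - (D a (\<lambda>ls. p (b # ls)) ls * Qs ls (\<lambda>xs. g (a # b # xs)) js))"
    by (rule sum.swap)
  also have "\<dots> = (\<Sum>b\<in>UNIV. \<Sum>a\<in>UNIV. - (\<Sum>ls | length ls = n. D a (\<lambda>ls. p (b # ls)) ls * Qs ls (\<lambda>xs. g (a # b # xs)) js))"
    unfolding sum_negf[symmetric] by (rule sum.cong, rule refl, rule sum.swap)
  also have "\<dots> = (\<Sum>b\<in>UNIV. \<Sum>a\<in>UNIV. \<Sum>ls | length ls = n. p (b # ls) * D a (\<lambda>ls. Qs ls (\<lambda>xs. g (a # b # xs)) js) ls)"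
    unfolding sum_lie_der_adjoint by simp
  also have "\<dots> = (\<Sum>b\<in>UNIV. \<Sum>ls | length ls = n. \<Sum>a\<in>UNIV. p (b # ls) * D a (\<lambda>ls. Qs ls (\<lambda>xs. g (a # b # xs)) js) ls)"
    by (rule sum.cong, rule refl, rule sum.swap)
  also have "\<dots> = 0"
    unfolding sum_distrib_left[symmetric] Z by simp
  finally show ?thesis .
qed

text \<open>From here on \<open>f us js\<close> has symmetric indices \<open>us\<close> and skew indices \<open>js\<close>; \<open>koszul\<close> turns
  one symmetric index into a skew one, as the Koszul differential does.\<close>

definition koszul :: "('i list \<Rightarrow> 'i tensor) \<Rightarrow> 'i list \<Rightarrow> 'i tensor" where
  "koszul f us js = (\<Sum>i\<in>UNIV. wedge i (f (i # us)) js)"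

text \<open>\<open>Tsum m h n\<close> and \<open>Ssum m h n\<close> pair with $h(F^n, u^{m-n})$ and $h(F^n, u^{m-n-1}, \theta)$,
  where $F$ is the curvature two-form. They are the successive stages of the zigzag from $h$ to its
  cocycle.\<close>

definition Tsum :: "nat \<Rightarrow> 'i tensor \<Rightarrow> nat \<Rightarrow> ('i list \<Rightarrow> 'i tensor) \<Rightarrow> real" where
  "Tsum m h n v = (\<Sum>us | length us = m - n. \<Sum>ls | length ls = n. h (ls @ us) * Qs ls (v us) [])"

definition Ssum :: "nat \<Rightarrow> 'i tensor \<Rightarrow> nat \<Rightarrow> ('i list \<Rightarrow> 'i tensor) \<Rightarrow> real" where
  "Ssum m h n x = (\<Sum>us | length us = m - 1 - n. \<Sum>ls | length ls = n. \<Sum>\<rho>\<in>UNIV.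
     h (ls @ us @ [\<rho>]) * Qs ls (x us) [\<rho>])"

text \<open>The boundary commutes with the curvature contractions, and on the single index \<rho> it
  reduces to \<open>Q \<rho>\<close>. Thus the last slot of \<open>h\<close> becomes the next
  curvature slot.\<close>

lemma Ssum_bdry:
  assumes "perm_inv h" "\<And>us. skew (v us)"
  shows "Ssum m h n (\<lambda>us. bdry (v us)) = Tsum m h (Suc n) v"
proof -
  have "Qs ls (bdry (v us)) [\<rho>] = Qs (ls @ [\<rho>]) (v us) []" for ls us \<rho>
    by (simp add: Qs_bdry[OF assms(2)] bdry_Cons[OF skew_Qs[OF assms(2)]] Qs_append)
  moreover have "h (ls @ us @ [\<rho>]) = h ((ls @ [\<rho>]) @ us)" for ls us \<rho>
    by (rule msymD[OF assms(1)]) simp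
  ultimately show ?thesis by (simp add: Ssum_def Tsum_def sum_len_snoc)
qed

text \<open>Each of the n contractions leaves the commutator of \<open>Q_wedge\<close>. Symmetry of
  \<open>k\<close> lets its label be brought to the front, so the n terms are equal.\<close>

lemma sum_Qs_wedge:
  assumes "perm_inv k" "skew g"
  shows "(\<Sum>ls | length ls = n. k ls * Qs ls (wedge i g) js) =
    (\<Sum>ls | length ls = n. k ls * wedge i (Qs ls g) js)
    + 2 * real n * (\<Sum>ls | length ls = n - 1. \<Sum>l\<in>UNIV. \<Sum>b\<in>UNIV. k (l # ls) * C i b l * Qs ls (\<lambda>xs. g (b # xs)) js)"
  using assms
proof (induction n arbitrary: k g)
  case (Suc n)
  define W where "W n k g = (\<Sum>ls | length ls = n. \<Sum>l\<in>UNIV. \<Sum>b\<in>UNIV. k (l # ls) * C i b l * Qs ls (\<lambda>xs. g (b # xs)) js)" for n k g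
  have 1: "Q l (wedge i g) = (\<lambda>js. wedge i (Q l g) js + 2 * (\<Sum>b\<in>UNIV. C i b l * g (b # js)))" for l
    by (rule ext) (rule Q_wedge)
  have "(\<Sum>ls | length ls = Suc n. k ls * Qs ls (wedge i g) js) =
    (\<Sum>l\<in>UNIV. \<Sum>ls | length ls = n. k (l # ls) * Qs ls (wedge i (Q l g)) js)
    + 2 * (\<Sum>l\<in>UNIV. \<Sum>ls | length ls = n. \<Sum>b\<in>UNIV. k (l # ls) * C i b l * Qs ls (\<lambda>xs. g (b # xs)) js)"
    by (simp add: sum_len_Suc 1 Qs_add Qs_scale Qs_sum distrib_left sum.distrib sum_distrib_left algebra_simps)
  also have "(\<Sum>l\<in>UNIV. \<Sum>ls | length ls = n. \<Sum>b\<in>UNIV. k (l # ls) * C i b l * Qs ls (\<lambda>xs. g (b # xs)) js) = W n k g"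
    unfolding W_def by (rule sum.swap)
  also have "(\<Sum>l\<in>UNIV. \<Sum>ls | length ls = n. k (l # ls) * Qs ls (wedge i (Q l g)) js)
    = (\<Sum>l\<in>UNIV. (\<Sum>ls | length ls = n. k (l # ls) * wedge i (Qs ls (Q l g)) js) + 2 * real n * W (n - 1) (\<lambda>ls. k (l # ls)) (Q l g))"
    unfolding W_def by (intro sum.cong refl Suc.IH perm_inv_Cons skew_Q Suc.prems)
  also have "\<dots> = (\<Sum>ls | length ls = Suc n. k ls * wedge i (Qs ls g) js) + 2 * real n * (\<Sum>l\<in>UNIV. W (n - 1) (\<lambda>ls. k (l # ls)) (Q l g))"
    by (simp add: sum_len_Suc sum.distrib sum_distrib_left)
  also have "2 * real n * (\<Sum>l\<in>UNIV. W (n - 1) (\<lambda>ls. k (l # ls)) (Q l g)) = 2 * real n * W n k g"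
  proof (cases n)
    case (Suc n')
    have "(\<lambda>xs. Q l g (b # xs)) = Q l (\<lambda>xs. g (b # xs))" for l b
      by (rule ext) (rule Q_Cons[OF Suc.prems(2)])
    moreover have "k (l # l' # ls) = k (l' # l # ls)" for l l' ls
      by (rule msymD[OF Suc.prems(1)]) simp
    ultimately show ?thesis by (simp add: W_def Suc sum_len_Suc)
  qed simp
  finally show ?case by (simp add: W_def algebra_simps)
qed simp

text \<open>By symmetry of \<open>f\<close> and \<open>g\<close> all slots contribute equally, so
  the first one is counted \<open>Suc N\<close> times.\<close>

lemma sum_lie_der_perm_inv:
  fixes f g :: "'i tensor"
  assumes "perm_inv f" "perm_inv g"
  shows "(\<Sum>us | length us = Suc N. D b f us * g us) =
    real (Suc N) * (\<Sum>us | length us = N. \<Sum>i\<in>UNIV. \<Sum>l\<in>UNIV. C b i l * f (l # us) * g (i # us))"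
  using assms
proof (induction N arbitrary: f g)
  case 0
  then show ?case by (simp add: sum_len_1 sum_distrib_right)
next
  case (Suc N)
  define W where "W n f g = (\<Sum>us | length us = n. \<Sum>i\<in>UNIV. \<Sum>l\<in>UNIV. C b i l * f (l # us) * g (i # us))"
    for n and f g :: "'i tensor"
  have "(\<Sum>us | length us = Suc (Suc N). D b f us * g us) =
     (\<Sum>i\<in>UNIV. \<Sum>us | length us = Suc N. \<Sum>l\<in>UNIV. C b i l * f (l # us) * g (i # us))
     + (\<Sum>i\<in>UNIV. \<Sum>us | length us = Suc N. D b (\<lambda>us. f (i # us)) us * g (i # us))"
    unfolding sum_len_Suc[of _ "Suc N"] by (simp add: distrib_right sum.distrib sum_distrib_right)
  also have "(\<Sum>i\<in>UNIV. \<Sum>us | length us = Suc N. \<Sum>l\<in>UNIV. C b i l * f (l # us) * g (i # us)) = W (Suc N) f g"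
    unfolding W_def by (rule sum.swap)
  also have "(\<Sum>i\<in>UNIV. \<Sum>us | length us = Suc N. D b (\<lambda>us. f (i # us)) us * g (i # us))
     = (\<Sum>i\<in>UNIV. real (Suc N) * W N (\<lambda>us. f (i # us)) (\<lambda>us. g (i # us)))"
    unfolding W_def by (intro sum.cong refl Suc.IH perm_inv_Cons Suc.prems)
  also have "\<dots> = real (Suc N) * W (Suc N) f g"
  proof -
    have "f (i # l # us) = f (l # i # us)" "g (i # l # us) = g (l # i # us)" for i l us
      by (rule msymD[OF Suc.prems(1)], simp) (rule msymD[OF Suc.prems(2)], simp)
    then show ?thesis unfolding sum_distrib_left[symmetric] W_def sum_len_Suc by simp
  qed
  finally show ?case by (simp add: W_def algebra_simps)
qed

end

section \<open>The Koszul operator in the pairings\<close>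

context antisym_lie_constants
begin

text \<open>The commutator term that remains when the covector of the Koszul operator is carried
  through the curvatures: \<open>C i b l\<close> ties the symmetric index i and a contraction b to a
  slot l of \<open>h\<close>.\<close>

definition Ysum :: "'i tensor \<Rightarrow> nat \<Rightarrow> nat \<Rightarrow> ('i list \<Rightarrow> 'i tensor) \<Rightarrow> real" where
  "Ysum h n N v = (\<Sum>us | length us = N. \<Sum>\<rho>\<in>UNIV. \<Sum>i\<in>UNIV. \<Sum>ls | length ls = n. \<Sum>l\<in>UNIV. \<Sum>b\<in>UNIV.
     h (l # ls @ us @ [\<rho>]) * C i b l * Qs ls (\<lambda>xs. v (i # us) (b # xs)) [\<rho>])"

lemma Ssum_koszul_Ysum:
  assumes "perm_inv h" "\<And>us. skew (v us)" "m = Suc N + n"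
  shows "Ssum m h n (koszul v) = Tsum m h n v + 2 * real n * Ysum h (n - 1) N v"
proof -
  have N: "m - n = Suc N" "m - 1 - n = N" using assms(3) by auto
  have e: "Qs ls (koszul v us) = (\<lambda>js. \<Sum>i\<in>UNIV. Qs ls (wedge i (v (i # us))) js)" for ls us
    unfolding Qs_sum[symmetric] by (rule arg_cong[of _ _ "Qs ls"]) (rule ext, simp add: koszul_def)
  have sy: "perm_inv (\<lambda>ls. h (ls @ ys))" for ys
    unfolding perm_inv_def by (auto intro!: msymD[OF assms(1)])
  have "Ssum m h n (koszul v) = (\<Sum>us | length us = N. \<Sum>ls | length ls = n. \<Sum>\<rho>\<in>UNIV. \<Sum>i\<in>UNIV.
     h (ls @ us @ [\<rho>]) * Qs ls (wedge i (v (i # us))) [\<rho>])"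
    by (simp only: Ssum_def N e sum_distrib_left)
  also have "\<dots> = (\<Sum>us | length us = N. \<Sum>\<rho>\<in>UNIV. \<Sum>i\<in>UNIV. \<Sum>ls | length ls = n.
     h (ls @ us @ [\<rho>]) * Qs ls (wedge i (v (i # us))) [\<rho>])"
    by (rule sum.cong, rule refl, rule sum3_move)
  also have "\<dots> = (\<Sum>us | length us = N. \<Sum>\<rho>\<in>UNIV. \<Sum>i\<in>UNIV.
      (\<Sum>ls | length ls = n. h (ls @ us @ [\<rho>]) * wedge i (Qs ls (v (i # us))) [\<rho>])
       + 2 * real n * (\<Sum>ls | length ls = n - 1. \<Sum>l\<in>UNIV. \<Sum>b\<in>UNIV. h ((l # ls) @ us @ [\<rho>]) * C i b l * Qs ls (\<lambda>xs. v (i # us) (b # xs)) [\<rho>]))"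
    by (intro sum.cong refl sum_Qs_wedge sy assms(2))
  also have "\<dots> = (\<Sum>us | length us = N. \<Sum>\<rho>\<in>UNIV. \<Sum>i\<in>UNIV.
      (\<Sum>ls | length ls = n. h (ls @ us @ [\<rho>]) * wedge i (Qs ls (v (i # us))) [\<rho>])) + 2 * real n * Ysum h (n - 1) N v"
    by (simp add: Ysum_def sum.distrib sum_distrib_left)
  \<comment> \<open>On the one-element list [\<rho>] the wedge is a Kronecker delta: the sum over i
    collapses and \<rho> becomes a further symmetric slot, as required for
    \<open>Tsum\<close>.\<close>
  also have "(\<Sum>us | length us = N. \<Sum>\<rho>\<in>UNIV. \<Sum>i\<in>UNIV.
      (\<Sum>ls | length ls = n. h (ls @ us @ [\<rho>]) * wedge i (Qs ls (v (i # us))) [\<rho>]))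
      = (\<Sum>us | length us = N. \<Sum>\<rho>\<in>UNIV. \<Sum>i\<in>UNIV. if i = \<rho> then (\<Sum>ls | length ls = n. h (ls @ us @ [\<rho>]) * Qs ls (v (i # us)) []) else 0)"
    by (intro sum.cong refl) auto
  also have "\<dots> = (\<Sum>us | length us = N. \<Sum>\<rho>\<in>UNIV. \<Sum>ls | length ls = n. h (ls @ us @ [\<rho>]) * Qs ls (v (\<rho> # us)) [])"
    by simp
  also have "\<dots> = (\<Sum>us | length us = N. \<Sum>\<rho>\<in>UNIV. \<Sum>ls | length ls = n. h (ls @ \<rho> # us) * Qs ls (v (\<rho> # us)) [])"
    by (intro sum.cong refl arg_cong2[of _ _ _ _ "(*)"] msymD[OF assms(1)]) simp
  also have "\<dots> = Tsum m h n v"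
    unfolding Tsum_def N sum_len_Suc by (rule sum.swap)
  finally show ?thesis .
qed

text \<open>Invariance of \<open>h\<close> in the direction b, contracted with \<open>K\<close> and
  summed over b, splits by slots. The curvature slots give 0 by \<open>sum_lie_der_Qs_Cons\<close>,
  the \<open>Suc N\<close> symmetric slots give equal multiples of \<open>Ysum\<close>, and in the
  last slot C_{b\<rho>}^\<sigma> forms one more curvature.\<close>

lemma Ysum_eq:
  assumes "perm_inv h" "invariant_tensor C m h" "perm_inv v" "\<And>us. skew (v us)" "m = Suc N + Suc n"
  shows "real (Suc N) * Ysum h n N v = Tsum m h (Suc n) v"
proof -
  define K where "K ls us b \<rho> = Qs ls (\<lambda>xs. v us (b # xs)) [\<rho>]" for ls us b \<rho>
  have K: "Qs ls (v us) [b, \<rho>] = K ls us b \<rho>" for ls us b \<rho>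
    by (simp add: K_def Qs_Cons[OF assms(4)])
  have N: "m - Suc n = Suc N" using assms(5) by auto
  let ?H = "\<lambda>ls us \<rho>. h (ls @ us @ [\<rho>])"
  have inv: "D b (\<lambda>ls. ?H ls us \<rho>) ls + D b (\<lambda>us. ?H ls us \<rho>) us + (\<Sum>\<sigma>\<in>UNIV. C b \<rho> \<sigma> * ?H ls us \<sigma>) = 0"
    if "length ls = n" "length us = Suc N" for ls us \<rho> b
  proof -
    have "D b h (ls @ us @ [\<rho>]) = 0" using assms(2,5) that by (simp add: invariant_tensor_lie_der)
    then show ?thesis by (simp add: lie_der_append)
  qed
  have A: "(\<Sum>ls | length ls = n. \<Sum>us | length us = Suc N. \<Sum>\<rho>\<in>UNIV. \<Sum>b\<in>UNIV. D b (\<lambda>ls. ?H ls us \<rho>) ls * K ls us b \<rho>) = 0"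
  proof -
    have "(\<Sum>ls | length ls = n. \<Sum>us | length us = Suc N. \<Sum>\<rho>\<in>UNIV. \<Sum>b\<in>UNIV. D b (\<lambda>ls. ?H ls us \<rho>) ls * K ls us b \<rho>)
       = (\<Sum>us | length us = Suc N. \<Sum>\<rho>\<in>UNIV. \<Sum>b\<in>UNIV. \<Sum>ls | length ls = n. D b (\<lambda>ls. ?H ls us \<rho>) ls * K ls us b \<rho>)"
      by (rule sum4_move)
    also have "\<dots> = (\<Sum>us | length us = Suc N. \<Sum>\<rho>\<in>UNIV. \<Sum>b\<in>UNIV. - (\<Sum>ls | length ls = n. ?H ls us \<rho> * D b (\<lambda>ls. K ls us b \<rho>) ls))"
      by (simp add: sum_lie_der_adjoint)
    also have "\<dots> = (\<Sum>us | length us = Suc N. \<Sum>\<rho>\<in>UNIV. - (\<Sum>ls | length ls = n. \<Sum>b\<in>UNIV. ?H ls us \<rho> * D b (\<lambda>ls. K ls us b \<rho>) ls))"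
      unfolding sum_negf by (subst sum.swap[of _ UNIV "{ls. length ls = n}"]) simp
    also have "\<dots> = 0"
      unfolding sum_distrib_left[symmetric] K_def sum_lie_der_Qs_Cons[OF assms(4)] by simp
    finally show ?thesis .
  qed
  have B: "(\<Sum>ls | length ls = n. \<Sum>us | length us = Suc N. \<Sum>\<rho>\<in>UNIV. \<Sum>b\<in>UNIV. D b (\<lambda>us. ?H ls us \<rho>) us * K ls us b \<rho>)
     = - (real (Suc N) * Ysum h n N v)"
  proof -
    have f: "perm_inv (\<lambda>us. ?H ls us \<rho>)" for ls \<rho>
      unfolding perm_inv_def by (auto intro!: msymD[OF assms(1)])
    have g: "perm_inv (\<lambda>us. K ls us b \<rho>)" for ls b \<rho>
      unfolding perm_inv_def K_def by (metis msymD[OF assms(3)])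
    have "(\<Sum>ls | length ls = n. \<Sum>us | length us = Suc N. \<Sum>\<rho>\<in>UNIV. \<Sum>b\<in>UNIV. D b (\<lambda>us. ?H ls us \<rho>) us * K ls us b \<rho>)
      = (\<Sum>ls | length ls = n. \<Sum>\<rho>\<in>UNIV. \<Sum>b\<in>UNIV. \<Sum>us | length us = Suc N. D b (\<lambda>us. ?H ls us \<rho>) us * K ls us b \<rho>)"
      by (rule sum.cong, rule refl, rule sum3_move)
    also have "\<dots> = (\<Sum>ls | length ls = n. \<Sum>\<rho>\<in>UNIV. \<Sum>b\<in>UNIV. real (Suc N) * (\<Sum>us | length us = N. \<Sum>i\<in>UNIV. \<Sum>l\<in>UNIV.
        C b i l * ?H ls (l # us) \<rho> * K ls (i # us) b \<rho>))"
      by (intro sum.cong refl sum_lie_der_perm_inv f g)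
    also have "\<dots> = real (Suc N) * (\<Sum>ls | length ls = n. \<Sum>\<rho>\<in>UNIV. \<Sum>b\<in>UNIV. \<Sum>us | length us = N. \<Sum>i\<in>UNIV. \<Sum>l\<in>UNIV.
        C b i l * ?H ls (l # us) \<rho> * K ls (i # us) b \<rho>)"
      by (simp add: sum_distrib_left)
    also have "(\<Sum>ls | length ls = n. \<Sum>\<rho>\<in>UNIV. \<Sum>b\<in>UNIV. \<Sum>us | length us = N. \<Sum>i\<in>UNIV. \<Sum>l\<in>UNIV.
        C b i l * ?H ls (l # us) \<rho> * K ls (i # us) b \<rho>)
       = (\<Sum>ls | length ls = n. \<Sum>\<rho>\<in>UNIV. \<Sum>us | length us = N. \<Sum>i\<in>UNIV. \<Sum>l\<in>UNIV. \<Sum>b\<in>UNIV.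
        C b i l * ?H ls (l # us) \<rho> * K ls (i # us) b \<rho>)"
      by (rule sum.cong, rule refl, rule sum.cong, rule refl, rule sum4_move)
    also have "\<dots> = (\<Sum>ls | length ls = n. \<Sum>us | length us = N. \<Sum>\<rho>\<in>UNIV. \<Sum>i\<in>UNIV. \<Sum>l\<in>UNIV. \<Sum>b\<in>UNIV.
        C b i l * ?H ls (l # us) \<rho> * K ls (i # us) b \<rho>)"
      by (rule sum.cong, rule refl, rule sum.swap)
    also have "\<dots> = (\<Sum>us | length us = N. \<Sum>\<rho>\<in>UNIV. \<Sum>i\<in>UNIV. \<Sum>ls | length ls = n. \<Sum>l\<in>UNIV. \<Sum>b\<in>UNIV.
        C b i l * ?H ls (l # us) \<rho> * K ls (i # us) b \<rho>)"
      by (rule sum4_move)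
    also have "\<dots> = (\<Sum>us | length us = N. \<Sum>\<rho>\<in>UNIV. \<Sum>i\<in>UNIV. \<Sum>ls | length ls = n. \<Sum>l\<in>UNIV. \<Sum>b\<in>UNIV.
        - (h (l # ls @ us @ [\<rho>]) * C i b l * K ls (i # us) b \<rho>))"
    proof (intro sum.cong refl)
      fix us \<rho> i ls l b
      have "?H ls (l # us) \<rho> = h (l # ls @ us @ [\<rho>])" by (rule msymD[OF assms(1)]) simp
      then show "C b i l * ?H ls (l # us) \<rho> * K ls (i # us) b \<rho> = - (h (l # ls @ us @ [\<rho>]) * C i b l * K ls (i # us) b \<rho>)"
        using C_swap12[of b i l] by simp
    qed
    also have "\<dots> = - Ysum h n N v"
      by (simp add: Ysum_def K_def sum_negf)
    finally show ?thesis by (simp only: mult_minus_right)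
  qed
  have E: "(\<Sum>ls | length ls = n. \<Sum>us | length us = Suc N. \<Sum>\<rho>\<in>UNIV. \<Sum>b\<in>UNIV. (\<Sum>\<sigma>\<in>UNIV. C b \<rho> \<sigma> * ?H ls us \<sigma>) * K ls us b \<rho>)
     = Tsum m h (Suc n) v"
  proof -
    have "(\<Sum>\<rho>\<in>UNIV. \<Sum>b\<in>UNIV. (\<Sum>\<sigma>\<in>UNIV. C b \<rho> \<sigma> * ?H ls us \<sigma>) * K ls us b \<rho>)
      = (\<Sum>\<sigma>\<in>UNIV. h ((ls @ [\<sigma>]) @ us) * Qs (ls @ [\<sigma>]) (v us) [])" for ls us
    proof -
      have "(\<Sum>\<rho>\<in>UNIV. \<Sum>b\<in>UNIV. (\<Sum>\<sigma>\<in>UNIV. C b \<rho> \<sigma> * ?H ls us \<sigma>) * K ls us b \<rho>)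
         = (\<Sum>\<rho>\<in>UNIV. \<Sum>b\<in>UNIV. \<Sum>\<sigma>\<in>UNIV. ?H ls us \<sigma> * (C b \<rho> \<sigma> * K ls us b \<rho>))"
        by (simp add: sum_distrib_left sum_distrib_right algebra_simps)
      also have "\<dots> = (\<Sum>\<sigma>\<in>UNIV. \<Sum>b\<in>UNIV. \<Sum>\<rho>\<in>UNIV. ?H ls us \<sigma> * (C b \<rho> \<sigma> * K ls us b \<rho>))"
        by (rule sum3_rev)
      also have "\<dots> = (\<Sum>\<sigma>\<in>UNIV. ?H ls us \<sigma> * Qs (ls @ [\<sigma>]) (v us) [])"
        by (simp add: Qs_append Q_def K sum_distrib_left)
      also have "\<dots> = (\<Sum>\<sigma>\<in>UNIV. h ((ls @ [\<sigma>]) @ us) * Qs (ls @ [\<sigma>]) (v us) [])"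
        by (intro sum.cong refl arg_cong2[of _ _ _ _ "(*)"] msymD[OF assms(1)]) simp
      finally show ?thesis .
    qed
    then show ?thesis unfolding Tsum_def N sum_len_snoc[of _ n] by (simp add: sum.swap[of _ "{ls. length ls = n}"])
  qed
  have "0 = (\<Sum>ls | length ls = n. \<Sum>us | length us = Suc N. \<Sum>\<rho>\<in>UNIV. \<Sum>b\<in>UNIV.
      (D b (\<lambda>ls. ?H ls us \<rho>) ls + D b (\<lambda>us. ?H ls us \<rho>) us + (\<Sum>\<sigma>\<in>UNIV. C b \<rho> \<sigma> * ?H ls us \<sigma>)) * K ls us b \<rho>)"
    by (simp add: inv)
  also have "\<dots> = - (real (Suc N) * Ysum h n N v) + Tsum m h (Suc n) v"
    using A B E by (simp add: distrib_right sum.distrib)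
  finally show ?thesis by simp
qed

text \<open>By \<open>Ysum_eq\<close> the commutator term, multiplied by m-n, is 2n times
  \<open>Tsum\<close>, and (m-n) + 2n = m+n. At n = 0 there is no curvature and no commutator
  term.\<close>

lemma Ssum_koszul:
  assumes "perm_inv h" "invariant_tensor C m h" "perm_inv v" "\<And>us. skew (v us)" "n < m"
  shows "real (m - n) * Ssum m h n (koszul v) = real (m + n) * Tsum m h n v"
proof -
  obtain N where m: "m = Suc N + n" using assms(5) by (metis add.commute add_Suc less_imp_Suc_add)
  have "real n * (real (Suc N) * Ysum h (n - 1) N v) = real n * Tsum m h n v"
  proof (cases n)
    case (Suc n')
    then show ?thesis using Ysum_eq[OF assms(1-4), of N n'] m by simp
  qed simp
  then show ?thesis unfolding Ssum_koszul_Ysum[OF assms(1,4) m] using m by (simp add: algebra_simps)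
qed

end

section \<open>Exactness of the boundary on harmonic cochains\<close>

context antisym_lie_constants
begin

text \<open>Orthogonality to the ideal generated by the invariants of positive order below \<open>m\<close>. This is
  what makes \<open>bdry\<close> exact: a Casimir-harmonic element of \<open>harmonic_cochain m p q\<close> is, for each value of its skew
  indices, an invariant of order \<open>q\<close> orthogonal to itself.\<close>

definition contraction_free :: "nat \<Rightarrow> ('i list \<Rightarrow> 'i tensor) \<Rightarrow> bool" where
  "contraction_free m f \<longleftrightarrow> (\<forall>k p. 0 < k \<longrightarrow> k < m \<longrightarrow> symmetric_tensor k p \<longrightarrow> invariant_tensor C k p \<longrightarrow>
     (\<forall>us js. (\<Sum>ks | length ks = k. p ks * f (us @ ks) js) = 0))"

text \<open>Skew degree \<open>p\<close>, symmetric degree \<open>q\<close>. Invariance refers to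
  the simultaneous action on both groups of slots; vanishing in other degrees lets all equations be
  stated for arbitrary lists.\<close>

definition harmonic_cochain :: "nat \<Rightarrow> nat \<Rightarrow> nat \<Rightarrow> ('i list \<Rightarrow> 'i tensor) \<Rightarrow> bool" where
  "harmonic_cochain m p q f \<longleftrightarrow> perm_inv f \<and> (\<forall>us. skew (f us)) \<and>
     (\<forall>\<nu> us js. D \<nu> (f us) js + D \<nu> (\<lambda>us. f us js) us = 0) \<and>
     (\<forall>us js. length us \<noteq> q \<or> length js \<noteq> p \<longrightarrow> f us js = 0) \<and> contraction_free m f"

text \<open>Equivariant linear operators on the skew slots that take degree \<open>p\<close> to
  \<open>p'\<close>; the Casimir operator and its homotopy are the two instances.\<close>

definition skew_slot_op :: "nat \<Rightarrow> nat \<Rightarrow> ('i tensor \<Rightarrow> 'i tensor) \<Rightarrow> bool" where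
  "skew_slot_op p p' P \<longleftrightarrow> (\<forall>g. skew g \<longrightarrow> skew (P g)) \<and> (\<forall>\<nu> g js. D \<nu> (P g) js = P (D \<nu> g) js) \<and>
     (\<forall>g g' js. P (\<lambda>js. g js + g' js) js = P g js + P g' js) \<and>
     (\<forall>c g js. P (\<lambda>js. c * g js) js = c * P g js) \<and>
     (\<forall>g js. (\<forall>xs. length xs \<noteq> p \<longrightarrow> g xs = 0) \<longrightarrow> length js \<noteq> p' \<longrightarrow> P g js = 0)"

text \<open>The symmetric slots are mere parameters for \<open>P\<close>, so their Lie derivatives
  and the contractions with invariants pass through by linearity.\<close>

lemma harmonic_cochain_skew_slot_op:
  assumes P: "skew_slot_op p p' P" and f: "harmonic_cochain m p q f"
  shows "harmonic_cochain m p' q (\<lambda>us. P (f us))"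
proof -
  have add: "P (\<lambda>js. g js + g' js) js = P g js + P g' js" for g g' js
    using P by (simp add: skew_slot_op_def)
  have scale: "P (\<lambda>js. c * g js) js = c * P g js" for c g js
    using P by (simp add: skew_slot_op_def)
  have zero: "P (\<lambda>_. 0) js = 0" for js using scale[of 0 "\<lambda>_. 0" js] by simp
  have sum: "P (\<lambda>js. \<Sum>x\<in>A. c x * g x js) js = (\<Sum>x\<in>A. c x * P (g x) js)" for A :: "'b set" and c g js
    by (induction A rule: infinite_finite_induct) (simp_all add: zero add scale)
  have lie_der: "D \<nu> (\<lambda>us. P (g us) js) us = P (\<lambda>js. D \<nu> (\<lambda>us. g us js) us) js" for \<nu> g us js
  proof (induction us arbitrary: g)
    case (Cons k us)
    show ?case using Cons[of "\<lambda>us. g (k # us)"] by (simp add: add sum)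
  qed (simp add: zero)
  have sk: "skew (f us)" for us using f by (simp add: harmonic_cochain_def)
  have inv: "D \<nu> (P (f us)) js + D \<nu> (\<lambda>us. P (f us) js) us = 0" for \<nu> us js
  proof -
    have "D \<nu> (P (f us)) js + D \<nu> (\<lambda>us. P (f us) js) us = P (\<lambda>js. D \<nu> (f us) js + D \<nu> (\<lambda>us. f us js) us) js"
      using P by (simp add: skew_slot_op_def lie_der)
    also have "(\<lambda>js. D \<nu> (f us) js + D \<nu> (\<lambda>us. f us js) us) = (\<lambda>_. 0)"
      using f by (simp add: harmonic_cochain_def)
    finally show ?thesis by (simp add: zero)
  qed
  have hom: "P (f us) js = 0" if "length us \<noteq> q \<or> length js \<noteq> p'" for us js
  proof (cases "length us = q")
    case True
    have "\<forall>xs. length xs \<noteq> p \<longrightarrow> f us xs = 0" using f by (simp add: harmonic_cochain_def)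
    with True that P show ?thesis by (simp add: skew_slot_op_def)
  next
    case False
    then have "f us = (\<lambda>_. 0)" using f by (auto simp: harmonic_cochain_def)
    then show ?thesis by (simp add: zero)
  qed
  have cf: "contraction_free m (\<lambda>us. P (f us))"
    unfolding contraction_free_def
  proof (intro allI impI)
    fix k p us js
    assume "0 < k" "k < m" "symmetric_tensor k p" "invariant_tensor C k p"
    then have "(\<lambda>js. \<Sum>ks | length ks = k. p ks * f (us @ ks) js) = (\<lambda>_. 0)"
      using f by (simp add: harmonic_cochain_def contraction_free_def)
    then show "(\<Sum>ks | length ks = k. p ks * P (f (us @ ks)) js) = 0"
      by (simp add: sum[symmetric] zero)
  qed
  have "perm_inv f" using f by (simp add: harmonic_cochain_def)
  then have "perm_inv (\<lambda>us. P (f us))" unfolding perm_inv_def by metis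
  then show ?thesis using inv hom cf sk P by (auto simp: harmonic_cochain_def skew_slot_op_def)
qed

lemma harmonic_cochain_lincomb:
  assumes "harmonic_cochain m p q f" "harmonic_cochain m p q g"
  shows "harmonic_cochain m p q (\<lambda>us js. f us js + c * g us js)"
proof -
  have "perm_inv (\<lambda>us js. f us js + c * g us js)"
    using assms unfolding harmonic_cochain_def perm_inv_def by metis
  moreover have "skew (\<lambda>js. f us js + c * g us js)" for us
  proof -
    have "skew (f us)" "skew (g us)" using assms by (auto simp: harmonic_cochain_def)
    then show ?thesis unfolding skew_def by (metis add_uminus_conv_diff minus_add_distrib mult_minus_right)
  qed
  moreover have "D \<nu> (\<lambda>js. f us js + c * g us js) js + D \<nu> (\<lambda>us. f us js + c * g us js) us = 0" for \<nu> us js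
  proof -
    have "D \<nu> (f us) js + D \<nu> (\<lambda>us. f us js) us = 0" "D \<nu> (g us) js + D \<nu> (\<lambda>us. g us js) us = 0"
      using assms by (auto simp: harmonic_cochain_def)
    then have "(D \<nu> (f us) js + D \<nu> (\<lambda>us. f us js) us) + c * (D \<nu> (g us) js + D \<nu> (\<lambda>us. g us js) us) = 0"
      by simp
    then show ?thesis by (simp add: lie_der_add lie_der_scale algebra_simps)
  qed
  moreover have "contraction_free m (\<lambda>us js. f us js + c * g us js)"
    unfolding contraction_free_def
  proof (intro allI impI)
    fix k p us js
    assume *: "0 < k" "k < m" "symmetric_tensor k p" "invariant_tensor C k p"
    have "(\<Sum>ks | length ks = k. p ks * (f (us @ ks) js + c * g (us @ ks) js)) =
      (\<Sum>ks | length ks = k. p ks * f (us @ ks) js) + c * (\<Sum>ks | length ks = k. p ks * g (us @ ks) js)"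
      by (simp add: sum.distrib sum_distrib_left algebra_simps)
    also have "\<dots> = 0" using * assms by (simp add: harmonic_cochain_def contraction_free_def)
    finally show "(\<Sum>ks | length ks = k. p ks * (f (us @ ks) js + c * g (us @ ks) js)) = 0" .
  qed
  ultimately show ?thesis using assms by (auto simp: harmonic_cochain_def)
qed

lemma harmonic_cochain_zero: "harmonic_cochain m p q (\<lambda>us js. 0)"
  by (simp add: harmonic_cochain_def contraction_free_def perm_inv_def skew_def lie_der_zero)

lemma lie_der_length: "(\<And>xs. length xs \<noteq> p \<Longrightarrow> g xs = 0) \<Longrightarrow> length js \<noteq> p \<Longrightarrow> D i g js = 0"
  using lie_der_cong[of js g "\<lambda>_. 0" C i] by (simp add: lie_der_zero)

lemma wedge_length: "(\<And>xs. length xs \<noteq> p \<Longrightarrow> g xs = 0) \<Longrightarrow> length js \<noteq> Suc p \<Longrightarrow> wedge i g js = 0"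
  using wedge_cong[of js g "\<lambda>_. 0" i] by (simp add: wedge_zero)

lemma lie_der_add_fun: "D \<nu> (\<lambda>js. g js + g' js) = (\<lambda>js. D \<nu> g js + D \<nu> g' js)"
  by (rule ext) (rule lie_der_add)

lemma lie_der_scale_fun: "D \<nu> (\<lambda>js. c * g js) = (\<lambda>js. c * D \<nu> g js)"
  by (rule ext) (rule lie_der_scale)

lemma skew_slot_op_casimir: "skew_slot_op p p casimir"
proof -
  have "casimir g js = 0" if "\<forall>xs. length xs \<noteq> p \<longrightarrow> g xs = 0" "length js \<noteq> p" for g js
    unfolding casimir_def using that by (auto intro!: sum.neutral lie_der_length[of p])
  moreover have "skew (casimir g)" if "skew g" for g
    unfolding casimir_def by (intro skew_sum skew_lie_der that)
  ultimately show ?thesis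
    by (auto simp: skew_slot_op_def lie_der_casimir) (simp_all add: casimir_def lie_der_add_fun lie_der_scale_fun sum.distrib sum_distrib_left)
qed

text \<open>By Cartan's formula \<open>bdry_wedge\<close>, \<open>casimir_htpy\<close> is a homotopy between the Casimir operator and zero on \<open>bdry\<close>-closed
  elements.\<close>

definition casimir_htpy :: "'i tensor \<Rightarrow> 'i tensor" where
  "casimir_htpy g js = (- 1 / 2) * (\<Sum>i\<in>UNIV. wedge i (D i g) js)"

lemma lie_der_casimir_htpy: "D \<nu> (casimir_htpy g) js = casimir_htpy (D \<nu> g) js"
proof -
  have 1: "D \<nu> (D i g) = (\<lambda>js. D i (D \<nu> g) js - (\<Sum>k\<in>UNIV. C \<nu> i k * D k g js))" for i
    by (rule ext) (rule lie_der_commutator)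
  have 2: "(\<Sum>i\<in>UNIV. \<Sum>\<rho>\<in>UNIV. C \<nu> \<rho> i * wedge \<rho> (D i g) js) = (\<Sum>i\<in>UNIV. \<Sum>k\<in>UNIV. C \<nu> i k * wedge i (D k g) js)"
    by (rule sum.swap)
  have "D \<nu> (\<lambda>js. \<Sum>i\<in>UNIV. wedge i (D i g) js) js = (\<Sum>i\<in>UNIV. wedge i (D i (D \<nu> g)) js)"
    by (simp add: lie_der_sum lie_der_wedge 1 wedge_diff wedge_sum wedge_scale sum.distrib sum_subtractf 2)
  then show ?thesis unfolding casimir_htpy_def lie_der_scale by simp
qed

lemma skew_slot_op_casimir_htpy: "skew_slot_op p (Suc p) casimir_htpy"
proof -
  have "casimir_htpy g js = 0" if "\<forall>xs. length xs \<noteq> p \<longrightarrow> g xs = 0" "length js \<noteq> Suc p" for g js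
    unfolding casimir_htpy_def using that by (auto intro!: sum.neutral lie_der_length[of p] wedge_length[of p])
  moreover have "skew (casimir_htpy g)" if "skew g" for g
    unfolding casimir_htpy_def by (intro skew_scale skew_sum skew_wedge skew_lie_der that)
  ultimately show ?thesis
    unfolding skew_slot_op_def lie_der_casimir_htpy
    by (auto simp: casimir_htpy_def lie_der_add_fun lie_der_scale_fun wedge_add wedge_scale sum.distrib sum_distrib_left distrib_left algebra_simps)
qed

text \<open>With \<open>g\<close> closed, every D_i g is closed, so Cartan's formula leaves only -2
  D_i D_i g; the factor -1/2 in the homotopy cancels the coefficient.\<close>

lemma bdry_casimir_htpy:
  assumes "skew g" "\<And>js. bdry g js = 0"
  shows "bdry (casimir_htpy g) js = casimir g js"
proof -
  have "bdry (D i g) = (\<lambda>_. 0)" for i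
  proof
    fix js
    have "bdry g = (\<lambda>_. 0)" using assms(2) by auto
    then show "bdry (D i g) js = 0" by (simp add: lie_der_bdry[symmetric] lie_der_zero)
  qed
  then have "bdry (wedge i (D i g)) js = - 2 * D i (D i g) js" for i js
    by (simp add: bdry_wedge[OF skew_lie_der[OF assms(1)]] wedge_zero)
  then show ?thesis
    unfolding casimir_htpy_def casimir_def bdry_scale bdry_sum by (simp add: sum_distrib_left sum_negf)
qed

text \<open>The pairing with the Casimir operator is minus a sum of squares of all D_i, so each D_i
  vanishes on the skew slots and, by joint invariance, on the symmetric ones. For fixed
  \<open>js\<close> the tensor itself then qualifies as a \<open>p\<close> in
  \<open>contraction_free\<close>, because 0 < q < m, and its square norm is zero.\<close>

lemma harmonic_cochain_kernel:
  assumes w: "harmonic_cochain m p q w" and q: "0 < q" "q < m"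
    and z: "(\<Sum>us | length us = q. \<Sum>js | length js = p. w us js * casimir (w us) js) = 0"
  shows "w us js = 0"
proof -
  have "(\<Sum>js | length js = p. w us js * casimir (w us) js) = - (\<Sum>i\<in>UNIV. \<Sum>js | length js = p. (D i (w us) js)\<^sup>2)" for us
  proof -
    have "(\<Sum>js | length js = p. w us js * casimir (w us) js) = (\<Sum>i\<in>UNIV. \<Sum>js | length js = p. w us js * D i (D i (w us)) js)"
      unfolding casimir_def sum_distrib_left by (rule sum.swap)
    then show ?thesis by (simp add: sum_lie_der_adjoint power2_eq_square sum_negf)
  qed
  with z have "(\<Sum>us | length us = q. \<Sum>i\<in>UNIV. \<Sum>js | length js = p. (D i (w us) js)\<^sup>2) = 0"
    by (simp add: sum_negf)
  then have "\<forall>us\<in>{us. length us = q}. (\<Sum>i\<in>UNIV. \<Sum>js | length js = p. (D i (w us) js)\<^sup>2) = 0"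
    by (subst (asm) sum_nonneg_eq_0_iff) (auto intro!: sum_nonneg)
  then have "\<forall>us\<in>{us. length us = q}. \<forall>i\<in>UNIV. (\<Sum>js | length js = p. (D i (w us) js)\<^sup>2) = 0"
    by (subst (asm) sum_nonneg_eq_0_iff) (auto intro!: sum_nonneg)
  then have D0: "D i (w us) js = 0" if "length us = q" "length js = p" for i us js
    using that by (subst (asm) sum_nonneg_eq_0_iff) auto
  show ?thesis
  proof (cases "length us = q \<and> length js = p")
    case True
    let ?p = "\<lambda>us. w us js"
    have ms: "perm_inv w" using w by (simp add: harmonic_cochain_def)
    have "symmetric_tensor q ?p"
      unfolding symmetric_tensor_def
    proof (intro allI impI)
      fix us :: "'i list" and \<pi> assume "length us = q" "\<pi> permutes {..<q}"
      then have "w (permute_list \<pi> us) = w us" by (intro msymD[OF ms]) simp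
      then show "?p (permute_list \<pi> us) = ?p us" by simp
    qed
    moreover have "invariant_tensor C q ?p"
      unfolding invariant_tensor_lie_der
    proof (intro allI impI)
      fix \<nu> and ks :: "'i list" assume "length ks = q"
      moreover have "D \<nu> (w ks) js + D \<nu> ?p ks = 0" using w unfolding harmonic_cochain_def by blast
      ultimately show "D \<nu> ?p ks = 0" using D0 True by simp
    qed
    ultimately have "(\<Sum>ks | length ks = q. ?p ks * w ([] @ ks) js) = 0"
      using w q unfolding harmonic_cochain_def contraction_free_def by blast
    then have "\<forall>ks\<in>{ks. length ks = q}. ?p ks * ?p ks = 0"
      by (subst (asm) sum_nonneg_eq_0_iff) auto
    then show ?thesis using True by simp
  next
    case False
    then show ?thesis using w by (auto simp: harmonic_cochain_def)
  qed
qed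

text \<open>Projection replaces the inverse of the Casimir operator. The residue \<open>w\<close> of
  \<open>x\<close> modulo the image of closed cochains is again closed, hence orthogonal to its own
  Casimir image, and \<open>harmonic_cochain_kernel\<close> makes it zero. The homotopy applied to a
  Casimir preimage of \<open>x\<close> is the required \<open>v\<close>.\<close>

lemma harmonic_cochain_bdry_exact:
  assumes x: "harmonic_cochain m p q x" "\<And>us js. bdry (x us) js = 0" and q: "0 < q" "q < m"
  shows "\<exists>v. harmonic_cochain m (Suc p) q v \<and> (\<forall>us js. bdry (v us) js = x us js)"
proof -
  define E where "E = {y. harmonic_cochain m p q y \<and> (\<forall>us js. bdry (y us) js = 0)}"
  have lin: "(\<lambda>us js. f us js + c * g us js) \<in> E" if "f \<in> E" "g \<in> E" for f g c
    using that harmonic_cochain_lincomb by (simp add: E_def bdry_add bdry_scale)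
  have casadd: "casimir (\<lambda>js. f js + c * g js) js = casimir f js + c * casimir g js" for f g c js
    using skew_slot_op_casimir by (simp add: skew_slot_op_def)
  have skE: "skew (y us)" if "y \<in> E" for y us using that by (simp add: E_def harmonic_cochain_def)
  have casE: "(\<lambda>us. casimir (y us)) \<in> E" if "y \<in> E" for y
  proof -
    have "bdry (casimir (y us)) js = 0" for us js
    proof -
      have "bdry (D i (D i (y us))) js = D i (D i (bdry (y us))) js" for i
        using lie_der_bdry[of i "D i (y us)" js] lie_der_bdry[of i "y us"] by (metis lie_der_cong)
      moreover have "bdry (y us) = (\<lambda>_. 0)" using that by (auto simp: E_def)
      moreover have "D i (\<lambda>_. 0) = (\<lambda>_. 0)" for i by (rule ext) (rule lie_der_zero)
      ultimately show ?thesis unfolding casimir_def bdry_sum by simp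
    qed
    then show ?thesis using that harmonic_cochain_skew_slot_op[OF skew_slot_op_casimir] by (simp add: E_def)
  qed
  define A where "A = {us :: 'i list. length us = q} \<times> {js :: 'i list. length js = p}"
  define U where "U y = (\<lambda>(us, js). casimir (y us) js)" for y :: "'i list \<Rightarrow> 'i tensor"
  have "\<exists>d\<in>U ` E. \<forall>e\<in>U ` E. (\<Sum>a\<in>A. ((\<lambda>(us, js). x us js) a - d a) * e a) = 0"
  proof (rule projection_exists)
    show "finite A" unfolding A_def by simp
    fix f a assume "f \<in> U ` E" "a \<notin> A"
    then obtain y where y: "y \<in> E" "f = U y" by auto
    then show "f a = 0" using casE[OF y(1)] \<open>a \<notin> A\<close>
      by (auto simp: U_def A_def E_def harmonic_cochain_def split: prod.splits)
  next
    have zero: "(\<lambda>us js. 0) \<in> E" using harmonic_cochain_zero bdry_scale[of 0 "\<lambda>_. 0"] by (simp add: E_def)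
    have eq: "(\<lambda>_. 0) = U (\<lambda>us js. 0)"
      using casadd[of "\<lambda>_. 0" 1 "\<lambda>_. 0"] by (auto simp: fun_eq_iff U_def)
    show "(\<lambda>_. 0) \<in> U ` E" unfolding eq using zero by (rule imageI)
  next
    fix f g c assume "f \<in> U ` E" "g \<in> U ` E"
    then obtain y z where yz: "y \<in> E" "f = U y" "z \<in> E" "g = U z" by auto
    have eq: "(\<lambda>a. f a + c * g a) = U (\<lambda>us js. y us js + c * z us js)"
      by (auto simp: yz casadd U_def)
    show "(\<lambda>a. f a + c * g a) \<in> U ` E" unfolding eq using lin[OF yz(1,3)] by (rule imageI)
  qed
  then obtain y where y: "y \<in> E" "\<And>z. z \<in> E \<Longrightarrow> (\<Sum>(us, js)\<in>A. (x us js - casimir (y us) js) * casimir (z us) js) = 0"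
    by (auto simp: U_def case_prod_unfold)
  define w where "w = (\<lambda>us js. x us js + (-1) * casimir (y us) js)"
  have wE: "w \<in> E" unfolding w_def using x casE[OF y(1)] by (intro lin) (auto simp: E_def)
  have "(\<Sum>(us, js)\<in>A. w us js * casimir (w us) js) = 0"
    using y(2)[OF wE] by (simp add: w_def)
  then have "(\<Sum>us | length us = q. \<Sum>js | length js = p. w us js * casimir (w us) js) = 0"
    by (simp add: A_def sum.cartesian_product)
  then have "w us js = 0" for us js
    using harmonic_cochain_kernel[of m p q w] wE q by (simp add: E_def)
  then have "casimir (y us) js = x us js" for us js by (simp add: w_def)
  moreover have "harmonic_cochain m (Suc p) q (\<lambda>us. casimir_htpy (y us))"
    using y(1) harmonic_cochain_skew_slot_op[OF skew_slot_op_casimir_htpy] by (simp add: E_def)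
  moreover have "bdry (casimir_htpy (y us)) js = casimir (y us) js" for us js
    using bdry_casimir_htpy[OF skE[OF y(1)]] y(1) by (simp add: E_def)
  ultimately show ?thesis by auto
qed

section \<open>The Koszul operator on harmonic cochains and the zigzag\<close>

lemma harmonic_cochain_koszul:
  assumes v: "harmonic_cochain m p (Suc q) v"
  shows "harmonic_cochain m (Suc p) q (koszul v)"
proof -
  have ms: "perm_inv v" using v by (simp add: harmonic_cochain_def)
  have hom: "v us js = 0" if "length us \<noteq> Suc q \<or> length js \<noteq> p" for us js
    using v that by (simp add: harmonic_cochain_def)
  have "perm_inv (koszul v)"
    unfolding perm_inv_def
  proof (intro allI impI ext)
    fix us us' :: "'i list" and js assume "mset us = mset us'"
    then have "v (i # us) = v (i # us')" for i by (intro msymD[OF ms]) simp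
    then show "koszul v us js = koszul v us' js" unfolding koszul_def by presburger
  qed
  moreover have "skew (koszul v us)" for us
    unfolding koszul_def using v by (intro skew_sum skew_wedge) (simp add: harmonic_cochain_def)
  moreover have "koszul v us js = 0" if "length us \<noteq> q \<or> length js \<noteq> Suc p" for us js
  proof (cases "length us = q")
    case True
    then show ?thesis using that unfolding koszul_def by (auto intro!: sum.neutral wedge_length[of p] hom)
  next
    case False
    then have "v (i # us) = (\<lambda>_. 0)" for i by (auto simp: hom)
    then show ?thesis by (simp add: koszul_def wedge_zero)
  qed
  moreover have "contraction_free m (koszul v)"
    unfolding contraction_free_def
  proof (intro allI impI)
    fix k p us js
    assume *: "0 < k" "k < m" "symmetric_tensor k p" "invariant_tensor C k p"
    have "(\<Sum>ks | length ks = k. p ks * koszul v (us @ ks) js) = (\<Sum>i\<in>UNIV. \<Sum>ks | length ks = k. wedge i (\<lambda>js. p ks * v ((i # us) @ ks) js) js)"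
      unfolding koszul_def by (subst sum.swap) (simp add: sum_distrib_left wedge_scale)
    also have "\<dots> = (\<Sum>i\<in>UNIV. wedge i (\<lambda>js. \<Sum>ks | length ks = k. p ks * v ((i # us) @ ks) js) js)"
      by (simp add: wedge_sum)
    \<comment> \<open>The index i that becomes skew is among the uncontracted ones; for this reason
      \<open>contraction_free\<close> allows arbitrary further indices \<open>us\<close>.\<close>
    also have "\<dots> = (\<Sum>i\<in>UNIV. wedge i (\<lambda>js. 0) js)"
      using * v by (simp only: harmonic_cochain_def contraction_free_def)
    finally show "(\<Sum>ks | length ks = k. p ks * koszul v (us @ ks) js) = 0" by (simp add: wedge_zero)
  qed
  moreover have "D \<nu> (koszul v us) js + D \<nu> (\<lambda>us. koszul v us js) us = 0" for \<nu> us js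
  proof -
    have 1: "D \<nu> (\<lambda>us. v (i # us) js) us = - D \<nu> (v (i # us)) js - (\<Sum>\<rho>\<in>UNIV. C \<nu> i \<rho> * v (\<rho> # us) js)" for i js
    proof -
      have "D \<nu> (v (i # us)) js + D \<nu> (\<lambda>us. v us js) (i # us) = 0" using v unfolding harmonic_cochain_def by blast
      then show ?thesis by simp
    qed
    have 2: "(\<Sum>i\<in>UNIV. \<Sum>\<rho>\<in>UNIV. C \<nu> \<rho> i * wedge \<rho> (v (i # us)) js) = (\<Sum>i\<in>UNIV. \<Sum>\<rho>\<in>UNIV. C \<nu> i \<rho> * wedge i (v (\<rho> # us)) js)"
      by (rule sum.swap)
    have "D \<nu> (koszul v us) js = (\<Sum>i\<in>UNIV. wedge i (D \<nu> (v (i # us))) js) + (\<Sum>i\<in>UNIV. \<Sum>\<rho>\<in>UNIV. C \<nu> \<rho> i * wedge \<rho> (v (i # us)) js)"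
      unfolding koszul_def by (simp add: lie_der_sum lie_der_wedge sum.distrib)
    moreover have "D \<nu> (\<lambda>us. koszul v us js) us = - (\<Sum>i\<in>UNIV. wedge i (D \<nu> (v (i # us))) js) - (\<Sum>i\<in>UNIV. \<Sum>\<rho>\<in>UNIV. C \<nu> i \<rho> * wedge i (v (\<rho> # us)) js)"
      unfolding koszul_def by (simp add: lie_der_sum lie_der_wedge_commute 1 wedge_diff wedge_minus wedge_sum wedge_scale sum_subtractf sum_negf)
    ultimately show ?thesis using 2 by simp
  qed
  ultimately show ?thesis by (simp add: harmonic_cochain_def)
qed

lemma koszul_koszul:
  assumes "perm_inv v" shows "koszul (koszul v) us js = 0"
proof -
  have "koszul (koszul v) us js = (\<Sum>i\<in>UNIV. \<Sum>k\<in>UNIV. wedge i (wedge k (v (k # i # us))) js)"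
    unfolding koszul_def by (simp add: wedge_sum)
  also have "\<dots> = 0"
  proof (rule sum2_antisym)
    fix i k
    have "v (k # i # us) = v (i # k # us)" by (rule msymD[OF assms]) simp
    then show "wedge i (wedge k (v (k # i # us))) js = - wedge k (wedge i (v (i # k # us))) js"
      using wedge_anticommute[of i k "v (k # i # us)" js] by simp
  qed
  finally show ?thesis .
qed

text \<open>Every slot contracts \<open>C\<close>, antisymmetric in i and \<rho>, with a pair of
  symmetric slots of \<open>f\<close>.\<close>

lemma sum_lie_der_perm_inv_Cons:
  fixes f :: "'i tensor"
  assumes "perm_inv f" shows "(\<Sum>i\<in>UNIV. D i (\<lambda>us. f (i # us)) us) = 0"
  using assms
proof (induction us arbitrary: f)
  case (Cons k us)
  have "(\<Sum>i\<in>UNIV. \<Sum>\<rho>\<in>UNIV. C i k \<rho> * f (i # \<rho> # us)) = 0"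
  proof (rule sum2_antisym)
    fix i \<rho>
    have "f (i # \<rho> # us) = f (\<rho> # i # us)" by (rule msymD[OF Cons.prems]) simp
    moreover have "C i k \<rho> = - C \<rho> k i" by (metis C_swap12 C_swap23 add.inverse_inverse)
    ultimately show "C i k \<rho> * f (i # \<rho> # us) = - (C \<rho> k i * f (\<rho> # i # us))" by simp
  qed
  moreover have "f (i # k # us) = f (k # i # us)" for i us by (rule msymD[OF Cons.prems]) simp
  then have "(\<Sum>i\<in>UNIV. D i (\<lambda>us. f (i # k # us)) us) = (\<Sum>i\<in>UNIV. D i (\<lambda>us. f (k # i # us)) us)"
    by presburger
  ultimately show ?case using Cons.IH[OF perm_inv_Cons[OF Cons.prems], of k] by (simp add: sum.distrib)
qed simp

text \<open>Besides the anticommutator, Cartan's formula produces the sum of D_i acting on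
  \<open>v (i # us)\<close>. Joint invariance shifts D_i to the symmetric slots, where
  \<open>sum_lie_der_perm_inv_Cons\<close> gives 0.\<close>

lemma bdry_koszul:
  assumes v: "harmonic_cochain m p q v"
  shows "bdry (koszul v us) js = - koszul (\<lambda>us. bdry (v us)) us js"
proof -
  have sk: "skew (v us)" for us using v by (simp add: harmonic_cochain_def)
  have ms: "perm_inv (\<lambda>us. v us js)" using v unfolding harmonic_cochain_def perm_inv_def by metis
  have "D i (v (i # us)) js = - D i (\<lambda>us. v (i # us) js) us" for i
  proof -
    have "D i (v (i # us)) js + D i (\<lambda>us. v us js) (i # us) = 0" using v unfolding harmonic_cochain_def by blast
    then show ?thesis by simp
  qed
  then have "(\<Sum>i\<in>UNIV. D i (v (i # us)) js) = 0"
    using sum_lie_der_perm_inv_Cons[OF ms, of us] by (simp add: sum_negf)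
  moreover have "bdry (koszul v us) js = (\<Sum>i\<in>UNIV. bdry (wedge i (v (i # us))) js)"
    unfolding koszul_def bdry_sum ..
  ultimately show ?thesis
    by (simp add: bdry_wedge[OF sk] koszul_def sum_subtractf sum_negf sum_distrib_left[symmetric])
qed

text \<open>The induction also carries that \<open>koszul\<close> kills the boundary of
  \<open>v\<close>: since the two operators anticommute, \<open>koszul v\<close> is closed, as the
  next inversion of the boundary needs. The property is inherited because the new boundary is
  \<open>koszul v\<close> and \<open>koszul\<close> squares to zero.\<close>

theorem transgression_nonzero:
  assumes h: "perm_inv h" "invariant_tensor C m h" and m: "0 < m"
    and h': "perm_inv h'" "invariant_tensor C m h'" "\<And>us. length us \<noteq> m \<Longrightarrow> h' us = 0"
    and cf: "\<And>k p us. 0 < k \<Longrightarrow> k < m \<Longrightarrow> symmetric_tensor k p \<Longrightarrow> invariant_tensor C k p \<Longrightarrow>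
      (\<Sum>ks | length ks = k. p ks * h' (us @ ks)) = 0"
    and ne: "(\<Sum>us | length us = m. h us * h' us) \<noteq> 0"
  shows "\<exists>g. skew g \<and> (\<Sum>ls | length ls = m - 1. \<Sum>\<rho>\<in>UNIV. h (ls @ [\<rho>]) * Qs ls g [\<rho>]) \<noteq> 0"
proof -
  have "\<exists>v. harmonic_cochain m (2 * n) (m - n) v \<and> (\<forall>us js. koszul (\<lambda>us. bdry (v us)) us js = 0) \<and> Tsum m h n v \<noteq> 0"
    if "n < m" for n
    using that
  proof (induction n)
    case 0
    define v where "v us js = (if js = [] then h' us else 0)" for us and js :: "'i list"
    have d0: "D \<nu> h' us = 0" for \<nu> us
      using h'(2) lie_der_length[of m h' us \<nu>] h'(3) by (cases "length us = m") (auto simp: invariant_tensor_lie_der)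
    have "D \<nu> (v us) js = 0" for \<nu> us js
      using lie_der_length[of 0 "v us" js \<nu>] by (cases js) (auto simp: v_def)
    moreover have "D \<nu> (\<lambda>us. v us js) us = 0" for \<nu> us js
      by (cases "js = []") (simp_all add: v_def d0 lie_der_zero)
    moreover have "perm_inv v" using h'(1) unfolding perm_inv_def v_def by metis
    moreover have "contraction_free m v"
      unfolding contraction_free_def
    proof (intro allI impI)
      fix k p us and js :: "'i list"
      assume "0 < k" "k < m" "symmetric_tensor k p" "invariant_tensor C k p"
      from cf[OF this] show "(\<Sum>ks | length ks = k. p ks * v (us @ ks) js) = 0"
        by (cases "js = []") (simp_all add: v_def)
    qed
    moreover have "skew (v us)" for us by (simp add: skew_def v_def)
    ultimately have "harmonic_cochain m (2 * 0) (m - 0) v"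
      by (auto simp: harmonic_cochain_def v_def h'(3))
    moreover have "Q c (v us) = (\<lambda>_. 0)" for c us by (rule ext) (simp add: Q_def v_def)
    then have "bdry (v us) = (\<lambda>_. 0)" for us by (intro ext) (simp add: bdry_def wedge_zero)
    then have "\<forall>us js. koszul (\<lambda>us. bdry (v us)) us js = 0" by (simp add: koszul_def wedge_zero)
    moreover have "Tsum m h 0 v \<noteq> 0" using ne by (simp add: Tsum_def v_def)
    ultimately show ?case by blast
  next
    case (Suc n)
    then obtain v where v: "harmonic_cochain m (2 * n) (m - n) v" "\<forall>us js. koszul (\<lambda>us. bdry (v us)) us js = 0" "Tsum m h n v \<noteq> 0"
      by auto
    have mn: "m - n = Suc (m - Suc n)" using Suc.prems by simp
    have x: "harmonic_cochain m (Suc (2 * n)) (m - Suc n) (koszul v)"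
      using v(1) unfolding mn by (rule harmonic_cochain_koszul)
    have "bdry (koszul v us) js = 0" for us js
      using bdry_koszul[OF v(1)] v(2) by simp
    then obtain v' where v': "harmonic_cochain m (Suc (Suc (2 * n))) (m - Suc n) v'" "\<forall>us js. bdry (v' us) js = koszul v us js"
      using harmonic_cochain_bdry_exact[OF x] Suc.prems by auto
    have sk: "skew (v us)" "skew (v' us)" for us using v(1) v'(1) by (auto simp: harmonic_cochain_def)
    have ms: "perm_inv v" using v(1) by (simp add: harmonic_cochain_def)
    have dv': "(\<lambda>us. bdry (v' us)) = koszul v" using v'(2) by (intro ext) simp
    have "real (m - n) * Tsum m h (Suc n) v' = real (m + n) * Tsum m h n v"
      using Ssum_bdry[of h v' m n, OF h(1) sk(2)] Ssum_koszul[OF h ms sk(1), of n] Suc.prems dv' by simp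
    then have "Tsum m h (Suc n) v' \<noteq> 0" using v(3) Suc.prems by auto
    moreover have "\<forall>us js. koszul (\<lambda>us. bdry (v' us)) us js = 0"
      unfolding dv' using koszul_koszul[OF ms] by blast
    ultimately show ?case using v'(1) by auto
  qed
  \<comment> \<open>One symmetric index is left at this stage. A last Koszul operator makes it the
    skew index \<rho>, and no boundary has to be inverted in symmetric degree 0.\<close>
  from this[of "m - 1"] m obtain v where v: "harmonic_cochain m (2 * (m - 1)) (m - (m - 1)) v" "Tsum m h (m - 1) v \<noteq> 0"
    by auto
  have sk: "skew (v us)" for us using v(1) by (simp add: harmonic_cochain_def)
  have ms: "perm_inv v" using v(1) by (simp add: harmonic_cochain_def)
  have "Ssum m h (m - 1) (koszul v) \<noteq> 0"
    using Ssum_koszul[OF h ms sk, of "m - 1"] v(2) m by auto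
  moreover have "skew (koszul v [])" unfolding koszul_def by (intro skew_sum skew_wedge sk)
  ultimately show ?thesis unfolding Ssum_def using m by auto
qed

end

section \<open>Symmetrisation and alternation\<close>

lemma symmetric_tensor_iff_mset:
  "symmetric_tensor m f \<longleftrightarrow> (\<forall>xs ys. length xs = m \<longrightarrow> mset xs = mset ys \<longrightarrow> f xs = f ys)"
proof (intro iffI allI impI)
  fix xs ys :: "'a list" assume f: "symmetric_tensor m f" and xs: "length xs = m" "mset xs = mset ys"
  obtain p where "p permutes {..<length ys}" "permute_list p ys = xs"
    using mset_eq_permutation[OF xs(2)] .
  then show "f xs = f ys" using f xs mset_eq_length[OF xs(2)] by (auto simp: symmetric_tensor_def)
next
  assume "\<forall>xs ys. length xs = m \<longrightarrow> mset xs = mset ys \<longrightarrow> f xs = f ys"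
  then show "symmetric_tensor m f" unfolding symmetric_tensor_def by (metis length_permute_list mset_permute_list)
qed

lemma symmetric_tensorD: "symmetric_tensor m f \<Longrightarrow> mset xs = mset ys \<Longrightarrow> length xs = m \<Longrightarrow> f xs = f ys"
  by (simp add: symmetric_tensor_iff_mset)

text \<open>Sorting by adjacent swaps: the head of one list is carried to the front of the other,
  and the tails are compared by induction with that head held fixed.\<close>

lemma symmetric_tensorI_adjacent:
  assumes "\<And>xs a b ys. length (xs @ a # b # ys) = m \<Longrightarrow> f (xs @ a # b # ys) = f (xs @ b # a # ys)"
  shows "symmetric_tensor m f"
proof -
  have "f xs = f ys" if "length xs = m" "mset xs = mset ys" for xs ys
    using that assms
  proof (induction xs arbitrary: ys f m)
    case (Cons x xs)
    obtain ys1 ys2 where ys: "ys = ys1 @ x # ys2"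
      using Cons.prems(2) by (metis list.set_intros(1) mset_eq_setD split_list)
    have len: "length ys = m" using Cons.prems(1) mset_eq_length[OF Cons.prems(2)] by simp
    have move: "f (zs @ ys1 @ x # ys2) = f (zs @ x # ys1 @ ys2)" if "length (zs @ ys1 @ x # ys2) = m" for zs ys1
      using that
    proof (induction ys1 arbitrary: zs)
      case (Cons y ys1)
      have "f (zs @ (y # ys1) @ x # ys2) = f (zs @ y # x # ys1 @ ys2)"
        using Cons.IH[of "zs @ [y]"] Cons.prems by simp
      also have "\<dots> = f (zs @ x # y # ys1 @ ys2)"
        using Cons.prems by (intro Cons.prems(1) \<open>\<And>xs a b ys. length (xs @ a # b # ys) = m \<Longrightarrow> f (xs @ a # b # ys) = f (xs @ b # a # ys)\<close>) simp
      finally show ?case by simp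
    qed simp
    have "f (x # xs) = f (x # ys1 @ ys2)"
    proof (rule Cons.IH[of "m - 1" "ys1 @ ys2" "\<lambda>zs. f (x # zs)"])
      fix as bs :: "'a list" and a b assume "length (as @ a # b # bs) = m - 1"
      then show "f (x # as @ a # b # bs) = f (x # as @ b # a # bs)"
        using Cons.prems(1) Cons.prems(3)[of "x # as" a b bs] by simp
    qed (use Cons.prems ys in auto)
    also have "\<dots> = f ys" using move[of "[]" ys1] len ys by simp
    finally show ?case .
  qed simp
  then show ?thesis by (simp add: symmetric_tensor_iff_mset)
qed

text \<open>Values at other lengths are arbitrary in a tensor of order \<open>m\<close>; setting
  them to zero makes conditions over all lengths, such as \<open>perm_inv\<close> and
  \<open>skew\<close>, available.\<close>

definition restrict_order :: "nat \<Rightarrow> 'i tensor \<Rightarrow> 'i tensor" where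
  "restrict_order m f is = (if length is = m then f is else 0)"

lemma perm_inv_restrict_order: "symmetric_tensor m f \<Longrightarrow> perm_inv (restrict_order m f)"
  unfolding perm_inv_def restrict_order_def by (metis symmetric_tensorD mset_eq_length)

lemma invariant_tensor_cong:
  assumes "\<And>is. length is = m \<Longrightarrow> f is = g is"
  shows "invariant_tensor C m f \<longleftrightarrow> invariant_tensor C m g"
  unfolding invariant_tensor_def using assms by (intro all_cong1 imp_cong refl arg_cong2[of _ _ _ _ "(=)"] sum.cong) auto

lemma symmetric_tensor_cong:
  assumes "\<And>is. length is = m \<Longrightarrow> f is = g is"
  shows "symmetric_tensor m f \<longleftrightarrow> symmetric_tensor m g"
  unfolding symmetric_tensor_def using assms by auto

lemma lie_der_permute_list:
  assumes "\<sigma> permutes {..<length is}"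
  shows "lie_der C \<nu> (\<lambda>is. g (permute_list \<sigma> is)) is = lie_der C \<nu> g (permute_list \<sigma> is)"
proof -
  have "permute_list \<sigma> (is[\<sigma> s := \<rho>]) = (permute_list \<sigma> is)[s := \<rho>]" if "s < length is" for s \<rho>
  proof (rule nth_equalityI)
    fix i assume "i < length (permute_list \<sigma> (is[\<sigma> s := \<rho>]))"
    then have i: "i < length is" by simp
    then have "\<sigma> i < length is" "\<sigma> s < length is" using permutes_in_image[OF assms] that by auto
    moreover have "\<sigma> i = \<sigma> s \<longleftrightarrow> i = s" using permutes_inj[OF assms] by (auto dest: injD)
    ultimately show "permute_list \<sigma> (is[\<sigma> s := \<rho>]) ! i = (permute_list \<sigma> is)[s := \<rho>] ! i"
      using i assms that by (auto simp: permute_list_nth nth_list_update)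
  qed simp
  then have "(\<Sum>s<length is. \<Sum>\<rho>\<in>UNIV. C \<nu> (is ! \<sigma> s) \<rho> * g (permute_list \<sigma> (is[\<sigma> s := \<rho>])))
     = (\<Sum>s<length is. \<Sum>\<rho>\<in>UNIV. C \<nu> (permute_list \<sigma> is ! s) \<rho> * g ((permute_list \<sigma> is)[s := \<rho>]))"
    by (intro sum.cong refl) (simp add: permute_list_nth[OF assms])
  then show ?thesis
    unfolding lie_der_nth by (subst sum.permute[OF assms]) simp
qed

lemma permute_list_inv:
  assumes "\<sigma> permutes {..<length is}"
  shows "permute_list (inv \<sigma>) (permute_list \<sigma> is) = is" "permute_list \<sigma> (permute_list (inv \<sigma>) is) = is"
  using permute_list_compose[OF permutes_inv[OF assms], of \<sigma>] permute_list_compose[OF assms, of "inv \<sigma>"]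
  by (simp_all add: permutes_inv_o[OF assms])

lemma sum_permute_list:
  assumes "\<sigma> permutes {..<n}"
  shows "(\<Sum>is | length is = n. F (permute_list \<sigma> is)) = (\<Sum>is | length is = n. F is)"
  by (rule sum.reindex_bij_witness[where i = "permute_list (inv \<sigma>)" and j = "permute_list \<sigma>"])
    (use assms in \<open>auto simp: permute_list_inv\<close>)

lemma symmetrize_symmetric: "symmetric_tensor m (symmetrize f)"
  unfolding symmetric_tensor_def
proof (intro allI impI)
  fix "is" :: "'a list" and \<pi> assume l: "length is = m" and \<pi>: "\<pi> permutes {..<m}"
  have "(\<Sum>\<sigma> | \<sigma> permutes {..<m}. f (permute_list \<sigma> (permute_list \<pi> is))) =
     (\<Sum>\<sigma> | \<sigma> permutes {..<m}. f (permute_list (\<pi> \<circ> \<sigma>) is))"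
    using l by (intro sum.cong refl) (simp add: permute_list_compose)
  also have "\<dots> = (\<Sum>\<sigma> | \<sigma> permutes {..<m}. f (permute_list \<sigma> is))"
    using setum_permutations_compose_left[OF \<pi>, of "\<lambda>\<sigma>. f (permute_list \<sigma> is)"] by simp
  finally show "symmetrize f (permute_list \<pi> is) = symmetrize f is"
    using l by (simp add: symmetrize_def)
qed

lemma symmetrize_invariant:
  assumes "invariant_tensor C m f" shows "invariant_tensor C m (symmetrize f)"
  unfolding invariant_tensor_lie_der
proof (intro allI impI)
  fix \<nu> and "is" :: "'a list" assume l: "length is = m"
  have "lie_der C \<nu> (symmetrize f) is = lie_der C \<nu> (\<lambda>is. inverse (fact m) * (\<Sum>\<pi> | \<pi> permutes {..<m}. f (permute_list \<pi> is))) is"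
    by (rule lie_der_cong) (simp add: symmetrize_def l field_simps)
  also have "\<dots> = inverse (fact m) * (\<Sum>\<pi> | \<pi> permutes {..<m}. lie_der C \<nu> f (permute_list \<pi> is))"
    unfolding lie_der_scale lie_der_sum using l by (simp add: lie_der_permute_list)
  also have "\<dots> = 0" using assms l by (simp add: invariant_tensor_lie_der)
  finally show "lie_der C \<nu> (symmetrize f) is = 0" .
qed

lemma sum_symmetrize:
  fixes f t :: "'i::finite tensor"
  assumes "symmetric_tensor m t"
  shows "(\<Sum>is | length is = m. t is * symmetrize f is) = (\<Sum>is | length is = m. t is * f is)"
proof -
  have "(\<Sum>is | length is = m. t is * symmetrize f is) =
    (\<Sum>is | length is = m. \<Sum>\<pi> | \<pi> permutes {..<m}. t is * f (permute_list \<pi> is)) / fact m"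
    by (simp add: symmetrize_def sum_distrib_left sum_divide_distrib)
  also have "(\<Sum>is | length is = m. \<Sum>\<pi> | \<pi> permutes {..<m}. t is * f (permute_list \<pi> is))
     = (\<Sum>\<pi> | \<pi> permutes {..<m}. \<Sum>is | length is = m. t is * f (permute_list \<pi> is))"
    by (rule sum.swap)
  also have "\<dots> = (\<Sum>\<pi> | \<pi> permutes {..<m}. \<Sum>is | length is = m. t (permute_list \<pi> is) * f (permute_list \<pi> is))"
    using assms by (intro sum.cong refl) (auto simp: symmetric_tensor_def)
  also have "\<dots> = (\<Sum>\<pi> | \<pi> permutes {..<m}. \<Sum>is | length is = m. t is * f is)"
    by (intro sum.cong refl sum_permute_list[of _ _ "\<lambda>is. t is * f is"]) simp
  also have "\<dots> = fact m * (\<Sum>is | length is = m. t is * f is)"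
    by (simp add: card_permutations)
  finally show ?thesis by simp
qed

section \<open>Skew tensors under permutations, and the alternation operator\<close>

lemma skew_swap_far:
  assumes "skew x" shows "x (xs @ u # ys @ v # zs) = - x (xs @ v # ys @ u # zs)"
proof (induction ys arbitrary: xs)
  case (Cons y ys)
  have "x (xs @ u # y # ys @ v # zs) = - x (xs @ y # u # ys @ v # zs)"
    by (rule skewD2[OF assms])
  moreover have "x (xs @ y # u # ys @ v # zs) = - x (xs @ y # v # ys @ u # zs)"
    using Cons[of "xs @ [y]"] by simp
  moreover have "x (xs @ y # v # ys @ u # zs) = - x (xs @ v # y # ys @ u # zs)"
    by (rule skewD2[OF assms])
  ultimately show ?case by simp
next
  case Nil
  show ?case unfolding append_Nil by (rule skewD2[OF assms])
qed

lemma permute_list_transpose: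
  assumes "a < length L" "b < length L"
  shows "permute_list (Transposition.transpose a b) L = L[a := L ! b, b := L ! a]"
proof (rule nth_equalityI)
  have p: "Transposition.transpose a b permutes {..<length L}" using assms by (intro permutes_swap_id) auto
  fix i assume "i < length (permute_list (Transposition.transpose a b) L)"
  then have "i < length L" by simp
  then show "permute_list (Transposition.transpose a b) L ! i = L[a := L ! b, b := L ! a] ! i"
    using assms unfolding permute_list_nth[OF p \<open>i < length L\<close>]
    by (cases "i = a"; cases "i = b") simp_all
qed simp

lemma skew_transpose:
  assumes "skew x" "a < length L" "b < length L" "a \<noteq> b"
  shows "x (permute_list (Transposition.transpose a b) L) = - x L"
proof -
  have *: "x (permute_list (Transposition.transpose a b) L) = - x L" if ab: "a < b" "b < length L" for a b
  proof -
    define xs where "xs = take a L"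
    have L1: "L = xs @ L ! a # drop (Suc a) L" "length xs = a"
      using ab by (auto simp: xs_def intro: id_take_nth_drop)
    define ys where "ys = take (b - Suc a) (drop (Suc a) L)"
    define zs where "zs = drop (Suc (b - Suc a)) (drop (Suc a) L)"
    have L2: "drop (Suc a) L = ys @ drop (Suc a) L ! (b - Suc a) # zs" "length ys = b - Suc a"
      unfolding ys_def zs_def by (rule id_take_nth_drop) (use ab in auto)
    obtain u v where L: "L = xs @ u # ys @ v # zs" using L1(1) L2(1) by metis
    have b: "b = Suc (a + length ys)" using L2(2) ab by simp
    have "permute_list (Transposition.transpose a b) L = xs @ v # ys @ u # zs"
      using ab L1(2) by (simp add: permute_list_transpose) (simp add: L b nth_append list_update_append)
    then show ?thesis using skew_swap_far[OF assms(1), of xs v ys u zs] L by simp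
  qed
  show ?thesis
    using *[of a b] *[of b a] assms by (cases "a < b") (auto simp: transpose_commute)
qed

lemma skew_permute_list:
  assumes "skew x" "\<sigma> permutes {..<length L}"
  shows "x (permute_list \<sigma> L) = of_int (sign \<sigma>) * x L"
proof -
  have "\<forall>K. length K = length L \<longrightarrow> x (permute_list \<sigma> K) = of_int (sign \<sigma>) * x K"
    using assms(2) finite_lessThan
  proof (induction rule: permutes_induct)
    case (swap a b p)
    have perm: "permutation p" "permutation (Transposition.transpose a b)"
      using swap.hyps by (auto intro: permutes_imp_permutation permutation_swap_id)
    have "x (permute_list (Transposition.transpose a b \<circ> p) K) = of_int (sign (Transposition.transpose a b \<circ> p)) * x K" if "length K = length L" for K
      using swap that by (simp add: permute_list_compose skew_transpose[OF assms(1)] sign_compose[OF perm(2,1)] sign_swap_id)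
    then show ?case by blast
  qed simp
  then show ?thesis by simp
qed

definition alternate :: "'i tensor \<Rightarrow> 'i tensor" where
  "alternate G is = (\<Sum>\<sigma> | \<sigma> permutes {..<length is}. of_int (sign \<sigma>) * G (permute_list \<sigma> is)) / fact (length is)"

lemma alternate_permute_list:
  assumes "\<tau> permutes {..<length is}"
  shows "alternate G (permute_list \<tau> is) = of_int (sign \<tau>) * alternate G is"
proof -
  define n where "n = length is"
  have \<tau>: "\<tau> permutes {..<n}" using assms by (simp add: n_def)
  have s: "of_int (sign (\<tau> \<circ> \<sigma>)) = (of_int (sign \<tau>) * of_int (sign \<sigma>) :: real)" if "\<sigma> permutes {..<n}" for \<sigma>
    using that \<tau> by (subst sign_compose) (auto intro: permutes_imp_permutation)
  have ss: "of_int (sign \<tau>) * of_int (sign \<tau>) = (1::real)" by (metis of_int_1 of_int_mult sign_idempotent)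
  have "(\<Sum>\<sigma> | \<sigma> permutes {..<n}. of_int (sign \<sigma>) * G (permute_list \<sigma> is))
     = (\<Sum>\<sigma> | \<sigma> permutes {..<n}. of_int (sign (\<tau> \<circ> \<sigma>)) * G (permute_list (\<tau> \<circ> \<sigma>) is))"
    by (rule setum_permutations_compose_left[OF \<tau>])
  also have "\<dots> = of_int (sign \<tau>) * (\<Sum>\<sigma> | \<sigma> permutes {..<n}. of_int (sign \<sigma>) * G (permute_list \<sigma> (permute_list \<tau> is)))"
    by (simp add: s sum_distrib_left n_def permute_list_compose mult.assoc)
  finally have "of_int (sign \<tau>) * (\<Sum>\<sigma> | \<sigma> permutes {..<n}. of_int (sign \<sigma>) * G (permute_list \<sigma> is)) =
     (\<Sum>\<sigma> | \<sigma> permutes {..<n}. of_int (sign \<sigma>) * G (permute_list \<sigma> (permute_list \<tau> is)))"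
    by (simp add: mult.assoc[symmetric] ss)
  then show ?thesis by (simp add: alternate_def n_def)
qed

lemma skew_alternate: "skew (restrict_order n (alternate G))"
  unfolding skew_def
proof (intro allI)
  fix xs ys :: "'a list" and a b
  let ?k = "length xs" and ?L = "xs @ a # b # ys"
  have \<tau>: "Transposition.transpose ?k (Suc ?k) permutes {..<length ?L}" by (intro permutes_swap_id) auto
  have "permute_list (Transposition.transpose ?k (Suc ?k)) ?L = xs @ b # a # ys"
    by (simp add: permute_list_transpose nth_append list_update_append)
  then have "alternate G (xs @ b # a # ys) = - alternate G ?L"
    using alternate_permute_list[OF \<tau>, of G] by (simp add: sign_swap_id)
  then show "restrict_order n (alternate G) (xs @ a # b # ys) = - restrict_order n (alternate G) (xs @ b # a # ys)"
    by (simp add: restrict_order_def)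
qed

text \<open>Relabelling each summand moves its permutation onto \<open>x\<close>, whose sign cancels
  the explicit one.\<close>

lemma sum_skew_alternate:
  fixes x G :: "'i::finite tensor"
  assumes "skew x"
  shows "(\<Sum>is | length is = n. x is * alternate G is) = (\<Sum>is | length is = n. x is * G is)"
proof -
  have "(\<Sum>is | length is = n. x is * alternate G is) =
    (\<Sum>is | length is = n. \<Sum>\<sigma> | \<sigma> permutes {..<n}. x is * (of_int (sign \<sigma>) * G (permute_list \<sigma> is))) / fact n"
    by (simp add: alternate_def sum_distrib_left sum_divide_distrib)
  also have "(\<Sum>is | length is = n. \<Sum>\<sigma> | \<sigma> permutes {..<n}. x is * (of_int (sign \<sigma>) * G (permute_list \<sigma> is)))
     = (\<Sum>\<sigma> | \<sigma> permutes {..<n}. \<Sum>is | length is = n. x is * (of_int (sign \<sigma>) * G (permute_list \<sigma> is)))"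
    by (rule sum.swap)
  also have "\<dots> = (\<Sum>\<sigma> | \<sigma> permutes {..<n}. \<Sum>is | length is = n. x (permute_list \<sigma> is) * G (permute_list \<sigma> is))"
    using skew_permute_list[OF assms] by (intro sum.cong refl) (auto simp: mult.commute)
  also have "\<dots> = (\<Sum>\<sigma> | \<sigma> permutes {..<n}. \<Sum>is | length is = n. x is * G is)"
    by (intro sum.cong refl sum_permute_list[of _ _ "\<lambda>is. x is * G is"]) simp
  also have "\<dots> = fact n * (\<Sum>is | length is = n. x is * G is)"
    by (simp add: card_permutations)
  finally show ?thesis by simp
qed

lemma alternate_invariant:
  assumes "invariant_tensor C n G" shows "invariant_tensor C n (alternate G)"
  unfolding invariant_tensor_lie_der
proof (intro allI impI)
  fix \<nu> and "is" :: "'a list" assume l: "length is = n"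
  have "lie_der C \<nu> (alternate G) is = lie_der C \<nu> (\<lambda>is. inverse (fact n) * (\<Sum>\<pi> | \<pi> permutes {..<n}. of_int (sign \<pi>) * G (permute_list \<pi> is))) is"
    by (rule lie_der_cong) (simp add: alternate_def l field_simps)
  also have "\<dots> = inverse (fact n) * (\<Sum>\<pi> | \<pi> permutes {..<n}. of_int (sign \<pi>) * lie_der C \<nu> G (permute_list \<pi> is))"
    unfolding lie_der_scale lie_der_sum using l by (simp add: lie_der_permute_list)
  also have "\<dots> = 0" using assms l by (simp add: invariant_tensor_lie_der)
  finally show "lie_der C \<nu> (alternate G) is = 0" .
qed

text \<open>The symbol permutes its second list, so solving for \<open>L\<close> puts the inverse
  permutation on \<open>is\<close>; inversion preserves signs and permutes the summands.\<close>

lemma sum_gen_eps: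
  fixes G :: "'i::finite tensor"
  assumes "length is = n"
  shows "(\<Sum>L | length L = n. gen_eps is L * G L) = fact n * alternate G is"
proof -
  have g: "gen_eps is L = (\<Sum>\<sigma> | \<sigma> permutes {..<n}. of_int (sign \<sigma>) * (if is = permute_list \<sigma> L then 1 else 0))"
    if "length L = n" for L
    unfolding gen_eps_def assms
  proof (intro sum.cong refl arg_cong2[of _ _ _ _ "(*)"])
    fix \<sigma> assume "\<sigma> \<in> {\<sigma>. \<sigma> permutes {..<n}}"
    then have "is = permute_list \<sigma> L \<longleftrightarrow> (\<forall>s<n. is ! s = L ! \<sigma> s)"
      using that assms by (auto simp: list_eq_iff_nth_eq permute_list_nth)
    then show "(\<Prod>s<n. if is ! s = L ! \<sigma> s then 1 else 0) = (if is = permute_list \<sigma> L then 1 else (0::real))"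
      by auto
  qed
  have "(\<Sum>L | length L = n. gen_eps is L * G L) =
     (\<Sum>L | length L = n. \<Sum>\<sigma> | \<sigma> permutes {..<n}. of_int (sign \<sigma>) * (if is = permute_list \<sigma> L then G L else 0))"
    by (intro sum.cong refl) (simp add: g sum_distrib_right mult.assoc if_distrib[of "\<lambda>x. x * _"] cong: if_cong)
  also have "\<dots> = (\<Sum>\<sigma> | \<sigma> permutes {..<n}. \<Sum>L | length L = n. of_int (sign \<sigma>) * (if is = permute_list \<sigma> L then G L else 0))"
    by (rule sum.swap)
  also have "\<dots> = (\<Sum>\<sigma> | \<sigma> permutes {..<n}. of_int (sign (inv \<sigma>)) * G (permute_list (inv \<sigma>) is))"
  proof (intro sum.cong refl)
    fix \<sigma> assume "\<sigma> \<in> {\<sigma>. \<sigma> permutes {..<n}}"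
    then have \<sigma>: "\<sigma> permutes {..<n}" by simp
    have "is = permute_list \<sigma> L \<longleftrightarrow> L = permute_list (inv \<sigma>) is" if "length L = n" for L
      using permute_list_inv[of \<sigma>] \<sigma> that assms by metis
    then have "(\<Sum>L | length L = n. of_int (sign \<sigma>) * (if is = permute_list \<sigma> L then G L else 0))
      = (\<Sum>L | length L = n. if L = permute_list (inv \<sigma>) is then of_int (sign \<sigma>) * G L else 0)"
      by (intro sum.cong refl) auto
    also have "\<dots> = of_int (sign \<sigma>) * G (permute_list (inv \<sigma>) is)"
      using assms by (simp add: sum.delta)
    finally show "(\<Sum>L | length L = n. of_int (sign \<sigma>) * (if is = permute_list \<sigma> L then G L else 0)) =
       of_int (sign (inv \<sigma>)) * G (permute_list (inv \<sigma>) is)"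
      using sign_inverse[OF permutes_imp_permutation[OF finite_lessThan \<sigma>]] by simp
  qed
  also have "\<dots> = (\<Sum>\<sigma> | \<sigma> permutes {..<n}. of_int (sign \<sigma>) * G (permute_list \<sigma> is))"
    by (rule sum_permutations_inverse[symmetric])
  finally show ?thesis by (simp add: alternate_def assms)
qed

section \<open>Decomposable tensors\<close>

lemma tensor_prod_invariant:
  assumes "\<And>k f. (k, f) \<in> set fs \<Longrightarrow> invariant_tensor C k f"
  shows "invariant_tensor C (sum_list (map fst fs)) (tensor_prod fs)"
  using assms
proof (induction fs)
  case (Cons kf fs)
  obtain k f where kf: "kf = (k, f)" by (cases kf)
  have f: "invariant_tensor C k f" using Cons.prems kf by simp
  have IH: "invariant_tensor C (sum_list (map fst fs)) (tensor_prod fs)"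
    using Cons by simp
  show ?case
    unfolding invariant_tensor_lie_der
  proof (intro allI impI)
    fix \<nu> and "is" :: "'a list" assume l: "length is = sum_list (map fst (kf # fs))"
    define xs ys where "xs = take k is" and "ys = drop k is"
    have xy: "is = xs @ ys" "length xs = k" "length ys = sum_list (map fst fs)"
      using l kf by (auto simp: xs_def ys_def)
    have "lie_der C \<nu> (\<lambda>xs. tensor_prod (kf # fs) (xs @ ys)) xs = lie_der C \<nu> (\<lambda>xs. tensor_prod fs ys * f xs) xs"
      using xy by (intro lie_der_cong) (simp add: kf)
    then have 1: "lie_der C \<nu> (\<lambda>xs. tensor_prod (kf # fs) (xs @ ys)) xs = 0"
      using f xy by (simp add: lie_der_scale invariant_tensor_lie_der)
    have "lie_der C \<nu> (\<lambda>ys. tensor_prod (kf # fs) (xs @ ys)) ys = lie_der C \<nu> (\<lambda>ys. f xs * tensor_prod fs ys) ys"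
      using xy by (intro lie_der_cong) (simp add: kf)
    then have 2: "lie_der C \<nu> (\<lambda>ys. tensor_prod (kf # fs) (xs @ ys)) ys = 0"
      using IH xy by (simp add: lie_der_scale invariant_tensor_lie_der)
    show "lie_der C \<nu> (tensor_prod (kf # fs)) is = 0"
      unfolding xy(1) lie_der_append 1 2 by simp
  qed
qed (simp add: invariant_tensor_lie_der)

lemma lower_order_factors_invariant:
  "lower_order_factors C m fs \<Longrightarrow> invariant_tensor C m (tensor_prod fs)"
  unfolding lower_order_factors_def using tensor_prod_invariant[of fs C] by auto

lemma decomposable_invariant:
  assumes "decomposable_tensor C m f" shows "invariant_tensor C m f"
proof -
  obtain N c F where F: "\<forall>a<N. lower_order_factors C m (F a)"
    and f: "\<And>is. length is = m \<Longrightarrow> f is = (\<Sum>a<(N::nat). c a * symmetrize (tensor_prod (F a)) is)"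
    using assms unfolding decomposable_tensor_def by blast
  have "invariant_tensor C m (\<lambda>is. \<Sum>a<N. c a * symmetrize (tensor_prod (F a)) is)"
    unfolding invariant_tensor_lie_der lie_der_sum lie_der_scale
  proof (intro allI impI sum.neutral ballI)
    fix \<nu> and "is" :: "'a list" and a assume "length is = m" "a \<in> {..<N}"
    then show "c a * lie_der C \<nu> (symmetrize (tensor_prod (F a))) is = 0"
      using symmetrize_invariant[OF lower_order_factors_invariant, of C m "F a"] F
      by (simp add: invariant_tensor_lie_der)
  qed
  moreover have "invariant_tensor C m f \<longleftrightarrow> invariant_tensor C m (\<lambda>is. \<Sum>a<N. c a * symmetrize (tensor_prod (F a)) is)"
    by (rule invariant_tensor_cong) (rule f)
  ultimately show ?thesis by simp
qed

lemma decomposable_symmetric: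
  assumes "decomposable_tensor C m f" shows "symmetric_tensor m f"
proof -
  obtain N c F where f: "\<And>is. length is = m \<Longrightarrow> f is = (\<Sum>a<(N::nat). c a * symmetrize (tensor_prod (F a)) is)"
    using assms unfolding decomposable_tensor_def by blast
  have "symmetric_tensor m (\<lambda>is. \<Sum>a<N. c a * symmetrize (tensor_prod (F a)) is)"
    unfolding symmetric_tensor_def
    by (auto simp: symmetrize_symmetric[unfolded symmetric_tensor_def, rule_format])
  moreover have "symmetric_tensor m f \<longleftrightarrow> symmetric_tensor m (\<lambda>is. \<Sum>a<N. c a * symmetrize (tensor_prod (F a)) is)"
    by (rule symmetric_tensor_cong) (rule f)
  ultimately show ?thesis by simp
qed

lemma decomposable_lincomb:
  assumes "decomposable_tensor C m f" "decomposable_tensor C m g"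
  shows "decomposable_tensor C m (\<lambda>is. f is + k * g is)"
proof -
  obtain N1 c1 F1 where F1: "\<forall>a<N1. lower_order_factors C m (F1 a)"
    and f: "\<forall>is. length is = m \<longrightarrow> f is = (\<Sum>a<(N1::nat). c1 a * symmetrize (tensor_prod (F1 a)) is)"
    using assms(1) unfolding decomposable_tensor_def by blast
  obtain N2 c2 F2 where F2: "\<forall>a<N2. lower_order_factors C m (F2 a)"
    and g: "\<forall>is. length is = m \<longrightarrow> g is = (\<Sum>a<(N2::nat). c2 a * symmetrize (tensor_prod (F2 a)) is)"
    using assms(2) unfolding decomposable_tensor_def by blast
  define c where "c a = (if a < N1 then c1 a else k * c2 (a - N1))" for a
  define F where "F a = (if a < N1 then F1 a else F2 (a - N1))" for a
  have "\<forall>a<N1 + N2. lower_order_factors C m (F a)" using F1 F2 by (auto simp: F_def)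
  moreover have "\<forall>is. length is = m \<longrightarrow> f is + k * g is = (\<Sum>a<N1 + N2. c a * symmetrize (tensor_prod (F a)) is)"
    using f g by (simp add: sum_lessThan_add c_def F_def sum_distrib_left mult.assoc)
  ultimately show ?thesis unfolding decomposable_tensor_def by blast
qed

lemma decomposable_zero: "decomposable_tensor C m (\<lambda>_. 0)"
  unfolding decomposable_tensor_def by (rule exI[of _ 0]) simp

lemma decomposable_cong:
  "(\<And>is. length is = m \<Longrightarrow> f is = g is) \<Longrightarrow> decomposable_tensor C m f \<Longrightarrow> decomposable_tensor C m g"
  unfolding decomposable_tensor_def by metis

text \<open>One factor of positive order already contracts \<open>t\<close> to zero. Factors of
  order 0 are scalars and are split off; as \<open>m\<close> is positive, a positive factor must
  follow. Symmetrisation is absorbed by the symmetry of \<open>t\<close>.\<close>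

lemma sum_decomposable_eq_0:
  fixes t :: "'i::finite tensor"
  assumes t: "symmetric_tensor m t" and m: "0 < m"
    and cf: "\<And>k p us. 0 < k \<Longrightarrow> k < m \<Longrightarrow> length us = m - k \<Longrightarrow> symmetric_tensor k p \<Longrightarrow> invariant_tensor C k p \<Longrightarrow>
      (\<Sum>ks | length ks = k. p ks * t (ks @ us)) = 0"
    and f: "decomposable_tensor C m f"
  shows "(\<Sum>is | length is = m. t is * f is) = 0"
proof -
  have TP: "(\<Sum>is | length is = m. t is * tensor_prod fs is) = 0"
    if "sum_list (map fst fs) = m" "\<forall>(k, f) \<in> set fs. k < m \<and> symmetric_tensor k f \<and> invariant_tensor C k f" for fs
    using that
  proof (induction fs)
    case (Cons kf fs)
    obtain k f where kf: "kf = (k, f)" by (cases kf)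
    show ?case
    proof (cases "k = 0")
      case True
      then have "(\<Sum>is | length is = m. t is * tensor_prod (kf # fs) is) = f [] * (\<Sum>is | length is = m. t is * tensor_prod fs is)"
        by (simp add: kf sum_distrib_left algebra_simps)
      then show ?thesis using Cons True kf by simp
    next
      case False
      define r where "r = sum_list (map fst fs)"
      have mk: "m = k + r" using Cons.prems(1) kf by (simp add: r_def)
      have k: "k < m" "symmetric_tensor k f" "invariant_tensor C k f" using Cons.prems(2) kf by auto
      have "(\<Sum>is | length is = m. t is * tensor_prod (kf # fs) is)
         = (\<Sum>ks | length ks = k. \<Sum>us | length us = r. tensor_prod fs us * (f ks * t (ks @ us)))"
        unfolding mk sum_len_add by (simp add: kf algebra_simps)
      also have "\<dots> = (\<Sum>us | length us = r. \<Sum>ks | length ks = k. tensor_prod fs us * (f ks * t (ks @ us)))"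
        by (rule sum.swap)
      also have "\<dots> = 0"
        unfolding sum_distrib_left[symmetric] using False k mk by (intro sum.neutral ballI) (simp add: cf)
      finally show ?thesis .
    qed
  qed (use m in simp)
  obtain N c F where F: "\<forall>a<N. lower_order_factors C m (F a)"
    and f: "\<And>is. length is = m \<Longrightarrow> f is = (\<Sum>a<(N::nat). c a * symmetrize (tensor_prod (F a)) is)"
    using f unfolding decomposable_tensor_def by blast
  have "(\<Sum>is | length is = m. t is * f is) = (\<Sum>is | length is = m. \<Sum>a<N. c a * (t is * symmetrize (tensor_prod (F a)) is))"
    by (intro sum.cong refl) (simp add: f sum_distrib_left algebra_simps)
  also have "\<dots> = (\<Sum>a<N. c a * (\<Sum>is | length is = m. t is * symmetrize (tensor_prod (F a)) is))"
    unfolding sum_distrib_left by (rule sum.swap)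
  also have "\<dots> = 0"
    unfolding sum_symmetrize[OF t] using F TP by (intro sum.neutral) (simp add: lower_order_factors_def)
  finally show ?thesis .
qed

section \<open>The harmonic part of a primitive tensor; the cocycle as an alternation\<close>

context antisym_lie_constants
begin

text \<open>Subtract from \<open>h\<close> its projection onto the decomposables. The part removed
  is orthogonal to \<open>h'\<close>, so the pairing of \<open>h\<close> with \<open>h'\<close> is
  the square norm of \<open>h'\<close>, positive as \<open>h\<close> is not decomposable.\<close>

lemma harmonic_part_exists:
  assumes h: "symmetric_tensor m h" "invariant_tensor C m h" "\<not> decomposable_tensor C m h"
  obtains h' where "perm_inv h'" "invariant_tensor C m h'" "\<And>us. length us \<noteq> m \<Longrightarrow> h' us = 0"
    "\<And>k p us. 0 < k \<Longrightarrow> k < m \<Longrightarrow> symmetric_tensor k p \<Longrightarrow> invariant_tensor C k p \<Longrightarrow>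
      (\<Sum>ks | length ks = k. p ks * h' (us @ ks)) = 0"
    "(\<Sum>us | length us = m. h us * h' us) \<noteq> 0"
proof -
  define V where "V = {f. (\<forall>is. length is \<noteq> m \<longrightarrow> f is = 0) \<and> decomposable_tensor C m f}"
  have "\<exists>d\<in>V. \<forall>e\<in>V. (\<Sum>a | length a = m. (restrict_order m h a - d a) * e a) = 0"
  proof (rule projection_exists)
    show "(\<lambda>a. f a + c * g a) \<in> V" if "f \<in> V" "g \<in> V" for f g c
      using that decomposable_lincomb[of C m f g c] by (simp add: V_def)
  qed (auto simp: V_def decomposable_zero)
  then obtain d where d: "d \<in> V" "\<And>e. e \<in> V \<Longrightarrow> (\<Sum>a | length a = m. (restrict_order m h a - d a) * e a) = 0" by blast
  define h' where "h' = (\<lambda>is. restrict_order m h is - d is)"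
  have dec: "decomposable_tensor C m d" and d0: "\<And>is. length is \<noteq> m \<Longrightarrow> d is = 0" using d(1) by (auto simp: V_def)
  have supp: "h' us = 0" if "length us \<noteq> m" for us using that d0 by (simp add: h'_def restrict_order_def)
  have sym: "symmetric_tensor m h'"
    using h(1) decomposable_symmetric[OF dec] by (simp add: h'_def restrict_order_def symmetric_tensor_def)
  have ms: "perm_inv h'"
  proof -
    have "restrict_order m h' = h'" by (rule ext) (simp add: restrict_order_def supp)
    then show ?thesis using perm_inv_restrict_order[OF sym] by simp
  qed
  have "invariant_tensor C m (\<lambda>is. h is - d is)"
    using h(2) decomposable_invariant[OF dec] by (simp add: invariant_tensor_lie_der lie_der_diff)
  then have inv: "invariant_tensor C m h'"
    using invariant_tensor_cong[of m h' "\<lambda>is. h is - d is"] by (simp add: h'_def restrict_order_def)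
  have ne: "(\<Sum>us | length us = m. h' us * h' us) \<noteq> 0"
  proof
    assume "(\<Sum>us | length us = m. h' us * h' us) = 0"
    then have "\<forall>us\<in>{us. length us = m}. h' us * h' us = 0" by (subst (asm) sum_nonneg_eq_0_iff) auto
    then have "d us = h us" if "length us = m" for us using that by (simp add: h'_def restrict_order_def)
    then show False using decomposable_cong dec h(3) by blast
  qed
  have eq: "(\<Sum>us | length us = m. h us * h' us) = (\<Sum>us | length us = m. h' us * h' us)"
  proof -
    have "(\<Sum>us | length us = m. h' us * d us) = 0" using d(2)[OF d(1)] by (simp add: h'_def)
    moreover have "(\<Sum>us | length us = m. h us * h' us) = (\<Sum>us | length us = m. h' us * h' us + h' us * d us)"
      by (intro sum.cong refl) (simp add: h'_def restrict_order_def algebra_simps)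
    ultimately show ?thesis by (simp add: sum.distrib)
  qed
  have contr: "(\<Sum>ks | length ks = k. p ks * h' (us @ ks)) = 0"
    if k: "0 < k" "k < m" and p: "symmetric_tensor k p" "invariant_tensor C k p" for k p us
  proof -
    \<comment> \<open>The contraction inherits symmetry and, by integration by parts, invariance
      from \<open>h'\<close> and \<open>p\<close>. Its product with \<open>p\<close> is therefore
      decomposable, and pairing that product with \<open>h'\<close> gives the square norm of
      \<open>r\<close>.\<close>
    define r where "r us = (\<Sum>ks | length ks = k. p ks * h' (us @ ks))" for us
    have rs: "symmetric_tensor (m - k) r"
      unfolding symmetric_tensor_iff_mset r_def
      by (auto intro!: sum.cong arg_cong2[of _ _ _ _ "(*)"] msymD[OF ms])
    have ri: "invariant_tensor C (m - k) r"
      unfolding invariant_tensor_lie_der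
    proof (intro allI impI)
      fix \<nu> and us :: "'i list" assume us: "length us = m - k"
      have "D \<nu> (\<lambda>us. h' (us @ ks)) us = - D \<nu> (\<lambda>ks. h' (us @ ks)) ks" if "length ks = k" for ks
      proof -
        have "D \<nu> h' (us @ ks) = 0" using inv us that k by (simp add: invariant_tensor_lie_der)
        then show ?thesis by (simp add: lie_der_append)
      qed
      then have "D \<nu> r us = - (\<Sum>ks | length ks = k. p ks * D \<nu> (\<lambda>ks. h' (us @ ks)) ks)"
        unfolding r_def by (simp add: lie_der_sum lie_der_scale sum_negf)
      also have "\<dots> = (\<Sum>ks | length ks = k. D \<nu> p ks * h' (us @ ks))"
        by (simp add: sum_lie_der_adjoint)
      also have "\<dots> = 0" using p(2) by (simp add: invariant_tensor_lie_der)
      finally show "D \<nu> r us = 0" .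
    qed
    define F where "F = [(m - k, r), (k, p)]"
    have lof: "lower_order_factors C m F"
      using k p rs ri by (simp add: lower_order_factors_def F_def)
    have "decomposable_tensor C m (restrict_order m (symmetrize (tensor_prod F)))"
      unfolding decomposable_tensor_def
      by (rule exI[of _ 1], rule exI[of _ "\<lambda>_. 1"], rule exI[of _ "\<lambda>_. F"]) (simp add: lof restrict_order_def)
    then have "restrict_order m (symmetrize (tensor_prod F)) \<in> V" by (simp add: V_def restrict_order_def)
    from d(2)[OF this] have "0 = (\<Sum>is | length is = m. h' is * symmetrize (tensor_prod F) is)"
      by (simp add: h'_def restrict_order_def)
    also have "\<dots> = (\<Sum>is | length is = (m - k) + k. h' is * tensor_prod F is)"
      using sum_symmetrize[OF sym] k by simp
    also have "\<dots> = (\<Sum>us | length us = m - k. r us * r us)"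
      unfolding sum_len_add by (simp add: F_def r_def sum_distrib_left algebra_simps)
    finally have "\<forall>us\<in>{us. length us = m - k}. r us * r us = 0"
      by (subst (asm) eq_commute, subst (asm) sum_nonneg_eq_0_iff) auto
    then have "r us = 0" if "length us = m - k" using that by simp
    moreover have "r us = 0" if "length us \<noteq> m - k" using that k by (auto simp: r_def supp)
    ultimately show ?thesis unfolding r_def by blast
  qed
  show thesis by (rule that[OF ms inv supp contr]) (use ne eq in auto)
qed

lemma C_chain_Suc: "C_chain C (Suc n) (a # b # js) (l # ls) = C a b l * C_chain C n js ls"
  unfolding C_chain_def by (simp add: prod.lessThan_Suc_shift del: prod.lessThan_Suc)

lemma C_chain_append: "2 * n \<le> length js \<Longrightarrow> n \<le> length ls \<Longrightarrow> C_chain C n (js @ xs) (ls @ ys) = C_chain C n js ls"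
  unfolding C_chain_def by (intro prod.cong refl) (auto simp: nth_append)

text \<open>The bridge from the explicit products of structure constants to the operators
  \<open>Qs\<close>.\<close>

lemma sum_C_chain:
  "length ls = n \<Longrightarrow> (\<Sum>js | length js = 2 * n. C_chain C n js ls * g (js @ zs)) = Qs ls g zs"
proof (induction ls arbitrary: n g)
  case Nil
  then show ?case by (simp add: C_chain_def)
next
  case (Cons l ls)
  then obtain n' where n: "n = Suc n'" "length ls = n'" by auto
  have "(\<Sum>js | length js = 2 * n. C_chain C n js (l # ls) * g (js @ zs)) =
    (\<Sum>a\<in>UNIV. \<Sum>b\<in>UNIV. \<Sum>js | length js = 2 * n'. C_chain C n' js ls * (C a b l * g (a # b # js @ zs)))"
    by (simp add: n(1) sum_len_Suc C_chain_Suc algebra_simps)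
  also have "\<dots> = (\<Sum>js | length js = 2 * n'. \<Sum>a\<in>UNIV. \<Sum>b\<in>UNIV. C_chain C n' js ls * (C a b l * g (a # b # js @ zs)))"
    by (rule sum3_move[symmetric])
  also have "\<dots> = (\<Sum>js | length js = 2 * n'. C_chain C n' js ls * Q l g (js @ zs))"
    by (simp add: Q_def sum_distrib_left)
  also have "\<dots> = Qs ls (Q l g) zs" using Cons.IH[OF n(2)] by simp
  finally show ?case by simp
qed

lemma C_chain_invariant:
  "length js = 2 * n \<Longrightarrow> length ls = n \<Longrightarrow>
     D \<nu> (\<lambda>js. C_chain C n js ls) js + D \<nu> (\<lambda>ls. C_chain C n js ls) ls = 0"
proof (induction n arbitrary: js ls)
  case (Suc n)
  obtain a b js' where js: "js = a # b # js'" "length js' = 2 * n"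
    using Suc.prems(1) by (auto simp: length_Suc_conv)
  obtain l ls' where ls: "ls = l # ls'" "length ls' = n"
    using Suc.prems(2) by (auto simp: length_Suc_conv)
  have 1: "(\<Sum>\<rho>\<in>UNIV. C \<nu> a \<rho> * C \<rho> b l) + (\<Sum>\<rho>\<in>UNIV. C \<nu> b \<rho> * C a \<rho> l) + (\<Sum>\<rho>\<in>UNIV. C \<nu> l \<rho> * C a b \<rho>) = 0"
  proof -
    have "(\<Sum>\<rho>\<in>UNIV. C \<nu> a \<rho> * C \<rho> b l) = - (\<Sum>\<rho>\<in>UNIV. C \<rho> b l * C \<nu> \<rho> a)"
      "(\<Sum>\<rho>\<in>UNIV. C \<nu> b \<rho> * C a \<rho> l) = - (\<Sum>\<rho>\<in>UNIV. C a \<rho> l * C \<nu> \<rho> b)"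
      unfolding sum_negf[symmetric]
      by (auto intro!: sum.cong simp: C_swap23[of \<nu> a] C_swap23[of \<nu> b])
    then show ?thesis using jacobi_Q[of b l \<nu> a] by simp
  qed
  have "D \<nu> (\<lambda>js. C_chain C (Suc n) js ls) js =
     ((\<Sum>\<rho>\<in>UNIV. C \<nu> a \<rho> * C \<rho> b l) + (\<Sum>\<rho>\<in>UNIV. C \<nu> b \<rho> * C a \<rho> l)) * C_chain C n js' ls'
     + C a b l * D \<nu> (\<lambda>js. C_chain C n js ls') js'"
    by (simp add: js ls C_chain_Suc lie_der_scale sum_distrib_right distrib_right mult.assoc)
  moreover have "D \<nu> (\<lambda>ls. C_chain C (Suc n) js ls) ls =
     (\<Sum>\<rho>\<in>UNIV. C \<nu> l \<rho> * C a b \<rho>) * C_chain C n js' ls' + C a b l * D \<nu> (\<lambda>ls. C_chain C n js' ls) ls'"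
    by (simp add: js ls C_chain_Suc lie_der_scale sum_distrib_right distrib_right mult.assoc)
  ultimately have "D \<nu> (\<lambda>js. C_chain C (Suc n) js ls) js + D \<nu> (\<lambda>ls. C_chain C (Suc n) js ls) ls =
    ((\<Sum>\<rho>\<in>UNIV. C \<nu> a \<rho> * C \<rho> b l) + (\<Sum>\<rho>\<in>UNIV. C \<nu> b \<rho> * C a \<rho> l) + (\<Sum>\<rho>\<in>UNIV. C \<nu> l \<rho> * C a b \<rho>)) * C_chain C n js' ls'
     + C a b l * (D \<nu> (\<lambda>js. C_chain C n js ls') js' + D \<nu> (\<lambda>ls. C_chain C n js' ls) ls')"
    by (simp add: algebra_simps)
  then show ?case unfolding 1 Suc.IH[OF js(2) ls(2)] by simp
qed (simp add: C_chain_def)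

text \<open>The tensor under the antisymmetrisation in the cocycle. Position 2m-2, counted from 0,
  holds the last index.\<close>

definition cochain :: "nat \<Rightarrow> 'i tensor \<Rightarrow> 'i tensor" where
  "cochain m h L = (\<Sum>ls | length ls = m - 1. C_chain C (m - 1) L ls * h (ls @ [L ! (2 * m - 2)]))"

lemma cochain_snoc:
  assumes "length js = 2 * m - 2"
  shows "cochain m h (js @ [\<rho>]) = (\<Sum>ls | length ls = m - 1. C_chain C (m - 1) js ls * h (ls @ [\<rho>]))"
proof -
  have "(js @ [\<rho>]) ! (2 * m - 2) = \<rho>" using assms nth_append_length[of js \<rho> "[]"] by simp
  moreover have "C_chain C (m - 1) (js @ [\<rho>]) ls = C_chain C (m - 1) js ls" if "length ls = m - 1" for ls
    using C_chain_append[of "m - 1" js ls "[\<rho>]" "[]"] assms that by simp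
  ultimately show ?thesis unfolding cochain_def by (intro sum.cong refl) auto
qed

lemma cocycle_of_alternate:
  assumes "0 < m" "length is = 2 * m - 1"
  shows "cocycle_of C m h is = alternate (cochain m h) is"
proof -
  have n: "2 * m - 1 = Suc (2 * m - 2)" using assms(1) by simp
  have "(\<Sum>js | length js = 2 * m - 2. \<Sum>\<rho>\<in>UNIV. \<Sum>ls | length ls = m - 1.
        gen_eps is (js @ [\<rho>]) * C_chain C (m - 1) js ls * h (ls @ [\<rho>]))
     = (\<Sum>L | length L = Suc (2 * m - 2). gen_eps is L * cochain m h L)"
    unfolding sum_len_snoc by (intro sum.cong refl) (simp add: cochain_snoc sum_distrib_left mult.assoc)
  also have "\<dots> = fact (2 * m - 1) * alternate (cochain m h) is"
    unfolding n[symmetric] by (rule sum_gen_eps) (rule assms(2))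
  finally show ?thesis unfolding cocycle_of_def by simp
qed

text \<open>The chain trades the action on \<open>js\<close> for the opposite action on its labels;
  integration by parts passes it to \<open>h\<close>. Together with the slot \<rho> this is the full
  invariance of \<open>h\<close>.\<close>

lemma cochain_invariant:
  assumes m: "0 < m" and h: "invariant_tensor C m h"
  shows "invariant_tensor C (2 * m - 1) (cochain m h)"
  unfolding invariant_tensor_lie_der
proof (intro allI impI)
  fix \<nu> and L :: "'i list" assume "length L = 2 * m - 1"
  then obtain js \<rho> where L: "L = js @ [\<rho>]" "length js = 2 * m - 2"
    using m by (cases L rule: rev_cases) auto
  have 2: "2 * m - 2 = 2 * (m - 1)" by simp
  have "D \<nu> (\<lambda>js. cochain m h (js @ [\<rho>])) js = D \<nu> (\<lambda>js. \<Sum>ls | length ls = m - 1. C_chain C (m - 1) js ls * h (ls @ [\<rho>])) js"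
    using L(2) by (intro lie_der_cong) (simp add: cochain_snoc)
  also have "\<dots> = (\<Sum>ls | length ls = m - 1. h (ls @ [\<rho>]) * D \<nu> (\<lambda>js. C_chain C (m - 1) js ls) js)"
    by (simp add: lie_der_sum lie_der_scale mult.commute[of _ "h _"])
  also have "\<dots> = (\<Sum>ls | length ls = m - 1. h (ls @ [\<rho>]) * - D \<nu> (\<lambda>ls. C_chain C (m - 1) js ls) ls)"
    using C_chain_invariant[of js "m - 1" _ \<nu>] L(2)
    by (intro sum.cong refl arg_cong2[of _ _ _ _ "(*)"]) (simp add: eq_neg_iff_add_eq_0)
  also have "\<dots> = - (\<Sum>ls | length ls = m - 1. h (ls @ [\<rho>]) * D \<nu> (\<lambda>ls. C_chain C (m - 1) js ls) ls)"
    by (simp add: sum_negf)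
  also have "\<dots> = (\<Sum>ls | length ls = m - 1. D \<nu> (\<lambda>ls. h (ls @ [\<rho>])) ls * C_chain C (m - 1) js ls)"
    unfolding sum_lie_der_adjoint by simp
  finally have 1: "D \<nu> (\<lambda>js. cochain m h (js @ [\<rho>])) js = (\<Sum>ls | length ls = m - 1. D \<nu> (\<lambda>ls. h (ls @ [\<rho>])) ls * C_chain C (m - 1) js ls)" .
  have "D \<nu> (\<lambda>rs. cochain m h (js @ rs)) [\<rho>] = (\<Sum>\<sigma>\<in>UNIV. \<Sum>ls | length ls = m - 1. C \<nu> \<rho> \<sigma> * h (ls @ [\<sigma>]) * C_chain C (m - 1) js ls)"
    by (simp add: cochain_snoc[OF L(2)] sum_distrib_left algebra_simps)
  also have "\<dots> = (\<Sum>ls | length ls = m - 1. (\<Sum>\<sigma>\<in>UNIV. C \<nu> \<rho> \<sigma> * h (ls @ [\<sigma>])) * C_chain C (m - 1) js ls)"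
    unfolding sum_distrib_right by (rule sum.swap)
  finally have "D \<nu> (cochain m h) L = (\<Sum>ls | length ls = m - 1.
     (D \<nu> (\<lambda>ls. h (ls @ [\<rho>])) ls + (\<Sum>\<sigma>\<in>UNIV. C \<nu> \<rho> \<sigma> * h (ls @ [\<sigma>]))) * C_chain C (m - 1) js ls)"
    unfolding L(1) lie_der_append 1 by (simp add: sum.distrib distrib_right)
  also have "\<dots> = 0"
  proof (rule sum.neutral, intro ballI)
    fix ls :: "'i list" assume "ls \<in> {ls. length ls = m - 1}"
    then have "D \<nu> h (ls @ [\<rho>]) = 0" using h m by (simp add: invariant_tensor_lie_der)
    then show "(D \<nu> (\<lambda>ls. h (ls @ [\<rho>])) ls + (\<Sum>\<sigma>\<in>UNIV. C \<nu> \<rho> \<sigma> * h (ls @ [\<sigma>]))) * C_chain C (m - 1) js ls = 0"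
      by (simp add: lie_der_append)
  qed
  finally show "D \<nu> (cochain m h) L = 0" .
qed

text \<open>The right side is the functional \<open>Ssum\<close> at n = m-1, so pairing with the
  cocycle is the last stage of the zigzag.\<close>

lemma sum_cochain:
  assumes m: "0 < m"
  shows "(\<Sum>L | length L = 2 * m - 1. g L * cochain m h L) =
    (\<Sum>ls | length ls = m - 1. \<Sum>\<rho>\<in>UNIV. h (ls @ [\<rho>]) * Qs ls g [\<rho>])"
proof -
  have n: "2 * m - 1 = Suc (2 * m - 2)" and 2: "2 * m - 2 = 2 * (m - 1)" using m by auto
  have "(\<Sum>L | length L = 2 * m - 1. g L * cochain m h L) =
    (\<Sum>js | length js = 2 * m - 2. \<Sum>\<rho>\<in>UNIV. \<Sum>ls | length ls = m - 1. h (ls @ [\<rho>]) * (C_chain C (m - 1) js ls * g (js @ [\<rho>])))"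
    unfolding n sum_len_snoc by (intro sum.cong refl) (simp add: cochain_snoc sum_distrib_left algebra_simps)
  also have "\<dots> = (\<Sum>\<rho>\<in>UNIV. \<Sum>ls | length ls = m - 1. \<Sum>js | length js = 2 * m - 2. h (ls @ [\<rho>]) * (C_chain C (m - 1) js ls * g (js @ [\<rho>])))"
    by (rule sum3_move)
  also have "\<dots> = (\<Sum>\<rho>\<in>UNIV. \<Sum>ls | length ls = m - 1. h (ls @ [\<rho>]) * Qs ls g [\<rho>])"
    unfolding 2 sum_distrib_left[symmetric] by (intro sum.cong refl) (simp add: sum_C_chain)
  also have "\<dots> = (\<Sum>ls | length ls = m - 1. \<Sum>\<rho>\<in>UNIV. h (ls @ [\<rho>]) * Qs ls g [\<rho>])"
    by (rule sum.swap)
  finally show ?thesis .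
qed

end

context antisym_lie_constants
begin

section \<open>The tensor t\<close>

theorem t_tensor_properties:
  assumes "primitive_cocycle C m \<Omega>" and t: "t = t_tensor C m \<Omega>"
  shows "invariant_tensor C m t \<and> symmetric_tensor m t \<and> primitive_tensor C m t \<and>
    (m > 2 \<longrightarrow> traceless_tensor m t)"
proof -
  obtain h where h: "symmetric_tensor m h" "invariant_tensor C m h" "\<not> decomposable_tensor C m h"
    and \<Omega>: "\<And>is. length is = 2 * m - 1 \<Longrightarrow> \<Omega> is = cocycle_of C m h is"
    using assms(1) unfolding primitive_cocycle_def primitive_tensor_def by blast
  have m: "0 < m"
  proof (rule ccontr)
    assume "\<not> 0 < m"
    then have "decomposable_tensor C m h"
      unfolding decomposable_tensor_def
      by (intro exI[of _ 1] exI[of _ "\<lambda>_. h []"] exI[of _ "\<lambda>_. []"])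
        (simp add: lower_order_factors_def symmetrize_def)
    with h(3) show False ..
  qed
  \<comment> \<open>\<Omega> is prescribed only on lists of length 2m-1; \<open>W\<close> extends it
    by zero and is skew and invariant at every length.\<close>
  define W where "W = restrict_order (2 * m - 1) (alternate (cochain m h))"
  have W: "skew W" unfolding W_def by (rule skew_alternate)
  have W\<Omega>: "\<Omega> is = W is" if "length is = 2 * m - 1" for "is"
    using \<Omega>[OF that] cocycle_of_alternate[OF m that] that by (simp add: W_def restrict_order_def)
  have "invariant_tensor C (2 * m - 1) W"
    using alternate_invariant[OF cochain_invariant[OF m h(2)]]
    by (subst invariant_tensor_cong[of _ W "alternate (cochain m h)"]) (simp_all add: W_def restrict_order_def)
  then have DW: "D \<nu> W = (\<lambda>_. 0)" for \<nu>
  proof (intro ext)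
    fix "is" :: "'i list"
    show "D \<nu> W is = 0"
      using \<open>invariant_tensor C (2 * m - 1) W\<close> lie_der_length[of "2 * m - 1" W "is" \<nu>]
      by (cases "length is = 2 * m - 1") (auto simp: invariant_tensor_lie_der W_def restrict_order_def)
  qed
  have QsW: "D \<nu> (Qs ls W) js + D \<nu> (\<lambda>ls. Qs ls W js) ls = 0" for \<nu> ls js
    using Qs_lie_der[of ls \<nu> W js] by (simp add: DW Qs_zero)
  have tQ: "t (ls @ [\<rho>]) = Qs ls W [\<rho>]" if "length ls = m - 1" for ls \<rho>
  proof -
    have 2: "2 * m - 2 = 2 * (m - 1)" by simp
    have "t (ls @ [\<rho>]) = (\<Sum>js | length js = 2 * m - 2. C_chain C (m - 1) js ls * W (js @ [\<rho>]))"
      unfolding t t_tensor_def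
    proof (intro sum.cong refl)
      fix js :: "'i list" assume "js \<in> {js. length js = 2 * m - 2}"
      then have "C_chain C (m - 1) js (ls @ [\<rho>]) = C_chain C (m - 1) js ls" "\<Omega> (js @ [\<rho>]) = W (js @ [\<rho>])"
        using that m C_chain_append[of "m - 1" js ls "[]" "[\<rho>]"] by (auto intro!: W\<Omega>)
      then show "\<Omega> (js @ [(ls @ [\<rho>]) ! (m - 1)]) * C_chain C (m - 1) js (ls @ [\<rho>]) = C_chain C (m - 1) js ls * W (js @ [\<rho>])"
        using that nth_append_length[of ls \<rho> "[]"] by simp
    qed
    then show ?thesis unfolding 2 sum_C_chain[OF that] .
  qed
  have snoc: "\<exists>ls \<rho>. is = ls @ [\<rho>] \<and> length ls = m - 1" if "length is = m" for "is" :: "'i list"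
    using that m by (cases "is" rule: rev_cases) auto
  have inv: "invariant_tensor C m t"
    unfolding invariant_tensor_lie_der
  proof (intro allI impI)
    fix \<nu> and "is" :: "'i list" assume "length is = m"
    then obtain ls \<rho> where L: "is = ls @ [\<rho>]" "length ls = m - 1" using snoc by blast
    have "D \<nu> (\<lambda>ls. t (ls @ [\<rho>])) ls = D \<nu> (\<lambda>ls. Qs ls W [\<rho>]) ls"
      by (rule lie_der_cong) (simp add: tQ L(2))
    then show "D \<nu> t is = 0"
      unfolding L(1) lie_der_append using QsW[of \<nu> ls "[\<rho>]"] by (simp add: tQ L(2))
  qed
  \<comment> \<open>Joint invariance and \<open>sum_lie_der_Qs_Cons\<close> make the sum over c of
    D_c G at [c, a, b] vanish. The slot c contributes 0 because C_{cc} = 0; the slots a and b give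
    the two sides.\<close>
  have last: "Q a (Qs xs W) [b] = Q b (Qs xs W) [a]" for a b xs
  proof -
    define G where "G = Qs xs W"
    have G: "skew G" unfolding G_def by (rule skew_Qs[OF W])
    have "(\<Sum>c\<in>UNIV. D c (\<lambda>ls. Qs ls W [c, a, b]) xs) = 0"
      using sum_lie_der_Qs_Cons[OF W, of "[a, b]" xs] by (simp add: Qs_Cons[OF W])
    moreover have "D c G [c, a, b] = - D c (\<lambda>ls. Qs ls W [c, a, b]) xs" for c
      using QsW[of c xs "[c, a, b]"] unfolding G_def by linarith
    ultimately have "(\<Sum>c\<in>UNIV. D c G [c, a, b]) = 0"
      by (simp only: sum_negf minus_zero)
    then have "(\<Sum>c\<in>UNIV. \<Sum>\<rho>\<in>UNIV. C c a \<rho> * G [c, \<rho>, b]) + (\<Sum>c\<in>UNIV. \<Sum>\<rho>\<in>UNIV. C c b \<rho> * G [c, a, \<rho>]) = 0"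
      by (simp add: sum.distrib)
    moreover have "(\<Sum>c\<in>UNIV. \<Sum>\<rho>\<in>UNIV. C c a \<rho> * G [c, \<rho>, b]) = - Q a G [b]"
      unfolding Q_def sum_negf[symmetric]
    proof (intro sum.cong refl)
      fix c \<rho> show "C c a \<rho> * G [c, \<rho>, b] = - (C c \<rho> a * G [c, \<rho>, b])" using C_swap23[of c a \<rho>] by simp
    qed
    moreover have "(\<Sum>c\<in>UNIV. \<Sum>\<rho>\<in>UNIV. C c b \<rho> * G [c, a, \<rho>]) = Q b G [a]"
      unfolding Q_def
    proof (intro sum.cong refl)
      fix c \<rho> show "C c b \<rho> * G [c, a, \<rho>] = C c \<rho> b * G [c, \<rho>, a]"
        using C_swap23[of c b \<rho>] skewD2[OF G, of "[c]" a \<rho> "[]"] by simp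
    qed
    ultimately show ?thesis by (simp add: G_def)
  qed
  have sym: "symmetric_tensor m t"
  proof (rule symmetric_tensorI_adjacent)
    fix xs ys :: "'i list" and a b assume l: "length (xs @ a # b # ys) = m"
    show "t (xs @ a # b # ys) = t (xs @ b # a # ys)"
    proof (cases ys rule: rev_cases)
      case Nil
      then show ?thesis using tQ[of "xs @ [a]" b] tQ[of "xs @ [b]" a] l last[of a xs b] by (simp add: Qs_append)
    next
      case (snoc zs \<rho>)
      have "Q b (Q a (Qs xs W)) = Q a (Q b (Qs xs W))" by (rule Q_commute[OF skew_Qs[OF W]])
      then show ?thesis
        using snoc tQ[of "xs @ a # b # zs" \<rho>] tQ[of "xs @ b # a # zs" \<rho>] l by (simp add: Qs_append)
    qed
  qed
  \<comment> \<open>Since k < m, the list \<open>us\<close> keeps the last index, so all of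
    \<open>ks\<close> are curvature labels. The remaining contractions act after a sum that is
    already zero.\<close>
  have contr: "(\<Sum>ks | length ks = k. p ks * t (ks @ us)) = 0"
    if "0 < k" "k < m" "length us = m - k" "invariant_tensor C k p" for k p us
  proof -
    have "us \<noteq> []" using that(2,3) by auto
    then obtain us' \<rho> where "us = us' @ [\<rho>]" by (metis append_butlast_last_id)
    with that(3) have us: "us = us' @ [\<rho>]" "length us' = m - k - 1" by auto
    have "t (ks @ us) = Qs us' (Qs ks W) [\<rho>]" if "length ks = k" for ks
      using tQ[of "ks @ us'" \<rho>] that us \<open>k < m\<close> by (simp add: Qs_append)
    then have "(\<Sum>ks | length ks = k. p ks * t (ks @ us)) = Qs us' (\<lambda>js. \<Sum>ks | length ks = k. p ks * Qs ks W js) [\<rho>]"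
      by (simp add: Qs_sum Qs_scale)
    then show ?thesis using that(1,4) by (simp add: sum_invariant_Qs[OF that(4,1) W] Qs_zero)
  qed
  have nondec: "\<not> decomposable_tensor C m t"
  proof
    assume dec: "decomposable_tensor C m t"
    have "(\<Sum>is | length is = m. t is * t is) = 0"
      using sum_decomposable_eq_0[OF sym m _ dec] contr by blast
    then have "\<forall>is\<in>{is. length is = m}. t is * t is = 0" by (subst (asm) sum_nonneg_eq_0_iff) auto
    then have t0: "Qs ls W [\<rho>] = 0" if "length ls = m - 1" for ls \<rho>
      using tQ[OF that] that m by simp
    have alt: "(\<Sum>L | length L = 2 * m - 1. g L * W L) =
       (\<Sum>ls | length ls = m - 1. \<Sum>\<rho>\<in>UNIV. h (ls @ [\<rho>]) * Qs ls g [\<rho>])" if "skew g" for g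
      using sum_skew_alternate[OF that, where n = "2 * m - 1" and G = "cochain m h"] sum_cochain[OF m, of g h]
      by (simp add: W_def restrict_order_def)
    have "(\<Sum>L | length L = 2 * m - 1. W L * W L) = 0"
      unfolding alt[OF W] by (simp add: t0)
    then have "\<forall>L\<in>{L. length L = 2 * m - 1}. W L * W L = 0" by (subst (asm) sum_nonneg_eq_0_iff) auto
    then have W0: "W L = 0" if "length L = 2 * m - 1" for L using that by simp
    obtain h' where h': "perm_inv h'" "invariant_tensor C m h'" "\<And>us. length us \<noteq> m \<Longrightarrow> h' us = 0"
      "\<And>k p us. 0 < k \<Longrightarrow> k < m \<Longrightarrow> symmetric_tensor k p \<Longrightarrow> invariant_tensor C k p \<Longrightarrow>
        (\<Sum>ks | length ks = k. p ks * h' (us @ ks)) = 0"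
      "(\<Sum>us | length us = m. h us * h' us) \<noteq> 0"
      using harmonic_part_exists[OF h] by blast
    have hr: "perm_inv (restrict_order m h)" "invariant_tensor C m (restrict_order m h)"
      "(\<Sum>us | length us = m. restrict_order m h us * h' us) \<noteq> 0"
      using perm_inv_restrict_order[OF h(1)] h(2) h'(5) invariant_tensor_cong[of m "restrict_order m h" h C]
      by (simp_all add: restrict_order_def)
    obtain g where g: "skew g" "(\<Sum>ls | length ls = m - 1. \<Sum>\<rho>\<in>UNIV. restrict_order m h (ls @ [\<rho>]) * Qs ls g [\<rho>]) \<noteq> 0"
      using transgression_nonzero[OF hr(1,2) m h'(1-4) hr(3)] by blast
    have "(\<Sum>ls | length ls = m - 1. \<Sum>\<rho>\<in>UNIV. restrict_order m h (ls @ [\<rho>]) * Qs ls g [\<rho>]) =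
      (\<Sum>ls | length ls = m - 1. \<Sum>\<rho>\<in>UNIV. h (ls @ [\<rho>]) * Qs ls g [\<rho>])"
      using m by (intro sum.cong refl) (simp add: restrict_order_def)
    also have "\<dots> = 0" unfolding alt[OF g(1), symmetric] by (simp add: W0)
    finally show False using g(2) by simp
  qed
  have tr: "traceless_tensor m t" if "m > 2"
    unfolding traceless_tensor_def
  proof (intro allI impI)
    fix us :: "'i list" assume us: "length us = m - 2"
    \<comment> \<open>The metric as an invariant of order 2; it lies below the order of
      \<open>t\<close> exactly when m > 2.\<close>
    define p where "p ks = (if ks ! 0 = ks ! 1 then 1 else 0 :: real)" for ks :: "'i list"
    have "invariant_tensor C 2 p"
      unfolding invariant_tensor_lie_der
    proof (intro allI impI)
      fix \<nu> and ks :: "'i list" assume "length ks = 2"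
      then obtain a b where "ks = [a, b]" by (auto simp: numeral_2_eq_2 length_Suc_conv)
      then show "D \<nu> p ks = 0" using C_swap23[of \<nu> a b]
        by (simp add: p_def if_distrib[of "\<lambda>x. _ * x"] cong: if_cong)
    qed
    from contr[OF _ that us this] have "(\<Sum>ks | length ks = 2. p ks * t (ks @ us)) = 0" by simp
    then show "(\<Sum>\<sigma>\<in>UNIV. t (\<sigma> # \<sigma> # us)) = 0"
      by (simp add: numeral_2_eq_2 sum_len_Suc p_def if_distrib[of "\<lambda>x. x * _"] cong: if_cong)
  qed
  show ?thesis using inv sym nondec tr by (simp add: primitive_tensor_def)
qed

end

section \<open>Structure constants of a compact simple Lie algebra\<close>

locale lie_basis =
  fixes br :: "'g::real_vector \<Rightarrow> 'g \<Rightarrow> 'g" and X :: "'i::finite \<Rightarrow> 'g"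
  assumes lie: "lie_bracket br" and basis: "basis_family X"
begin

abbreviation C where "C \<equiv> structure_const br X"

lemma indep: "independent (range X)" and spanX: "v \<in> span (range X)" and injX: "inj X"
  using basis by (auto simp: basis_family_def)

lemma coord_add: "basis_coord X (u + v) k = basis_coord X u k + basis_coord X v k"
  using real_vector.representation_add[OF indep spanX spanX] by (simp add: basis_coord_def)

lemma coord_scale: "basis_coord X (c *\<^sub>R v) k = c * basis_coord X v k"
  using real_vector.representation_scale[OF indep spanX] by (simp add: basis_coord_def)

lemma coord_zero: "basis_coord X 0 k = 0"
  using coord_scale[of 0 0 k] by simp

lemma coord_sum: "basis_coord X (\<Sum>s\<in>A. f s) k = (\<Sum>s\<in>A. basis_coord X (f s) k)"
  by (induction A rule: infinite_finite_induct) (simp_all add: coord_add coord_zero)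

lemma coord_expand: "(\<Sum>k\<in>UNIV. basis_coord X v k *\<^sub>R X k) = v"
proof -
  have "(\<Sum>k\<in>UNIV. basis_coord X v k *\<^sub>R X k) = (\<Sum>b\<in>range X. representation (range X) v b *\<^sub>R b)"
    unfolding basis_coord_def using injX by (simp add: sum.reindex)
  also have "\<dots> = v"
    by (rule real_vector.sum_representation_eq[OF indep spanX]) auto
  finally show ?thesis .
qed

lemma bil: "bilinear br" using lie by (simp add: lie_bracket_def)

lemma coord_br: "basis_coord X (br (X i) v) d = (\<Sum>s\<in>UNIV. basis_coord X v s * C i s d)"
proof -
  have "linear (br (X i))" using bil by (simp add: bilinear_def)
  then have "br (X i) v = (\<Sum>s\<in>UNIV. basis_coord X v s *\<^sub>R br (X i) (X s))"
    by (subst coord_expand[of v, symmetric]) (simp add: linear_sum linear_scale)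
  then show ?thesis by (simp add: coord_sum coord_scale structure_const_def)
qed

lemma br_antisym: "br x y = - br y x"
proof -
  have "br (x + y) (x + y) = 0" "br x x = 0" "br y y = 0"
    using lie by (auto simp: lie_bracket_def)
  then show ?thesis
    by (simp add: bilinear_ladd[OF bil] bilinear_radd[OF bil] eq_neg_iff_add_eq_0 add.commute)
qed

lemma C_antisym: "C a b c = - C b a c"
  using coord_scale[of "-1" "br (X b) (X a)" c] br_antisym[of "X a" "X b"] by (simp add: structure_const_def)

lemma C_jacobi: "(\<Sum>s\<in>UNIV. C a b s * C s c d + C b c s * C s a d + C c a s * C s b d) = 0"
proof -
  have "br (X a) (br (X b) (X c)) + br (X b) (br (X c) (X a)) + br (X c) (br (X a) (X b)) = 0"
    using lie by (simp add: lie_bracket_def)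
  then have "basis_coord X (br (X a) (br (X b) (X c))) d + basis_coord X (br (X b) (br (X c) (X a))) d
      + basis_coord X (br (X c) (br (X a) (X b))) d = 0"
    by (simp add: coord_add[symmetric] coord_zero)
  then have "(\<Sum>s\<in>UNIV. C b c s * C a s d + C c a s * C b s d + C a b s * C c s d) = 0"
    by (simp add: coord_br structure_const_def[symmetric] sum.distrib)
  moreover have "(\<Sum>s\<in>UNIV. C a b s * C s c d + C b c s * C s a d + C c a s * C s b d) =
     - (\<Sum>s\<in>UNIV. C b c s * C a s d + C c a s * C b s d + C a b s * C c s d)"
    unfolding sum_negf[symmetric]
  proof (intro sum.cong refl)
    fix s
    show "C a b s * C s c d + C b c s * C s a d + C c a s * C s b d = - (C b c s * C a s d + C c a s * C b s d + C a b s * C c s d)"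
      using C_antisym[of s c d] C_antisym[of s a d] C_antisym[of s b d] by simp
  qed
  ultimately show ?thesis by simp
qed

lemma killing_coord: "killing_form br X (X i) (X j) = (\<Sum>a\<in>UNIV. \<Sum>b\<in>UNIV. C j a b * C i b a)"
  unfolding killing_form_def by (simp add: coord_br structure_const_def[symmetric])

lemma C_commutator: "(\<Sum>s\<in>UNIV. C i j s * C s a d) = (\<Sum>s\<in>UNIV. C j a s * C i s d) - (\<Sum>s\<in>UNIV. C i a s * C j s d)"
proof -
  have 1: "C j a s * C s i d = - (C j a s * C i s d)" for s
    by (subst C_antisym[of s]) simp
  have 2: "C a i s * C s j d = C i a s * C j s d" for s
    by (subst C_antisym[of s], subst C_antisym[of a]) simp
  show ?thesis using C_jacobi[of i j a d] unfolding 1 2 sum.distrib sum_negf by linarith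
qed

text \<open>\<open>C_commutator\<close> turns each sum into a difference of traces \<open>T\<close>
  of three adjoint maps; cyclicity of the trace cancels them.\<close>

lemma killing_invariant:
  "(\<Sum>s\<in>UNIV. C i j s * killing_form br X (X s) (X k)) + (\<Sum>s\<in>UNIV. C i k s * killing_form br X (X j) (X s)) = 0"
proof -
  define T where "T x y z = (\<Sum>a\<in>UNIV. \<Sum>b\<in>UNIV. \<Sum>c\<in>UNIV. C x a b * C y b c * C z c a)" for x y z
  have "(\<Sum>s\<in>UNIV. C i j s * killing_form br X (X s) (X k)) = (\<Sum>s\<in>UNIV. \<Sum>a\<in>UNIV. \<Sum>b\<in>UNIV. C k a b * (C i j s * C s b a))"
    by (simp add: killing_coord sum_distrib_left mult.left_commute)
  also have "\<dots> = (\<Sum>a\<in>UNIV. \<Sum>b\<in>UNIV. C k a b * (\<Sum>s\<in>UNIV. C i j s * C s b a))"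
    unfolding sum_distrib_left by (rule sum3_move)
  also have "\<dots> = T k j i - T k i j"
    unfolding C_commutator T_def by (simp add: right_diff_distrib sum_subtractf sum_distrib_left mult.assoc)
  finally have 1: "(\<Sum>s\<in>UNIV. C i j s * killing_form br X (X s) (X k)) = T k j i - T k i j" .
  have "(\<Sum>s\<in>UNIV. C i k s * killing_form br X (X j) (X s)) = (\<Sum>s\<in>UNIV. \<Sum>a\<in>UNIV. \<Sum>b\<in>UNIV. C j b a * (C i k s * C s a b))"
    by (simp add: killing_coord sum_distrib_left mult_ac)
  also have "\<dots> = (\<Sum>a\<in>UNIV. \<Sum>b\<in>UNIV. C j b a * (\<Sum>s\<in>UNIV. C i k s * C s a b))"
    unfolding sum_distrib_left by (rule sum3_move)
  also have "\<dots> = (\<Sum>b\<in>UNIV. \<Sum>a\<in>UNIV. C j b a * (\<Sum>s\<in>UNIV. C i k s * C s a b))"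
    by (rule sum.swap)
  also have "\<dots> = T j k i - T j i k"
    unfolding C_commutator T_def by (simp add: right_diff_distrib sum_subtractf sum_distrib_left mult.assoc)
  finally have 2: "(\<Sum>s\<in>UNIV. C i k s * killing_form br X (X j) (X s)) = T j k i - T j i k" .
  have rot: "T x y z = T y z x" for x y z
    unfolding T_def by (subst sum3_move) (simp add: mult_ac)
  show ?thesis unfolding 1 2 using rot[of k j i] rot[of k i j] rot[of j i k] rot[of i j k] rot[of j k i] rot[of i k j] by simp
qed

text \<open>For a nonzero multiple of the Kronecker delta, invariance of the Killing form is
  antisymmetry of \<open>C\<close> in its last two indices.\<close>

lemma antisym_lie_constants_if_killing_normalized:
  assumes "killing_normalized br X" shows "antisym_lie_constants C"
proof
  obtain c where c: "c > 0" and K: "\<And>i j. killing_form br X (X i) (X j) = - c * (if i = j then 1 else 0)"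
    using assms unfolding killing_normalized_def by blast
  fix i j k
  have "- c * (C i j k + C i k j) = 0"
    using killing_invariant[of i j k]
    by (simp add: K if_distrib[of "\<lambda>x. _ * x"] algebra_simps cong: if_cong)
  then show "C i j k = - C i k j" using c by simp
qed (rule C_antisym, rule C_jacobi)

end

theorem lemma3p2:
  fixes br :: "'g::real_vector \<Rightarrow> 'g \<Rightarrow> 'g"
    and X :: "'i::finite \<Rightarrow> 'g"
    and C :: "'i \<Rightarrow> 'i \<Rightarrow> 'i \<Rightarrow> real"
    and \<Omega> t :: "'i list \<Rightarrow> real"
    and m :: nat
  assumes "compact_simple_lie_algebra br X"
    and "killing_normalized br X"
    and "C = structure_const br X"
    and "primitive_cocycle C m \<Omega>"
    and "t = t_tensor C m \<Omega>"
  shows "invariant_tensor C m t \<and> symmetric_tensor m t \<and> primitive_tensor C m t \<and>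
    (m > 2 \<longrightarrow> traceless_tensor m t)"
proof -
  interpret lie_basis br X
    using assms(1) by unfold_locales (auto simp: compact_simple_lie_algebra_def simple_lie_algebra_def)
  interpret antisym_lie_constants "structure_const br X"
    by (rule antisym_lie_constants_if_killing_normalized[OF assms(2)])
  show ?thesis using t_tensor_properties assms(3-5) by simp
qed

end
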